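(* Let $\mathbf I$ and $\mathbf C$ be $2$-categories, and let $F\colon\mathbf I\to\mathbf C$ be a normal pseudo-functor. Suppose that $\mathbf C$ has tensors by the category $\mathbb 2=\{0\to1\}$. Then the following statements are equivalent. (i) There is a bi-limit $(X,\lambda)$ of $F$. (ii) There is an object $X\in \mathbf C$ together with a pseudo-natural transformation $\lambda\colon \Delta X\Rightarrow F$ in $\mathbf{Ps}(\mathbf I,\mathbf C)$ such that $(X,\lambda)$ is bi-terminal in the pseudo-slice $2$-category $\Delta\downarrow F$.
   Context: **$2$-categories.** $\mathbf{Cat}$ is the $2$-category of categories, functors and natural transformations; $\mathbf C^{\mathrm{op}}$ reverses morphisms but not $2$-morphisms. A normal pseudo-functor $F\colon\mathbf A\to\mathbf B$ between (strict) $2$-categories consists of an assignment on objects, functors $\mathbf A(A,A')\to\mathbf B(FA,FA')$, and invertible compositors $\phi_{a,a'}\colon (Fa')(Fa)\Rightarrow F(a'a)$ satisfying the usual naturality, associativity and unit axioms, with all unitors identities (so $F\mathrm{id}_A=\mathrm{id}_{FA}$). $\mathbf{Ps}(\mathbf A,\mathbf B)$ is the $2$-category of normal pseudo-functors, pseudo-natural transformations (with invertible $2$-morphism components) and modifications. $\Delta\colon\mathbf C\to\mathbf{Ps}(\mathbf I,\mathbf C)$ is the diagonal (constant-diagram) $2$-functor. **Bi-limit.** A (conical) bi-limit of $F$ is a weighted bi-limit of $F$ by the constant weight $\Delta\mathbb 1\colon\mathbf I\to\mathbf{Cat}$ at the terminal category: a pair $(X,\lambda)$ of an object $X\in\mathbf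 C$ and a pseudo-natural transformation $\lambda\colon\Delta\mathbb 1\Rightarrow\mathbf C(X,F-)$ (equivalently, a pseudo-natural transformation $\Delta X\Rightarrow F$) such that for every $C\in\mathbf C$ the functor $\mathbf C(C,X)\to\mathbf{Ps}(\mathbf I,\mathbf{Cat})(\Delta\mathbb 1,\mathbf C(C,F-))$, $f\mapsto\mathbf C(f,F-)\circ\lambda$, is an adjoint equivalence of categories. **Tensors.** A tensor of an object $C\in\mathbf C$ by a category $\mathcal A$ is a pair $(C\otimes\mathcal A,\zeta)$ of an object $C\otimes\mathcal A\in\mathbf C$ and a functor $\zeta\colon\mathcal A\to\mathbf C(C,C\otimes\mathcal A)$ such that for every $C'\in\mathbf C$ the functor $\mathbf C(C\otimes\mathcal A,C')\to\mathbf{Cat}(\mathcal A,\mathbf C(C,C'))$, $h\mapsto (h\circ-)\circ\zeta$, is an isomorphism of categories. $\mathbf C$ has tensors by $\mathcal A$ if every object has one. **Pseudo-slice $2$-category $\Delta\downarrow F$**: objects $(C,\kappa)$ with $C\in\mathbf C$ and $\kappa\colon\Delta C\Rightarrow F$ pseudo-natural; morphisms $(C,\kappa)\to(C',\kappa')$ pairs $(c,\Psi)$ of $c\colon C\to C'$ and an invertible modification $\Psi$ from $\kappa'(\Delta c)$ to $\kappa$; $2$-morphisms $(c,\Psi)\Rightarrow(d,\Phi)$ the $\beta\colon c\Rightarrow d$ in $\mathbf C$ with $\Phi\circ(\kappa'\,\Delta\beta)=\Psi$. **Bi-initial and bi-terminal objects.** For an object $I$ of a $2$-category $\mathbf A$,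 the pseudo-slice $I\downarrow\mathbf A$ has objects $(A,f\colon I\to A)$; morphisms $(A,f)\to(A',f')$ pairs $(a,\psi)$ of $a\colon A\to A'$ and an invertible $\psi\colon f'\Rightarrow af$; $2$-morphisms $(a,\psi)\Rightarrow(b,\varphi)$ the $\beta\colon a\Rightarrow b$ with $(\beta f)\circ\psi=\varphi$. A $2$-functor is a trivial fibration if it is surjective on objects, full on morphisms (every morphism $GA\to GA'$ is the image of some morphism $A\to A'$) and fully faithful on $2$-morphisms. $I$ is bi-initial if the projection $I\downarrow\mathbf A\to\mathbf A$ is a trivial fibration, and bi-terminal in $\mathbf A$ if it is bi-initial in $\mathbf A^{\mathrm{op}}$. *)

theory Defs
  imports "HOL-Library.FuncSet"
begin

section \<open>Categories, functors and natural transformations\<close>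

text \<open>
  Arrows of every kind (functors, natural transformations, pseudo-natural transformations,
  modifications, ...) carry their source and target.  Their components are required to be
  extensional, i.e. to take the value \<open>undefined\<close> outside the relevant carrier, so that HOL
  equality of such arrows is the intended equality.
\<close>

record ('o, 'a) cat =
  Obj :: "'o set"
  Arr :: "'a set"
  Dom :: "'a \<Rightarrow> 'o"
  Cod :: "'a \<Rightarrow> 'o"
  One :: "'o \<Rightarrow> 'a"
  Cmp :: "'a \<Rightarrow> 'a \<Rightarrow> 'a"  (infixr "\<odot>\<index>" 70)

definition hom :: "('o, 'a) cat \<Rightarrow> 'o \<Rightarrow> 'o \<Rightarrow> 'a set" where
  "hom K x y = {f \<in> Arr K. Dom K f = x \<and> Cod K f = y}"

locale category =
  fixes K :: "('o, 'a) cat" (structure)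
  assumes dom_obj: "f \<in> Arr K \<Longrightarrow> Dom K f \<in> Obj K"
    and cod_obj: "f \<in> Arr K \<Longrightarrow> Cod K f \<in> Obj K"
    and one_hom: "x \<in> Obj K \<Longrightarrow> One K x \<in> hom K x x"
    and cmp_hom: "\<lbrakk>f \<in> hom K x y; g \<in> hom K y z\<rbrakk> \<Longrightarrow> g \<odot> f \<in> hom K x z"
    and one_left: "f \<in> hom K x y \<Longrightarrow> One K y \<odot> f = f"
    and one_right: "f \<in> hom K x y \<Longrightarrow> f \<odot> One K x = f"
    and cmp_assoc: "\<lbrakk>f \<in> hom K w x; g \<in> hom K x y; h \<in> hom K y z\<rbrakk>
      \<Longrightarrow> (h \<odot> g) \<odot> f = h \<odot> (g \<odot> f)"

definition iso_arr :: "('o, 'a) cat \<Rightarrow> 'a \<Rightarrow> bool" where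
  "iso_arr K f \<longleftrightarrow> f \<in> Arr K \<and>
    (\<exists>g \<in> hom K (Cod K f) (Dom K f).
      g \<odot>\<^bsub>K\<^esub> f = One K (Dom K f) \<and> f \<odot>\<^bsub>K\<^esub> g = One K (Cod K f))"

record ('o, 'a, 'p, 'b) ftor =
  FDom :: "('o, 'a) cat"
  FCod :: "('p, 'b) cat"
  FObj :: "'o \<Rightarrow> 'p"
  FArr :: "'a \<Rightarrow> 'b"

locale cat_functor =
  fixes F :: "('o, 'a, 'p, 'b) ftor"
  assumes dom_category: "category (FDom F)"
    and cod_category: "category (FCod F)"
    and obj_map: "FObj F \<in> Obj (FDom F) \<rightarrow>\<^sub>E Obj (FCod F)"
    and arr_ext: "FArr F \<in> extensional (Arr (FDom F))"
    and arr_map: "f \<in> hom (FDom F) x y \<Longrightarrow> FArr F f \<in> hom (FCod F) (FObj F x) (FObj F y)"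
    and map_one: "x \<in> Obj (FDom F) \<Longrightarrow> FArr F (One (FDom F) x) = One (FCod F) (FObj F x)"
    and map_cmp: "\<lbrakk>f \<in> hom (FDom F) x y; g \<in> hom (FDom F) y z\<rbrakk>
      \<Longrightarrow> FArr F (g \<odot>\<^bsub>FDom F\<^esub> f) = FArr F g \<odot>\<^bsub>FCod F\<^esub> FArr F f"

definition id_ftor :: "('o, 'a) cat \<Rightarrow> ('o, 'a, 'o, 'a) ftor" where
  "id_ftor K = \<lparr>FDom = K, FCod = K, FObj = (\<lambda>x\<in>Obj K. x), FArr = (\<lambda>f\<in>Arr K. f)\<rparr>"

definition ftor_comp ::
    "('p, 'b, 'q, 'c) ftor \<Rightarrow> ('o, 'a, 'p, 'b) ftor \<Rightarrow> ('o, 'a, 'q, 'c) ftor" where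
  "ftor_comp G F =
    \<lparr>FDom = FDom F, FCod = FCod G,
     FObj = (\<lambda>x\<in>Obj (FDom F). FObj G (FObj F x)),
     FArr = (\<lambda>f\<in>Arr (FDom F). FArr G (FArr F f))\<rparr>"

record ('o, 'a, 'p, 'b) ntrans =
  NTDom :: "('o, 'a, 'p, 'b) ftor"
  NTCod :: "('o, 'a, 'p, 'b) ftor"
  NTMap :: "'o \<Rightarrow> 'b"

locale nat_trans =
  fixes \<tau> :: "('o, 'a, 'p, 'b) ntrans"
  assumes dom_functor: "cat_functor (NTDom \<tau>)"
    and cod_functor: "cat_functor (NTCod \<tau>)"
    and same_dom: "FDom (NTCod \<tau>) = FDom (NTDom \<tau>)"
    and same_cod: "FCod (NTCod \<tau>) = FCod (NTDom \<tau>)"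
    and map_ext: "NTMap \<tau> \<in> extensional (Obj (FDom (NTDom \<tau>)))"
    and map_hom: "x \<in> Obj (FDom (NTDom \<tau>))
      \<Longrightarrow> NTMap \<tau> x \<in> hom (FCod (NTDom \<tau>)) (FObj (NTDom \<tau>) x) (FObj (NTCod \<tau>) x)"
    and natural: "f \<in> hom (FDom (NTDom \<tau>)) x y
      \<Longrightarrow> NTMap \<tau> y \<odot>\<^bsub>FCod (NTDom \<tau>)\<^esub> FArr (NTDom \<tau>) f
          = FArr (NTCod \<tau>) f \<odot>\<^bsub>FCod (NTDom \<tau>)\<^esub> NTMap \<tau> x"

definition id_nt :: "('o, 'a, 'p, 'b) ftor \<Rightarrow> ('o, 'a, 'p, 'b) ntrans" where
  "id_nt F = \<lparr>NTDom = F, NTCod = F, NTMap = (\<lambda>x\<in>Obj (FDom F). One (FCod F) (FObj F x))\<rparr>"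

definition nt_vcomp ::
    "('o, 'a, 'p, 'b) ntrans \<Rightarrow> ('o, 'a, 'p, 'b) ntrans \<Rightarrow> ('o, 'a, 'p, 'b) ntrans" where
  "nt_vcomp \<tau> \<sigma> =
    \<lparr>NTDom = NTDom \<sigma>, NTCod = NTCod \<tau>,
     NTMap = (\<lambda>x\<in>Obj (FDom (NTDom \<sigma>)). NTMap \<tau> x \<odot>\<^bsub>FCod (NTDom \<sigma>)\<^esub> NTMap \<sigma> x)\<rparr>"

definition nt_hcomp ::
    "('p, 'b, 'q, 'c) ntrans \<Rightarrow> ('o, 'a, 'p, 'b) ntrans \<Rightarrow> ('o, 'a, 'q, 'c) ntrans" where
  "nt_hcomp \<tau> \<sigma> =
    \<lparr>NTDom = ftor_comp (NTDom \<tau>) (NTDom \<sigma>), NTCod = ftor_comp (NTCod \<tau>) (NTCod \<sigma>),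
     NTMap = (\<lambda>x\<in>Obj (FDom (NTDom \<sigma>)).
       NTMap \<tau> (FObj (NTCod \<sigma>) x) \<odot>\<^bsub>FCod (NTDom \<tau>)\<^esub> FArr (NTDom \<tau>) (NTMap \<sigma> x))\<rparr>"

definition fun_cat ::
    "('o, 'a) cat \<Rightarrow> ('p, 'b) cat \<Rightarrow> (('o, 'a, 'p, 'b) ftor, ('o, 'a, 'p, 'b) ntrans) cat" where
  "fun_cat K L =
    \<lparr>Obj = {F. cat_functor F \<and> FDom F = K \<and> FCod F = L},
     Arr = {\<tau>. nat_trans \<tau> \<and> FDom (NTDom \<tau>) = K \<and> FCod (NTDom \<tau>) = L},
     Dom = NTDom, Cod = NTCod, One = id_nt, Cmp = nt_vcomp\<rparr>"

definition cat_iso :: "('o, 'a, 'p, 'b) ftor \<Rightarrow> bool" where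
  "cat_iso F \<longleftrightarrow> cat_functor F \<and>
    (\<exists>G. cat_functor G \<and> FDom G = FCod F \<and> FCod G = FDom F \<and>
         ftor_comp G F = id_ftor (FDom F) \<and> ftor_comp F G = id_ftor (FCod F))"

definition nat_iso ::
    "('o, 'a, 'p, 'b) ntrans \<Rightarrow> ('o, 'a, 'p, 'b) ftor \<Rightarrow> ('o, 'a, 'p, 'b) ftor \<Rightarrow> bool" where
  "nat_iso \<tau> F G \<longleftrightarrow> nat_trans \<tau> \<and> NTDom \<tau> = F \<and> NTCod \<tau> = G \<and>
    (\<forall>x \<in> Obj (FDom F). iso_arr (FCod F) (NTMap \<tau> x))"

definition adjoint_equivalence :: "('o, 'a, 'p, 'b) ftor \<Rightarrow> bool" where
  "adjoint_equivalence L \<longleftrightarrow> cat_functor L \<and>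
    (\<exists>R \<eta> \<epsilon>. cat_functor R \<and> FDom R = FCod L \<and> FCod R = FDom L \<and>
      nat_iso \<eta> (id_ftor (FDom L)) (ftor_comp R L) \<and>
      nat_iso \<epsilon> (ftor_comp L R) (id_ftor (FCod L)) \<and>
      (\<forall>x \<in> Obj (FDom L).
        NTMap \<epsilon> (FObj L x) \<odot>\<^bsub>FCod L\<^esub> FArr L (NTMap \<eta> x) = One (FCod L) (FObj L x)) \<and>
      (\<forall>y \<in> Obj (FCod L).
        FArr R (NTMap \<epsilon> y) \<odot>\<^bsub>FDom L\<^esub> NTMap \<eta> (FObj R y) = One (FDom L) (FObj R y)))"

text \<open>Any category with one object and one arrow serves as the terminal category; the
  inhabitants \<open>undefined\<close> let it be formed over arbitrary types.\<close>

definition one_cat :: "('o, 'a) cat" where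
  "one_cat = \<lparr>Obj = {undefined}, Arr = {undefined}, Dom = (\<lambda>_. undefined), Cod = (\<lambda>_. undefined),
    One = (\<lambda>_. undefined), Cmp = (\<lambda>_ _. undefined)\<rparr>"

text \<open>The category \<open>{0 \<rightarrow> 1}\<close>, with \<open>False\<close> for \<open>0\<close> and \<open>True\<close> for \<open>1\<close>; the arrows are the
  pairs \<open>(x, y)\<close> with \<open>x \<le> y\<close>.\<close>

definition arrow_cat :: "(bool, bool \<times> bool) cat" where
  "arrow_cat = \<lparr>Obj = UNIV, Arr = {(x, y). x \<le> y}, Dom = fst, Cod = snd,
    One = (\<lambda>x. (x, x)), Cmp = (\<lambda>g f. (fst f, snd g))\<rparr>"


section \<open>Strict 2-categories\<close>

text \<open>\<open>\<cdot>\<close> composes morphisms, \<open>\<bullet>\<close> composes 2-morphisms vertically and \<open>\<star>\<close> horizontally;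
  \<open>Id2 C g \<star> \<alpha>\<close> and \<open>\<alpha> \<star> Id2 C f\<close> are the whiskerings.\<close>

record ('o, 'm, 'c) two_cat =
  Ob :: "'o set"
  Mor :: "'m set"
  Cell :: "'c set"
  Src :: "'m \<Rightarrow> 'o"
  Trg :: "'m \<Rightarrow> 'o"
  CSrc :: "'c \<Rightarrow> 'm"
  CTrg :: "'c \<Rightarrow> 'm"
  Id1 :: "'o \<Rightarrow> 'm"
  Comp1 :: "'m \<Rightarrow> 'm \<Rightarrow> 'm"  (infixr "\<cdot>\<index>" 75)
  Id2 :: "'m \<Rightarrow> 'c"
  VComp :: "'c \<Rightarrow> 'c \<Rightarrow> 'c"  (infixr "\<bullet>\<index>" 65)
  HComp :: "'c \<Rightarrow> 'c \<Rightarrow> 'c"  (infixr "\<star>\<index>" 70)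

definition hom1 :: "('o, 'm, 'c) two_cat \<Rightarrow> 'o \<Rightarrow> 'o \<Rightarrow> 'm set" where
  "hom1 C A B = {f \<in> Mor C. Src C f = A \<and> Trg C f = B}"

definition hom2 :: "('o, 'm, 'c) two_cat \<Rightarrow> 'm \<Rightarrow> 'm \<Rightarrow> 'c set" where
  "hom2 C f g = {\<alpha> \<in> Cell C. CSrc C \<alpha> = f \<and> CTrg C \<alpha> = g}"

definition hom_cat :: "('o, 'm, 'c) two_cat \<Rightarrow> 'o \<Rightarrow> 'o \<Rightarrow> ('m, 'c) cat" where
  "hom_cat C A B =
    \<lparr>Obj = hom1 C A B, Arr = {\<alpha> \<in> Cell C. CSrc C \<alpha> \<in> hom1 C A B},
     Dom = CSrc C, Cod = CTrg C, One = Id2 C, Cmp = VComp C\<rparr>"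

locale two_category =
  fixes C :: "('o, 'm, 'c) two_cat" (structure)
  assumes src_ob: "f \<in> Mor C \<Longrightarrow> Src C f \<in> Ob C"
    and trg_ob: "f \<in> Mor C \<Longrightarrow> Trg C f \<in> Ob C"
    and csrc_mor: "\<alpha> \<in> Cell C \<Longrightarrow> CSrc C \<alpha> \<in> Mor C"
    and ctrg_mor: "\<alpha> \<in> Cell C \<Longrightarrow> CTrg C \<alpha> \<in> hom1 C (Src C (CSrc C \<alpha>)) (Trg C (CSrc C \<alpha>))"
    and hom_category: "\<lbrakk>A \<in> Ob C; B \<in> Ob C\<rbrakk> \<Longrightarrow> category (hom_cat C A B)"
    and id1_hom: "A \<in> Ob C \<Longrightarrow> Id1 C A \<in> hom1 C A A"
    and comp1_hom: "\<lbrakk>f \<in> hom1 C X Y; g \<in> hom1 C Y Z\<rbrakk> \<Longrightarrow> g \<cdot> f \<in> hom1 C X Z"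
    and hcomp_hom: "\<lbrakk>f \<in> hom1 C X Y; g \<in> hom1 C Y Z; \<alpha> \<in> hom2 C f f'; \<beta> \<in> hom2 C g g'\<rbrakk>
      \<Longrightarrow> \<beta> \<star> \<alpha> \<in> hom2 C (g \<cdot> f) (g' \<cdot> f')"
    and id1_left: "f \<in> hom1 C X Y \<Longrightarrow> Id1 C Y \<cdot> f = f"
    and id1_right: "f \<in> hom1 C X Y \<Longrightarrow> f \<cdot> Id1 C X = f"
    and comp1_assoc: "\<lbrakk>f \<in> hom1 C W X; g \<in> hom1 C X Y; h \<in> hom1 C Y Z\<rbrakk>
      \<Longrightarrow> (h \<cdot> g) \<cdot> f = h \<cdot> (g \<cdot> f)"
    and hcomp_id_left: "\<lbrakk>f \<in> hom1 C X Y; \<alpha> \<in> hom2 C f f'\<rbrakk> \<Longrightarrow> Id2 C (Id1 C Y) \<star> \<alpha> = \<alpha>"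
    and hcomp_id_right: "\<lbrakk>f \<in> hom1 C X Y; \<alpha> \<in> hom2 C f f'\<rbrakk> \<Longrightarrow> \<alpha> \<star> Id2 C (Id1 C X) = \<alpha>"
    and hcomp_assoc: "\<lbrakk>f \<in> hom1 C W X; g \<in> hom1 C X Y; h \<in> hom1 C Y Z;
        \<alpha> \<in> hom2 C f f'; \<beta> \<in> hom2 C g g'; \<gamma> \<in> hom2 C h h'\<rbrakk>
      \<Longrightarrow> (\<gamma> \<star> \<beta>) \<star> \<alpha> = \<gamma> \<star> (\<beta> \<star> \<alpha>)"
    and hcomp_id2: "\<lbrakk>f \<in> hom1 C X Y; g \<in> hom1 C Y Z\<rbrakk> \<Longrightarrow> Id2 C g \<star> Id2 C f = Id2 C (g \<cdot> f)"
    and interchange: "\<lbrakk>f \<in> hom1 C X Y; g \<in> hom1 C Y Z; \<alpha> \<in> hom2 C f f'; \<alpha>' \<in> hom2 C f' f'';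
        \<beta> \<in> hom2 C g g'; \<beta>' \<in> hom2 C g' g''\<rbrakk>
      \<Longrightarrow> (\<beta>' \<bullet> \<beta>) \<star> (\<alpha>' \<bullet> \<alpha>) = (\<beta>' \<star> \<alpha>') \<bullet> (\<beta> \<star> \<alpha>)"

definition iso2 :: "('o, 'm, 'c) two_cat \<Rightarrow> 'm \<Rightarrow> 'm \<Rightarrow> 'c set" where
  "iso2 C f g = {\<alpha> \<in> hom2 C f g. \<exists>\<beta> \<in> hom2 C g f. \<beta> \<bullet>\<^bsub>C\<^esub> \<alpha> = Id2 C f \<and> \<alpha> \<bullet>\<^bsub>C\<^esub> \<beta> = Id2 C g}"

definition op2 :: "('o, 'm, 'c) two_cat \<Rightarrow> ('o, 'm, 'c) two_cat" where
  "op2 C = C\<lparr>Src := Trg C, Trg := Src C,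
     Comp1 := (\<lambda>g f. f \<cdot>\<^bsub>C\<^esub> g), HComp := (\<lambda>\<beta> \<alpha>. \<alpha> \<star>\<^bsub>C\<^esub> \<beta>)\<rparr>"

text \<open>The 2-category of categories with objects and arrows in the given types.\<close>

definition Cat :: "(('o, 'a) cat, ('o, 'a, 'o, 'a) ftor, ('o, 'a, 'o, 'a) ntrans) two_cat" where
  "Cat =
    \<lparr>Ob = {K. category K}, Mor = {F. cat_functor F}, Cell = {\<tau>. nat_trans \<tau>},
     Src = FDom, Trg = FCod, CSrc = NTDom, CTrg = NTCod,
     Id1 = id_ftor, Comp1 = ftor_comp, Id2 = id_nt, VComp = nt_vcomp, HComp = nt_hcomp\<rparr>"


section \<open>Normal pseudo-functors, pseudo-natural transformations, modifications\<close>

text \<open>\<open>PComp F a' a\<close> is the compositor \<open>(F a') (F a) \<Rightarrow> F (a' a)\<close>.\<close>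

record ('ao, 'am, 'ac, 'bo, 'bm, 'bc) pfun =
  PObj :: "'ao \<Rightarrow> 'bo"
  PMor :: "'am \<Rightarrow> 'bm"
  PCell :: "'ac \<Rightarrow> 'bc"
  PComp :: "'am \<Rightarrow> 'am \<Rightarrow> 'bc"

locale normal_pseudo_functor =
  fixes A :: "('ao, 'am, 'ac) two_cat"
    and B :: "('bo, 'bm, 'bc) two_cat"
    and F :: "('ao, 'am, 'ac, 'bo, 'bm, 'bc) pfun"
  assumes ob_map: "X \<in> Ob A \<Longrightarrow> PObj F X \<in> Ob B"
    and mor_map: "a \<in> hom1 A X Y \<Longrightarrow> PMor F a \<in> hom1 B (PObj F X) (PObj F Y)"
    and cell_map: "\<alpha> \<in> hom2 A a b \<Longrightarrow> PCell F \<alpha> \<in> hom2 B (PMor F a) (PMor F b)"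
    and map_id2: "a \<in> Mor A \<Longrightarrow> PCell F (Id2 A a) = Id2 B (PMor F a)"
    and map_vcomp: "\<lbrakk>\<alpha> \<in> hom2 A a b; \<beta> \<in> hom2 A b c\<rbrakk>
      \<Longrightarrow> PCell F (\<beta> \<bullet>\<^bsub>A\<^esub> \<alpha>) = PCell F \<beta> \<bullet>\<^bsub>B\<^esub> PCell F \<alpha>"
    and comp_iso: "\<lbrakk>a \<in> hom1 A X Y; a' \<in> hom1 A Y Z\<rbrakk>
      \<Longrightarrow> PComp F a' a \<in> iso2 B (PMor F a' \<cdot>\<^bsub>B\<^esub> PMor F a) (PMor F (a' \<cdot>\<^bsub>A\<^esub> a))"
    and comp_natural: "\<lbrakk>a \<in> hom1 A X Y; a' \<in> hom1 A Y Z; \<alpha> \<in> hom2 A a b; \<alpha>' \<in> hom2 A a' b'\<rbrakk>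
      \<Longrightarrow> PComp F b' b \<bullet>\<^bsub>B\<^esub> (PCell F \<alpha>' \<star>\<^bsub>B\<^esub> PCell F \<alpha>) = PCell F (\<alpha>' \<star>\<^bsub>A\<^esub> \<alpha>) \<bullet>\<^bsub>B\<^esub> PComp F a' a"
    and comp_assoc: "\<lbrakk>a \<in> hom1 A W X; a' \<in> hom1 A X Y; a'' \<in> hom1 A Y Z\<rbrakk>
      \<Longrightarrow> PComp F a'' (a' \<cdot>\<^bsub>A\<^esub> a) \<bullet>\<^bsub>B\<^esub> (Id2 B (PMor F a'') \<star>\<^bsub>B\<^esub> PComp F a' a)
          = PComp F (a'' \<cdot>\<^bsub>A\<^esub> a') a \<bullet>\<^bsub>B\<^esub> (PComp F a'' a' \<star>\<^bsub>B\<^esub> Id2 B (PMor F a))"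
    and map_id1: "X \<in> Ob A \<Longrightarrow> PMor F (Id1 A X) = Id1 B (PObj F X)"
    and comp_id_right: "a \<in> hom1 A X Y \<Longrightarrow> PComp F a (Id1 A X) = Id2 B (PMor F a)"
    and comp_id_left: "a \<in> hom1 A X Y \<Longrightarrow> PComp F (Id1 A Y) a = Id2 B (PMor F a)"

text \<open>A 2-functor is a normal pseudo-functor whose compositors are identities.\<close>

definition two_functor ::
    "('ao, 'am, 'ac) two_cat \<Rightarrow> ('bo, 'bm, 'bc) two_cat
      \<Rightarrow> ('ao, 'am, 'ac, 'bo, 'bm, 'bc) pfun \<Rightarrow> bool" where
  "two_functor A B F \<longleftrightarrow> normal_pseudo_functor A B F \<and>
    (\<forall>a \<in> Mor A. \<forall>a' \<in> Mor A. Trg A a = Src A a' \<longrightarrow>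
      PComp F a' a = Id2 B (PMor F a' \<cdot>\<^bsub>B\<^esub> PMor F a))"

text \<open>For \<open>a : X \<rightarrow> Y\<close>, the component \<open>NMor \<theta> a\<close> of \<open>\<theta> : F \<Rightarrow> G\<close> is an invertible 2-morphism
  \<open>(G a) \<theta>\<^sub>X \<Rightarrow> \<theta>\<^sub>Y (F a)\<close>.\<close>

record ('ao, 'am, 'ac, 'bo, 'bm, 'bc) psnat =
  NDom :: "('ao, 'am, 'ac, 'bo, 'bm, 'bc) pfun"
  NCod :: "('ao, 'am, 'ac, 'bo, 'bm, 'bc) pfun"
  NObj :: "'ao \<Rightarrow> 'bm"
  NMor :: "'am \<Rightarrow> 'bc"

locale pseudo_nat =
  fixes A :: "('ao, 'am, 'ac) two_cat"
    and B :: "('bo, 'bm, 'bc) two_cat"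
    and \<theta> :: "('ao, 'am, 'ac, 'bo, 'bm, 'bc) psnat"
  assumes dom_pseudo_functor: "normal_pseudo_functor A B (NDom \<theta>)"
    and cod_pseudo_functor: "normal_pseudo_functor A B (NCod \<theta>)"
    and obj_ext: "NObj \<theta> \<in> extensional (Ob A)"
    and mor_ext: "NMor \<theta> \<in> extensional (Mor A)"
    and obj_comp: "X \<in> Ob A \<Longrightarrow> NObj \<theta> X \<in> hom1 B (PObj (NDom \<theta>) X) (PObj (NCod \<theta>) X)"
    and mor_comp: "a \<in> hom1 A X Y \<Longrightarrow> NMor \<theta> a \<in>
      iso2 B (PMor (NCod \<theta>) a \<cdot>\<^bsub>B\<^esub> NObj \<theta> X) (NObj \<theta> Y \<cdot>\<^bsub>B\<^esub> PMor (NDom \<theta>) a)"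
    and natural: "\<lbrakk>a \<in> hom1 A X Y; \<alpha> \<in> hom2 A a b\<rbrakk>
      \<Longrightarrow> NMor \<theta> b \<bullet>\<^bsub>B\<^esub> (PCell (NCod \<theta>) \<alpha> \<star>\<^bsub>B\<^esub> Id2 B (NObj \<theta> X))
          = (Id2 B (NObj \<theta> Y) \<star>\<^bsub>B\<^esub> PCell (NDom \<theta>) \<alpha>) \<bullet>\<^bsub>B\<^esub> NMor \<theta> a"
    and respects_comp: "\<lbrakk>a \<in> hom1 A X Y; a' \<in> hom1 A Y Z\<rbrakk>
      \<Longrightarrow> NMor \<theta> (a' \<cdot>\<^bsub>A\<^esub> a) \<bullet>\<^bsub>B\<^esub> (PComp (NCod \<theta>) a' a \<star>\<^bsub>B\<^esub> Id2 B (NObj \<theta> X))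
          = (Id2 B (NObj \<theta> Z) \<star>\<^bsub>B\<^esub> PComp (NDom \<theta>) a' a) \<bullet>\<^bsub>B\<^esub>
            (NMor \<theta> a' \<star>\<^bsub>B\<^esub> Id2 B (PMor (NDom \<theta>) a)) \<bullet>\<^bsub>B\<^esub>
            (Id2 B (PMor (NCod \<theta>) a') \<star>\<^bsub>B\<^esub> NMor \<theta> a)"
    and respects_id: "X \<in> Ob A \<Longrightarrow> NMor \<theta> (Id1 A X) = Id2 B (NObj \<theta> X)"

definition id_psnat ::
    "('ao, 'am, 'ac) two_cat \<Rightarrow> ('bo, 'bm, 'bc) two_cat
      \<Rightarrow> ('ao, 'am, 'ac, 'bo, 'bm, 'bc) pfun \<Rightarrow> ('ao, 'am, 'ac, 'bo, 'bm, 'bc) psnat" where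
  "id_psnat A B F =
    \<lparr>NDom = F, NCod = F,
     NObj = (\<lambda>X\<in>Ob A. Id1 B (PObj F X)), NMor = (\<lambda>a\<in>Mor A. Id2 B (PMor F a))\<rparr>"

definition psnat_comp ::
    "('ao, 'am, 'ac) two_cat \<Rightarrow> ('bo, 'bm, 'bc) two_cat
      \<Rightarrow> ('ao, 'am, 'ac, 'bo, 'bm, 'bc) psnat \<Rightarrow> ('ao, 'am, 'ac, 'bo, 'bm, 'bc) psnat
      \<Rightarrow> ('ao, 'am, 'ac, 'bo, 'bm, 'bc) psnat" where
  "psnat_comp A B \<upsilon> \<theta> =
    \<lparr>NDom = NDom \<theta>, NCod = NCod \<upsilon>,
     NObj = (\<lambda>X\<in>Ob A. NObj \<upsilon> X \<cdot>\<^bsub>B\<^esub> NObj \<theta> X),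
     NMor = (\<lambda>a\<in>Mor A. (Id2 B (NObj \<upsilon> (Trg A a)) \<star>\<^bsub>B\<^esub> NMor \<theta> a) \<bullet>\<^bsub>B\<^esub>
                        (NMor \<upsilon> a \<star>\<^bsub>B\<^esub> Id2 B (NObj \<theta> (Src A a))))\<rparr>"

record ('ao, 'am, 'ac, 'bo, 'bm, 'bc) modif =
  MDom :: "('ao, 'am, 'ac, 'bo, 'bm, 'bc) psnat"
  MCod :: "('ao, 'am, 'ac, 'bo, 'bm, 'bc) psnat"
  MObj :: "'ao \<Rightarrow> 'bc"

locale modification =
  fixes A :: "('ao, 'am, 'ac) two_cat"
    and B :: "('bo, 'bm, 'bc) two_cat"
    and \<Gamma> :: "('ao, 'am, 'ac, 'bo, 'bm, 'bc) modif"
  assumes dom_pseudo_nat: "pseudo_nat A B (MDom \<Gamma>)"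
    and cod_pseudo_nat: "pseudo_nat A B (MCod \<Gamma>)"
    and same_dom: "NDom (MCod \<Gamma>) = NDom (MDom \<Gamma>)"
    and same_cod: "NCod (MCod \<Gamma>) = NCod (MDom \<Gamma>)"
    and comp_ext: "MObj \<Gamma> \<in> extensional (Ob A)"
    and comp_cell: "X \<in> Ob A \<Longrightarrow> MObj \<Gamma> X \<in> hom2 B (NObj (MDom \<Gamma>) X) (NObj (MCod \<Gamma>) X)"
    and compatible: "a \<in> hom1 A X Y
      \<Longrightarrow> (MObj \<Gamma> Y \<star>\<^bsub>B\<^esub> Id2 B (PMor (NDom (MDom \<Gamma>)) a)) \<bullet>\<^bsub>B\<^esub> NMor (MDom \<Gamma>) a
          = NMor (MCod \<Gamma>) a \<bullet>\<^bsub>B\<^esub> (Id2 B (PMor (NCod (MDom \<Gamma>)) a) \<star>\<^bsub>B\<^esub> MObj \<Gamma> X)"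

definition id_modif ::
    "('ao, 'am, 'ac) two_cat \<Rightarrow> ('bo, 'bm, 'bc) two_cat
      \<Rightarrow> ('ao, 'am, 'ac, 'bo, 'bm, 'bc) psnat \<Rightarrow> ('ao, 'am, 'ac, 'bo, 'bm, 'bc) modif" where
  "id_modif A B \<theta> = \<lparr>MDom = \<theta>, MCod = \<theta>, MObj = (\<lambda>X\<in>Ob A. Id2 B (NObj \<theta> X))\<rparr>"

definition modif_vcomp ::
    "('ao, 'am, 'ac) two_cat \<Rightarrow> ('bo, 'bm, 'bc) two_cat
      \<Rightarrow> ('ao, 'am, 'ac, 'bo, 'bm, 'bc) modif \<Rightarrow> ('ao, 'am, 'ac, 'bo, 'bm, 'bc) modif
      \<Rightarrow> ('ao, 'am, 'ac, 'bo, 'bm, 'bc) modif" where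
  "modif_vcomp A B \<Delta> \<Gamma> =
    \<lparr>MDom = MDom \<Gamma>, MCod = MCod \<Delta>, MObj = (\<lambda>X\<in>Ob A. MObj \<Delta> X \<bullet>\<^bsub>B\<^esub> MObj \<Gamma> X)\<rparr>"

definition modif_hcomp ::
    "('ao, 'am, 'ac) two_cat \<Rightarrow> ('bo, 'bm, 'bc) two_cat
      \<Rightarrow> ('ao, 'am, 'ac, 'bo, 'bm, 'bc) modif \<Rightarrow> ('ao, 'am, 'ac, 'bo, 'bm, 'bc) modif
      \<Rightarrow> ('ao, 'am, 'ac, 'bo, 'bm, 'bc) modif" where
  "modif_hcomp A B \<Delta> \<Gamma> =
    \<lparr>MDom = psnat_comp A B (MDom \<Delta>) (MDom \<Gamma>), MCod = psnat_comp A B (MCod \<Delta>) (MCod \<Gamma>),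
     MObj = (\<lambda>X\<in>Ob A. MObj \<Delta> X \<star>\<^bsub>B\<^esub> MObj \<Gamma> X)\<rparr>"

definition Ps ::
    "('ao, 'am, 'ac) two_cat \<Rightarrow> ('bo, 'bm, 'bc) two_cat
      \<Rightarrow> (('ao, 'am, 'ac, 'bo, 'bm, 'bc) pfun,
          ('ao, 'am, 'ac, 'bo, 'bm, 'bc) psnat,
          ('ao, 'am, 'ac, 'bo, 'bm, 'bc) modif) two_cat" where
  "Ps A B =
    \<lparr>Ob = {F. normal_pseudo_functor A B F}, Mor = {\<theta>. pseudo_nat A B \<theta>},
     Cell = {\<Gamma>. modification A B \<Gamma>},
     Src = NDom, Trg = NCod, CSrc = MDom, CTrg = MCod,
     Id1 = id_psnat A B, Comp1 = psnat_comp A B,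
     Id2 = id_modif A B, VComp = modif_vcomp A B, HComp = modif_hcomp A B\<rparr>"

text \<open>The diagonal 2-functor on objects, morphisms and 2-morphisms.\<close>

definition diag_ob ::
    "('bo, 'bm, 'bc) two_cat \<Rightarrow> 'bo \<Rightarrow> ('ao, 'am, 'ac, 'bo, 'bm, 'bc) pfun" where
  "diag_ob B X =
    \<lparr>PObj = (\<lambda>_. X), PMor = (\<lambda>_. Id1 B X), PCell = (\<lambda>_. Id2 B (Id1 B X)),
     PComp = (\<lambda>_ _. Id2 B (Id1 B X))\<rparr>"

definition diag_mor ::
    "('ao, 'am, 'ac) two_cat \<Rightarrow> ('bo, 'bm, 'bc) two_cat
      \<Rightarrow> 'bm \<Rightarrow> ('ao, 'am, 'ac, 'bo, 'bm, 'bc) psnat" where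
  "diag_mor A B f =
    \<lparr>NDom = diag_ob B (Src B f), NCod = diag_ob B (Trg B f),
     NObj = (\<lambda>X\<in>Ob A. f), NMor = (\<lambda>a\<in>Mor A. Id2 B f)\<rparr>"

definition diag_cell ::
    "('ao, 'am, 'ac) two_cat \<Rightarrow> ('bo, 'bm, 'bc) two_cat
      \<Rightarrow> 'bc \<Rightarrow> ('ao, 'am, 'ac, 'bo, 'bm, 'bc) modif" where
  "diag_cell A B \<beta> =
    \<lparr>MDom = diag_mor A B (CSrc B \<beta>), MCod = diag_mor A B (CTrg B \<beta>), MObj = (\<lambda>X\<in>Ob A. \<beta>)\<rparr>"


section \<open>Hom-functors and tensors\<close>

definition postcomp :: "('o, 'm, 'c) two_cat \<Rightarrow> 'o \<Rightarrow> 'm \<Rightarrow> ('m, 'c, 'm, 'c) ftor" where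
  "postcomp C X h =
    \<lparr>FDom = hom_cat C X (Src C h), FCod = hom_cat C X (Trg C h),
     FObj = (\<lambda>f\<in>Obj (hom_cat C X (Src C h)). h \<cdot>\<^bsub>C\<^esub> f),
     FArr = (\<lambda>\<alpha>\<in>Arr (hom_cat C X (Src C h)). Id2 C h \<star>\<^bsub>C\<^esub> \<alpha>)\<rparr>"

definition postcomp2 :: "('o, 'm, 'c) two_cat \<Rightarrow> 'o \<Rightarrow> 'c \<Rightarrow> ('m, 'c, 'm, 'c) ntrans" where
  "postcomp2 C X \<theta> =
    \<lparr>NTDom = postcomp C X (CSrc C \<theta>), NTCod = postcomp C X (CTrg C \<theta>),
     NTMap = (\<lambda>f\<in>Obj (hom_cat C X (Src C (CSrc C \<theta>))). \<theta> \<star>\<^bsub>C\<^esub> Id2 C f)\<rparr>"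

definition precomp :: "('o, 'm, 'c) two_cat \<Rightarrow> 'm \<Rightarrow> 'o \<Rightarrow> ('m, 'c, 'm, 'c) ftor" where
  "precomp C f Y =
    \<lparr>FDom = hom_cat C (Trg C f) Y, FCod = hom_cat C (Src C f) Y,
     FObj = (\<lambda>g\<in>Obj (hom_cat C (Trg C f) Y). g \<cdot>\<^bsub>C\<^esub> f),
     FArr = (\<lambda>\<beta>\<in>Arr (hom_cat C (Trg C f) Y). \<beta> \<star>\<^bsub>C\<^esub> Id2 C f)\<rparr>"

definition precomp2 :: "('o, 'm, 'c) two_cat \<Rightarrow> 'c \<Rightarrow> 'o \<Rightarrow> ('m, 'c, 'm, 'c) ntrans" where
  "precomp2 C \<alpha> Y =
    \<lparr>NTDom = precomp C (CSrc C \<alpha>) Y, NTCod = precomp C (CTrg C \<alpha>) Y,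
     NTMap = (\<lambda>g\<in>Obj (hom_cat C (Trg C (CSrc C \<alpha>)) Y). Id2 C g \<star>\<^bsub>C\<^esub> \<alpha>)\<rparr>"

definition tensor_comparison ::
    "('o, 'm, 'c) two_cat \<Rightarrow> ('p, 'b) cat \<Rightarrow> 'o \<Rightarrow> 'o \<Rightarrow> ('p, 'b, 'm, 'c) ftor \<Rightarrow> 'o
      \<Rightarrow> ('m, 'c, ('p, 'b, 'm, 'c) ftor, ('p, 'b, 'm, 'c) ntrans) ftor" where
  "tensor_comparison C \<A> X T \<zeta> Y =
    \<lparr>FDom = hom_cat C T Y, FCod = fun_cat \<A> (hom_cat C X Y),
     FObj = (\<lambda>h\<in>Obj (hom_cat C T Y). ftor_comp (postcomp C X h) \<zeta>),
     FArr = (\<lambda>\<theta>\<in>Arr (hom_cat C T Y). nt_hcomp (postcomp2 C X \<theta>) (id_nt \<zeta>))\<rparr>"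

definition is_tensor ::
    "('o, 'm, 'c) two_cat \<Rightarrow> ('p, 'b) cat \<Rightarrow> 'o \<Rightarrow> 'o \<Rightarrow> ('p, 'b, 'm, 'c) ftor \<Rightarrow> bool" where
  "is_tensor C \<A> X T \<zeta> \<longleftrightarrow>
    T \<in> Ob C \<and> cat_functor \<zeta> \<and> FDom \<zeta> = \<A> \<and> FCod \<zeta> = hom_cat C X T \<and>
    (\<forall>Y \<in> Ob C. cat_iso (tensor_comparison C \<A> X T \<zeta> Y))"

definition has_tensors_by :: "('o, 'm, 'c) two_cat \<Rightarrow> ('p, 'b) cat \<Rightarrow> bool" where
  "has_tensors_by C \<A> \<longleftrightarrow> (\<forall>X \<in> Ob C. \<exists>T \<zeta>. is_tensor C \<A> X T \<zeta>)"


section \<open>Bi-limits\<close>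

text \<open>The pseudo-functor \<open>C(X, F-)\<close>, the pseudo-natural transformation \<open>C(f, F-)\<close> and the
  modification \<open>C(\<alpha>, F-)\<close>.  The squares of \<open>C(f, F-)\<close> commute strictly, so its 2-morphism
  components are identities.\<close>

definition hom_pfun ::
    "('o, 'm, 'c) two_cat \<Rightarrow> ('io, 'im, 'ic, 'o, 'm, 'c) pfun \<Rightarrow> 'o
      \<Rightarrow> ('io, 'im, 'ic, ('m, 'c) cat, ('m, 'c, 'm, 'c) ftor, ('m, 'c, 'm, 'c) ntrans) pfun" where
  "hom_pfun C F X =
    \<lparr>PObj = (\<lambda>i. hom_cat C X (PObj F i)), PMor = (\<lambda>u. postcomp C X (PMor F u)),
     PCell = (\<lambda>\<alpha>. postcomp2 C X (PCell F \<alpha>)), PComp = (\<lambda>u' u. postcomp2 C X (PComp F u' u))\<rparr>"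

definition hom_psnat ::
    "('io, 'im, 'ic) two_cat \<Rightarrow> ('o, 'm, 'c) two_cat \<Rightarrow> ('io, 'im, 'ic, 'o, 'm, 'c) pfun \<Rightarrow> 'm
      \<Rightarrow> ('io, 'im, 'ic, ('m, 'c) cat, ('m, 'c, 'm, 'c) ftor, ('m, 'c, 'm, 'c) ntrans) psnat" where
  "hom_psnat I C F f =
    \<lparr>NDom = hom_pfun C F (Trg C f), NCod = hom_pfun C F (Src C f),
     NObj = (\<lambda>i\<in>Ob I. precomp C f (PObj F i)),
     NMor = (\<lambda>u\<in>Mor I. id_nt (ftor_comp (postcomp C (Src C f) (PMor F u))
                                          (precomp C f (PObj F (Src I u)))))\<rparr>"

definition hom_modif ::
    "('io, 'im, 'ic) two_cat \<Rightarrow> ('o, 'm, 'c) two_cat \<Rightarrow> ('io, 'im, 'ic, 'o, 'm, 'c) pfun \<Rightarrow> 'c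
      \<Rightarrow> ('io, 'im, 'ic, ('m, 'c) cat, ('m, 'c, 'm, 'c) ftor, ('m, 'c, 'm, 'c) ntrans) modif" where
  "hom_modif I C F \<alpha> =
    \<lparr>MDom = hom_psnat I C F (CSrc C \<alpha>), MCod = hom_psnat I C F (CTrg C \<alpha>),
     MObj = (\<lambda>i\<in>Ob I. precomp2 C \<alpha> (PObj F i))\<rparr>"

text \<open>The functor \<open>C(Y, X) \<rightarrow> Ps(I, Cat)(\<Delta>1, C(Y, F-))\<close>, \<open>f \<mapsto> C(f, F-) \<circ> \<lambda>\<close>.\<close>

definition bilimit_comparison ::
    "('io, 'im, 'ic) two_cat \<Rightarrow> ('o, 'm, 'c) two_cat \<Rightarrow> ('io, 'im, 'ic, 'o, 'm, 'c) pfun \<Rightarrow> 'o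
      \<Rightarrow> ('io, 'im, 'ic, ('m, 'c) cat, ('m, 'c, 'm, 'c) ftor, ('m, 'c, 'm, 'c) ntrans) psnat \<Rightarrow> 'o
      \<Rightarrow> ('m, 'c,
          ('io, 'im, 'ic, ('m, 'c) cat, ('m, 'c, 'm, 'c) ftor, ('m, 'c, 'm, 'c) ntrans) psnat,
          ('io, 'im, 'ic, ('m, 'c) cat, ('m, 'c, 'm, 'c) ftor, ('m, 'c, 'm, 'c) ntrans) modif) ftor"
  where
  "bilimit_comparison I C F X l Y =
    \<lparr>FDom = hom_cat C Y X,
     FCod = hom_cat (Ps I Cat) (diag_ob Cat one_cat) (hom_pfun C F Y),
     FObj = (\<lambda>f\<in>Obj (hom_cat C Y X). hom_psnat I C F f \<cdot>\<^bsub>Ps I Cat\<^esub> l),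
     FArr = (\<lambda>\<alpha>\<in>Arr (hom_cat C Y X). hom_modif I C F \<alpha> \<star>\<^bsub>Ps I Cat\<^esub> Id2 (Ps I Cat) l)\<rparr>"

definition is_bilimit ::
    "('io, 'im, 'ic) two_cat \<Rightarrow> ('o, 'm, 'c) two_cat \<Rightarrow> ('io, 'im, 'ic, 'o, 'm, 'c) pfun \<Rightarrow> 'o
      \<Rightarrow> ('io, 'im, 'ic, ('m, 'c) cat, ('m, 'c, 'm, 'c) ftor, ('m, 'c, 'm, 'c) ntrans) psnat
      \<Rightarrow> bool" where
  "is_bilimit I C F X l \<longleftrightarrow>
    X \<in> Ob C \<and> l \<in> hom1 (Ps I Cat) (diag_ob Cat one_cat) (hom_pfun C F X) \<and>
    (\<forall>Y \<in> Ob C. adjoint_equivalence (bilimit_comparison I C F X l Y))"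


section \<open>The pseudo-slice of cones\<close>

text \<open>Morphisms and 2-morphisms are stored as triples (source, data, target).\<close>

type_synonym ('io, 'im, 'ic, 'o, 'm, 'c) cone = "'o \<times> ('io, 'im, 'ic, 'o, 'm, 'c) psnat"

type_synonym ('io, 'im, 'ic, 'o, 'm, 'c) cone_mor =
  "('io, 'im, 'ic, 'o, 'm, 'c) cone \<times> ('m \<times> ('io, 'im, 'ic, 'o, 'm, 'c) modif)
    \<times> ('io, 'im, 'ic, 'o, 'm, 'c) cone"

definition cones ::
    "('io, 'im, 'ic) two_cat \<Rightarrow> ('o, 'm, 'c) two_cat \<Rightarrow> ('io, 'im, 'ic, 'o, 'm, 'c) pfun
      \<Rightarrow> ('io, 'im, 'ic, 'o, 'm, 'c) cone set" where
  "cones I C F = {(X, \<kappa>). X \<in> Ob C \<and> \<kappa> \<in> hom1 (Ps I C) (diag_ob C X) F}"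

definition cone_mors ::
    "('io, 'im, 'ic) two_cat \<Rightarrow> ('o, 'm, 'c) two_cat \<Rightarrow> ('io, 'im, 'ic, 'o, 'm, 'c) pfun
      \<Rightarrow> ('io, 'im, 'ic, 'o, 'm, 'c) cone_mor set" where
  "cone_mors I C F = {((X, \<kappa>), (c, \<Psi>), (X', \<kappa>')).
    (X, \<kappa>) \<in> cones I C F \<and> (X', \<kappa>') \<in> cones I C F \<and>
    c \<in> hom1 C X X' \<and> \<Psi> \<in> iso2 (Ps I C) (\<kappa>' \<cdot>\<^bsub>Ps I C\<^esub> diag_mor I C c) \<kappa>}"

definition cone_cells ::
    "('io, 'im, 'ic) two_cat \<Rightarrow> ('o, 'm, 'c) two_cat \<Rightarrow> ('io, 'im, 'ic, 'o, 'm, 'c) pfun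
      \<Rightarrow> (('io, 'im, 'ic, 'o, 'm, 'c) cone_mor \<times> 'c \<times> ('io, 'im, 'ic, 'o, 'm, 'c) cone_mor) set"
  where
  "cone_cells I C F = {(((X, \<kappa>), (c, \<Psi>), (X', \<kappa>')), \<beta>, ((Y, \<mu>), (d, \<Phi>), (Y', \<mu>'))).
    ((X, \<kappa>), (c, \<Psi>), (X', \<kappa>')) \<in> cone_mors I C F \<and>
    ((Y, \<mu>), (d, \<Phi>), (Y', \<mu>')) \<in> cone_mors I C F \<and>
    (Y, \<mu>) = (X, \<kappa>) \<and> (Y', \<mu>') = (X', \<kappa>') \<and>
    \<beta> \<in> hom2 C c d \<and>
    \<Phi> \<bullet>\<^bsub>Ps I C\<^esub> (Id2 (Ps I C) \<kappa>' \<star>\<^bsub>Ps I C\<^esub> diag_cell I C \<beta>) = \<Psi>}"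

definition cone_id ::
    "('io, 'im, 'ic) two_cat \<Rightarrow> ('o, 'm, 'c) two_cat
      \<Rightarrow> ('io, 'im, 'ic, 'o, 'm, 'c) cone \<Rightarrow> ('io, 'im, 'ic, 'o, 'm, 'c) cone_mor" where
  "cone_id I C = (\<lambda>(X, \<kappa>). ((X, \<kappa>), (Id1 C X, Id2 (Ps I C) \<kappa>), (X, \<kappa>)))"

definition cone_comp ::
    "('io, 'im, 'ic) two_cat \<Rightarrow> ('o, 'm, 'c) two_cat
      \<Rightarrow> ('io, 'im, 'ic, 'o, 'm, 'c) cone_mor \<Rightarrow> ('io, 'im, 'ic, 'o, 'm, 'c) cone_mor
      \<Rightarrow> ('io, 'im, 'ic, 'o, 'm, 'c) cone_mor" where
  "cone_comp I C = (\<lambda>(_, (c', \<Psi>'), Z) (X, (c, \<Psi>), _).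
    (X, (c' \<cdot>\<^bsub>C\<^esub> c,
         \<Psi> \<bullet>\<^bsub>Ps I C\<^esub> (\<Psi>' \<star>\<^bsub>Ps I C\<^esub> Id2 (Ps I C) (diag_mor I C c))), Z))"

definition cone_slice ::
    "('io, 'im, 'ic) two_cat \<Rightarrow> ('o, 'm, 'c) two_cat \<Rightarrow> ('io, 'im, 'ic, 'o, 'm, 'c) pfun
      \<Rightarrow> (('io, 'im, 'ic, 'o, 'm, 'c) cone, ('io, 'im, 'ic, 'o, 'm, 'c) cone_mor,
          ('io, 'im, 'ic, 'o, 'm, 'c) cone_mor \<times> 'c \<times> ('io, 'im, 'ic, 'o, 'm, 'c) cone_mor) two_cat"
  where
  "cone_slice I C F =
    \<lparr>Ob = cones I C F, Mor = cone_mors I C F, Cell = cone_cells I C F,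
     Src = (\<lambda>(X, _, _). X), Trg = (\<lambda>(_, _, Y). Y),
     CSrc = (\<lambda>(p, _, _). p), CTrg = (\<lambda>(_, _, q). q),
     Id1 = cone_id I C, Comp1 = cone_comp I C,
     Id2 = (\<lambda>(X, (c, \<Psi>), Y). ((X, (c, \<Psi>), Y), Id2 C c, (X, (c, \<Psi>), Y))),
     VComp = (\<lambda>(_, \<beta>', r) (p, \<beta>, _). (p, \<beta>' \<bullet>\<^bsub>C\<^esub> \<beta>, r)),
     HComp = (\<lambda>(p', \<beta>', q') (p, \<beta>, q). (cone_comp I C p' p, \<beta>' \<star>\<^bsub>C\<^esub> \<beta>, cone_comp I C q' q))\<rparr>"


section \<open>Bi-initial and bi-terminal objects\<close>

type_synonym ('o, 'm, 'c) slice_mor = "('o \<times> 'm) \<times> ('m \<times> 'c) \<times> ('o \<times> 'm)"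

definition slice_obs :: "('o, 'm, 'c) two_cat \<Rightarrow> 'o \<Rightarrow> ('o \<times> 'm) set" where
  "slice_obs A X = {(Y, f). Y \<in> Ob A \<and> f \<in> hom1 A X Y}"

definition slice_mors :: "('o, 'm, 'c) two_cat \<Rightarrow> 'o \<Rightarrow> ('o, 'm, 'c) slice_mor set" where
  "slice_mors A X = {((Y, f), (a, \<psi>), (Y', f')).
    (Y, f) \<in> slice_obs A X \<and> (Y', f') \<in> slice_obs A X \<and>
    a \<in> hom1 A Y Y' \<and> \<psi> \<in> iso2 A f' (a \<cdot>\<^bsub>A\<^esub> f)}"

definition slice_cells ::
    "('o, 'm, 'c) two_cat \<Rightarrow> 'o
      \<Rightarrow> (('o, 'm, 'c) slice_mor \<times> 'c \<times> ('o, 'm, 'c) slice_mor) set" where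
  "slice_cells A X = {(((Y, f), (a, \<psi>), (Y', f')), \<beta>, ((Z, g), (b, \<phi>), (Z', g'))).
    ((Y, f), (a, \<psi>), (Y', f')) \<in> slice_mors A X \<and>
    ((Z, g), (b, \<phi>), (Z', g')) \<in> slice_mors A X \<and>
    (Z, g) = (Y, f) \<and> (Z', g') = (Y', f') \<and>
    \<beta> \<in> hom2 A a b \<and> (\<beta> \<star>\<^bsub>A\<^esub> Id2 A f) \<bullet>\<^bsub>A\<^esub> \<psi> = \<phi>}"

definition slice_id :: "('o, 'm, 'c) two_cat \<Rightarrow> 'o \<times> 'm \<Rightarrow> ('o, 'm, 'c) slice_mor" where
  "slice_id A = (\<lambda>(Y, f). ((Y, f), (Id1 A Y, Id2 A f), (Y, f)))"

definition slice_comp ::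
    "('o, 'm, 'c) two_cat
      \<Rightarrow> ('o, 'm, 'c) slice_mor \<Rightarrow> ('o, 'm, 'c) slice_mor \<Rightarrow> ('o, 'm, 'c) slice_mor" where
  "slice_comp A = (\<lambda>(_, (a', \<psi>'), Z) (Y, (a, \<psi>), _).
    (Y, (a' \<cdot>\<^bsub>A\<^esub> a, (Id2 A a' \<star>\<^bsub>A\<^esub> \<psi>) \<bullet>\<^bsub>A\<^esub> \<psi>'), Z))"

definition pseudo_slice ::
    "('o, 'm, 'c) two_cat \<Rightarrow> 'o
      \<Rightarrow> ('o \<times> 'm, ('o, 'm, 'c) slice_mor,
          ('o, 'm, 'c) slice_mor \<times> 'c \<times> ('o, 'm, 'c) slice_mor) two_cat" where
  "pseudo_slice A X =
    \<lparr>Ob = slice_obs A X, Mor = slice_mors A X, Cell = slice_cells A X,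
     Src = (\<lambda>(Y, _, _). Y), Trg = (\<lambda>(_, _, Z). Z),
     CSrc = (\<lambda>(p, _, _). p), CTrg = (\<lambda>(_, _, q). q),
     Id1 = slice_id A, Comp1 = slice_comp A,
     Id2 = (\<lambda>(Y, (a, \<psi>), Z). ((Y, (a, \<psi>), Z), Id2 A a, (Y, (a, \<psi>), Z))),
     VComp = (\<lambda>(_, \<beta>', r) (p, \<beta>, _). (p, \<beta>' \<bullet>\<^bsub>A\<^esub> \<beta>, r)),
     HComp = (\<lambda>(p', \<beta>', q') (p, \<beta>, q). (slice_comp A p' p, \<beta>' \<star>\<^bsub>A\<^esub> \<beta>, slice_comp A q' q))\<rparr>"

definition slice_proj ::
    "('o, 'm, 'c) two_cat
      \<Rightarrow> ('o \<times> 'm, ('o, 'm, 'c) slice_mor,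
          ('o, 'm, 'c) slice_mor \<times> 'c \<times> ('o, 'm, 'c) slice_mor, 'o, 'm, 'c) pfun" where
  "slice_proj A =
    \<lparr>PObj = fst, PMor = (\<lambda>(_, (a, _), _). a), PCell = (\<lambda>(_, \<beta>, _). \<beta>),
     PComp = (\<lambda>(_, (a', _), _) (_, (a, _), _). Id2 A (a' \<cdot>\<^bsub>A\<^esub> a))\<rparr>"

definition trivial_fibration ::
    "('ao, 'am, 'ac) two_cat \<Rightarrow> ('bo, 'bm, 'bc) two_cat
      \<Rightarrow> ('ao, 'am, 'ac, 'bo, 'bm, 'bc) pfun \<Rightarrow> bool" where
  "trivial_fibration A B G \<longleftrightarrow> two_functor A B G \<and>
    PObj G ` Ob A = Ob B \<and>
    (\<forall>X \<in> Ob A. \<forall>Y \<in> Ob A. PMor G ` hom1 A X Y = hom1 B (PObj G X) (PObj G Y)) \<and>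
    (\<forall>X \<in> Ob A. \<forall>Y \<in> Ob A. \<forall>f \<in> hom1 A X Y. \<forall>g \<in> hom1 A X Y.
      bij_betw (PCell G) (hom2 A f g) (hom2 B (PMor G f) (PMor G g)))"

definition bi_initial :: "('o, 'm, 'c) two_cat \<Rightarrow> 'o \<Rightarrow> bool" where
  "bi_initial A X \<longleftrightarrow> X \<in> Ob A \<and> trivial_fibration (pseudo_slice A X) A (slice_proj A)"

definition bi_terminal :: "('o, 'm, 'c) two_cat \<Rightarrow> 'o \<Rightarrow> bool" where
  "bi_terminal A X \<longleftrightarrow> bi_initial (op2 A) X"

end

theory Submission
  imports Defs
begin

text \<open>
  Fix a cone \<open>(X, k)\<close> over \<open>F\<close>.  Both sides of the equivalence are statements about the legs
  \<open>p i : Y \<rightarrow> F i\<close> and cells \<open>q u : F u \<cdot> p i \<Rightarrow> p j\<close> of cones, so each is first reduced to these data.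
  A transformation \<open>\<Delta>Y \<Rightarrow> F\<close> consists of exactly such data, and so does a transformation
  \<open>\<Delta>1 \<Rightarrow> C(Y, F-)\<close>, because a functor out of the terminal category is an object.

  \<^item> \<open>(X, k)\<close> is bi-terminal among cones iff every hom-category into it is contractible: each
    cone on \<open>Y\<close> factors as \<open>k \<triangleleft> c\<close> up to isomorphism (\<open>factors_at\<close>), and two such factorizations are
    related by a unique compatible cell (\<open>compares_at\<close>).  This is \<open>bi_terminal_cone_iff\<close>; it rests on
    the description of bi-initial objects in an arbitrary 2-category, \<open>bi_initial_iff\<close>.

  \<^item> \<open>(X, k)\<close> is a bi-limit iff \<open>C(Y, X) \<rightarrow> Ps(I, Cat)(\<Delta>1, C(Y, F-))\<close> is essentially surjective, which
    is \<open>factors_at\<close> again, and fully faithful, which says that every modification \<open>k \<triangleleft> c \<Rightarrow> k \<triangleleft> d\<close> is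
    induced by a unique cell \<open>c \<Rightarrow> d\<close> (\<open>lifts_at\<close>).  This is \<open>is_bilimit_iff\<close>.

  The two second conditions differ: \<open>compares_at\<close> only speaks of invertible modifications.  Tensors by
  the category \<open>{0 \<rightarrow> 1}\<close> remove the difference (\<open>lifts_iff_compares\<close>).  If \<open>T\<close> is the tensor of \<open>Y\<close>, with
  universal cell \<open>z : z0 \<Rightarrow> z1\<close>, then an arbitrary modification between cones on \<open>Y\<close> is the same as a
  single cone on \<open>T\<close>.  That cone factors through \<open>k\<close> by some \<open>c : T \<rightarrow> X\<close>, and \<open>c \<star> z\<close> is, up to the
  invertible comparison cells at its two ends, the required lift.  Uniqueness follows from the same
  correspondence: two cells with equal images are two morphisms \<open>T \<rightarrow> X\<close> that induce the same cone on
  \<open>T\<close>, and their comparison cell restricts to identities along \<open>z0\<close> and \<open>z1\<close>.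
\<close>

section \<open>Calculation in a 2-category\<close>

lemma hom1_iff: "f \<in> hom1 C X Y \<longleftrightarrow> f \<in> Mor C \<and> Src C f = X \<and> Trg C f = Y"
  by (auto simp: hom1_def)

lemma hom2_iff: "\<alpha> \<in> hom2 C f g \<longleftrightarrow> \<alpha> \<in> Cell C \<and> CSrc C \<alpha> = f \<and> CTrg C \<alpha> = g"
  by (auto simp: hom2_def)

lemma hom_iff: "f \<in> hom K x y \<longleftrightarrow> f \<in> Arr K \<and> Dom K f = x \<and> Cod K f = y"
  by (auto simp: hom_def)

lemma hom_cat_sel:
  "Obj (hom_cat C X Y) = hom1 C X Y"
  "Arr (hom_cat C X Y) = {\<alpha> \<in> Cell C. CSrc C \<alpha> \<in> hom1 C X Y}"
  "Dom (hom_cat C X Y) = CSrc C" "Cod (hom_cat C X Y) = CTrg C"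
  "One (hom_cat C X Y) = Id2 C" "Cmp (hom_cat C X Y) = VComp C"
  by (simp_all add: hom_cat_def)

text \<open>The axioms are restated with source and target functions in place of hom-sets.  Their side
  conditions then contain no variables that are absent from the conclusion, so that rewriting
  discharges them; pasting diagrams become equations between right-associated composites of
  whiskered cells.\<close>

context two_category
begin

lemma src_trg [simp]: "f \<in> Mor C \<Longrightarrow> Src C f \<in> Ob C" "f \<in> Mor C \<Longrightarrow> Trg C f \<in> Ob C"
  by (auto intro: src_ob trg_ob)

lemma csrc_ctrg [simp]:
  assumes "\<alpha> \<in> Cell C"
  shows "CSrc C \<alpha> \<in> Mor C" "CTrg C \<alpha> \<in> Mor C"
    "Src C (CTrg C \<alpha>) = Src C (CSrc C \<alpha>)" "Trg C (CTrg C \<alpha>) = Trg C (CSrc C \<alpha>)"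
  using csrc_mor[OF assms] ctrg_mor[OF assms] by (auto simp: hom1_iff)

lemma id1 [simp]:
  assumes "X \<in> Ob C"
  shows "Id1 C X \<in> Mor C" "Src C (Id1 C X) = X" "Trg C (Id1 C X) = X"
  using id1_hom[OF assms] by (auto simp: hom1_iff)

lemma comp1 [simp]:
  assumes "f \<in> Mor C" "g \<in> Mor C" "Trg C f = Src C g"
  shows "g \<cdot> f \<in> Mor C" "Src C (g \<cdot> f) = Src C f" "Trg C (g \<cdot> f) = Trg C g"
  using comp1_hom[of f "Src C f" "Trg C f" g "Trg C g"] assms by (auto simp: hom1_iff)

lemma comp1_id [simp]:
  "f \<in> Mor C \<Longrightarrow> Src C f = X \<Longrightarrow> f \<cdot> Id1 C X = f"
  "f \<in> Mor C \<Longrightarrow> Trg C f = X \<Longrightarrow> Id1 C X \<cdot> f = f"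
  using id1_left[of f] id1_right[of f] by (auto simp: hom1_iff)

lemma comp1_assoc' [simp]:
  "f \<in> Mor C \<Longrightarrow> g \<in> Mor C \<Longrightarrow> h \<in> Mor C \<Longrightarrow> Trg C f = Src C g \<Longrightarrow> Trg C g = Src C h
    \<Longrightarrow> (h \<cdot> g) \<cdot> f = h \<cdot> g \<cdot> f"
  by (rule comp1_assoc) (auto simp: hom1_iff)

lemma hom_hom_cat: "f \<in> hom1 C X Y \<Longrightarrow> hom (hom_cat C X Y) f g = hom2 C f g"
  by (auto simp: hom_def hom2_def hom_cat_sel)

lemma hom_category': "f \<in> Mor C \<Longrightarrow> category (hom_cat C (Src C f) (Trg C f))"
  by (simp add: hom_category)

lemma id2 [simp]:
  assumes "f \<in> Mor C"
  shows "Id2 C f \<in> Cell C" "CSrc C (Id2 C f) = f" "CTrg C (Id2 C f) = f"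
  using category.one_hom[OF hom_category'[OF assms], of f] assms
  by (auto simp: hom_iff hom_cat_sel hom1_iff)

lemma vcomp [simp]:
  assumes "\<alpha> \<in> Cell C" "\<beta> \<in> Cell C" "CTrg C \<alpha> = CSrc C \<beta>"
  shows "\<beta> \<bullet> \<alpha> \<in> Cell C" "CSrc C (\<beta> \<bullet> \<alpha>) = CSrc C \<alpha>" "CTrg C (\<beta> \<bullet> \<alpha>) = CTrg C \<beta>"
  using category.cmp_hom[OF hom_category'[of "CSrc C \<alpha>"], of \<alpha> "CSrc C \<alpha>" "CSrc C \<beta>" \<beta> "CTrg C \<beta>"]
    csrc_ctrg[of \<alpha>] assms
  by (auto simp: hom_iff hom_cat_sel hom1_iff)

lemma vcomp_id [simp]:
  "\<alpha> \<in> Cell C \<Longrightarrow> CSrc C \<alpha> = f \<Longrightarrow> \<alpha> \<bullet> Id2 C f = \<alpha>"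
  "\<alpha> \<in> Cell C \<Longrightarrow> CTrg C \<alpha> = f \<Longrightarrow> Id2 C f \<bullet> \<alpha> = \<alpha>"
  using category.one_left[OF hom_category'[of "CSrc C \<alpha>"], of \<alpha> "CSrc C \<alpha>" "CTrg C \<alpha>"]
    category.one_right[OF hom_category'[of "CSrc C \<alpha>"], of \<alpha> "CSrc C \<alpha>" "CTrg C \<alpha>"]
  by (auto simp: hom_iff hom_cat_sel hom1_iff)

lemma vcomp_assoc [simp]:
  assumes "\<alpha> \<in> Cell C" "\<beta> \<in> Cell C" "\<gamma> \<in> Cell C" "CTrg C \<alpha> = CSrc C \<beta>" "CTrg C \<beta> = CSrc C \<gamma>"
  shows "(\<gamma> \<bullet> \<beta>) \<bullet> \<alpha> = \<gamma> \<bullet> \<beta> \<bullet> \<alpha>"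
  using category.cmp_assoc[OF hom_category'[of "CSrc C \<alpha>"], of \<alpha> "CSrc C \<alpha>" "CSrc C \<beta>" \<beta>
      "CSrc C \<gamma>" \<gamma> "CTrg C \<gamma>"] assms csrc_ctrg[of \<alpha>] csrc_ctrg[of \<beta>]
  by (auto simp: hom_iff hom_cat_sel hom1_iff)

lemma hcomp [simp]:
  assumes "\<alpha> \<in> Cell C" "\<beta> \<in> Cell C" "Trg C (CSrc C \<alpha>) = Src C (CSrc C \<beta>)"
  shows "\<beta> \<star> \<alpha> \<in> Cell C" "CSrc C (\<beta> \<star> \<alpha>) = CSrc C \<beta> \<cdot> CSrc C \<alpha>"
    "CTrg C (\<beta> \<star> \<alpha>) = CTrg C \<beta> \<cdot> CTrg C \<alpha>"
  using hcomp_hom[of "CSrc C \<alpha>" "Src C (CSrc C \<alpha>)" "Trg C (CSrc C \<alpha>)" "CSrc C \<beta>" "Trg C (CSrc C \<beta>)"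
      \<alpha> "CTrg C \<alpha>" \<beta> "CTrg C \<beta>"] assms
  by (auto simp: hom1_iff hom2_iff)

lemma hcomp_id1 [simp]:
  "\<alpha> \<in> Cell C \<Longrightarrow> Src C (CSrc C \<alpha>) = X \<Longrightarrow> \<alpha> \<star> Id2 C (Id1 C X) = \<alpha>"
  "\<alpha> \<in> Cell C \<Longrightarrow> Trg C (CSrc C \<alpha>) = X \<Longrightarrow> Id2 C (Id1 C X) \<star> \<alpha> = \<alpha>"
  using hcomp_id_left[of "CSrc C \<alpha>" _ _ \<alpha>] hcomp_id_right[of "CSrc C \<alpha>" _ _ \<alpha>]
  by (auto simp: hom1_iff hom2_iff)

lemma hcomp_assoc' [simp]:
  assumes "\<alpha> \<in> Cell C" "\<beta> \<in> Cell C" "\<gamma> \<in> Cell C"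
    "Trg C (CSrc C \<alpha>) = Src C (CSrc C \<beta>)" "Trg C (CSrc C \<beta>) = Src C (CSrc C \<gamma>)"
  shows "(\<gamma> \<star> \<beta>) \<star> \<alpha> = \<gamma> \<star> \<beta> \<star> \<alpha>"
  by (rule hcomp_assoc[of "CSrc C \<alpha>" "Src C (CSrc C \<alpha>)" "Trg C (CSrc C \<alpha>)" "CSrc C \<beta>"
      "Trg C (CSrc C \<beta>)" "CSrc C \<gamma>" "Trg C (CSrc C \<gamma>)" _ "CTrg C \<alpha>" _ "CTrg C \<beta>" _ "CTrg C \<gamma>"])
    (use assms in \<open>auto simp: hom1_iff hom2_iff\<close>)

lemma hcomp_id2' [simp]:
  "f \<in> Mor C \<Longrightarrow> g \<in> Mor C \<Longrightarrow> Trg C f = Src C g \<Longrightarrow> Id2 C g \<star> Id2 C f = Id2 C (g \<cdot> f)"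
  by (rule hcomp_id2) (auto simp: hom1_iff)

lemma hcomp_id2_id2 [simp]:
  assumes "\<alpha> \<in> Cell C" "f \<in> Mor C" "g \<in> Mor C" "Trg C (CSrc C \<alpha>) = Src C f" "Trg C f = Src C g"
  shows "Id2 C g \<star> Id2 C f \<star> \<alpha> = Id2 C (g \<cdot> f) \<star> \<alpha>"
  using hcomp_assoc'[of \<alpha> "Id2 C f" "Id2 C g"] hcomp_id2'[of f g] assms by simp

lemma interchange':
  assumes "\<alpha> \<in> Cell C" "\<alpha>' \<in> Cell C" "\<beta> \<in> Cell C" "\<beta>' \<in> Cell C"
    "CTrg C \<alpha> = CSrc C \<alpha>'" "CTrg C \<beta> = CSrc C \<beta>'" "Trg C (CSrc C \<alpha>) = Src C (CSrc C \<beta>)"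
  shows "(\<beta>' \<bullet> \<beta>) \<star> (\<alpha>' \<bullet> \<alpha>) = (\<beta>' \<star> \<alpha>') \<bullet> (\<beta> \<star> \<alpha>)"
  by (rule interchange[of "CSrc C \<alpha>" "Src C (CSrc C \<alpha>)" "Trg C (CSrc C \<alpha>)" "CSrc C \<beta>"
      "Trg C (CSrc C \<beta>)" _ "CTrg C \<alpha>" _ "CTrg C \<alpha>'" _ "CTrg C \<beta>" _ "CTrg C \<beta>'"])
    (use assms in \<open>auto simp: hom1_iff hom2_iff\<close>)

lemma whisker_left_vcomp [simp]:
  assumes "\<alpha> \<in> Cell C" "\<alpha>' \<in> Cell C" "g \<in> Mor C" "CTrg C \<alpha> = CSrc C \<alpha>'"
    "Trg C (CSrc C \<alpha>) = Src C g"
  shows "Id2 C g \<star> (\<alpha>' \<bullet> \<alpha>) = (Id2 C g \<star> \<alpha>') \<bullet> (Id2 C g \<star> \<alpha>)"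
  using interchange'[of \<alpha> \<alpha>' "Id2 C g" "Id2 C g"] assms by simp

lemma whisker_right_vcomp [simp]:
  assumes "\<beta> \<in> Cell C" "\<beta>' \<in> Cell C" "f \<in> Mor C" "CTrg C \<beta> = CSrc C \<beta>'"
    "Trg C f = Src C (CSrc C \<beta>)"
  shows "(\<beta>' \<bullet> \<beta>) \<star> Id2 C f = (\<beta>' \<star> Id2 C f) \<bullet> (\<beta> \<star> Id2 C f)"
  using interchange'[of "Id2 C f" "Id2 C f" \<beta> \<beta>'] assms by simp

text \<open>Both sides are the horizontal composite \<open>\<beta> \<star> \<alpha>\<close>.\<close>

lemma whisker_exchange:
  assumes "\<alpha> \<in> hom2 C f f'" "\<beta> \<in> hom2 C g g'" "Trg C f = Src C g"
  shows "(Id2 C g' \<star> \<alpha>) \<bullet> (\<beta> \<star> Id2 C f) = (\<beta> \<star> Id2 C f') \<bullet> (Id2 C g \<star> \<alpha>)"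
  using interchange'[of "Id2 C f" \<alpha> \<beta> "Id2 C g'"] interchange'[of \<alpha> "Id2 C f'" "Id2 C g" \<beta>] assms
  by (auto simp: hom2_iff)

lemma iso2_iff:
  "\<alpha> \<in> iso2 C f g \<longleftrightarrow> \<alpha> \<in> hom2 C f g \<and>
    (\<exists>\<beta>. \<beta> \<in> hom2 C g f \<and> \<beta> \<bullet> \<alpha> = Id2 C f \<and> \<alpha> \<bullet> \<beta> = Id2 C g)"
  by (auto simp: iso2_def)

lemma iso2_hom2: "\<alpha> \<in> iso2 C f g \<Longrightarrow> \<alpha> \<in> hom2 C f g"
  by (simp add: iso2_iff)

lemma iso2_id2 [simp]: "f \<in> Mor C \<Longrightarrow> Id2 C f \<in> iso2 C f f"
  by (auto simp: iso2_iff hom2_iff intro!: exI[of _ "Id2 C f"])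

lemma iso2_vcomp:
  assumes "\<alpha> \<in> iso2 C f g" "\<beta> \<in> iso2 C g h"
  shows "\<beta> \<bullet> \<alpha> \<in> iso2 C f h"
proof -
  obtain \<alpha>' where a: "\<alpha>' \<in> hom2 C g f" "\<alpha>' \<bullet> \<alpha> = Id2 C f" "\<alpha> \<bullet> \<alpha>' = Id2 C g"
    using assms by (auto simp: iso2_iff)
  obtain \<beta>' where b: "\<beta>' \<in> hom2 C h g" "\<beta>' \<bullet> \<beta> = Id2 C g" "\<beta> \<bullet> \<beta>' = Id2 C h"
    using assms by (auto simp: iso2_iff)
  have t: "\<alpha> \<in> hom2 C f g" "\<beta> \<in> hom2 C g h" using assms by (auto simp: iso2_iff)
  have "(\<alpha>' \<bullet> \<beta>') \<bullet> \<beta> \<bullet> \<alpha> = \<alpha>' \<bullet> (\<beta>' \<bullet> \<beta>) \<bullet> \<alpha>"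
    "(\<beta> \<bullet> \<alpha>) \<bullet> \<alpha>' \<bullet> \<beta>' = \<beta> \<bullet> (\<alpha> \<bullet> \<alpha>') \<bullet> \<beta>'"
    using t a(1) b(1) by (auto simp: hom2_iff)
  then show ?thesis using t a b by (auto simp: iso2_iff hom2_iff intro!: exI[of _ "\<alpha>' \<bullet> \<beta>'"])
qed

lemma iso2_whisker_right:
  assumes "\<beta> \<in> iso2 C g g'" "f \<in> Mor C" "Trg C f = Src C g"
  shows "\<beta> \<star> Id2 C f \<in> iso2 C (g \<cdot> f) (g' \<cdot> f)"
proof -
  obtain \<beta>' where a: "\<beta>' \<in> hom2 C g' g" "\<beta>' \<bullet> \<beta> = Id2 C g" "\<beta> \<bullet> \<beta>' = Id2 C g'"
    using assms by (auto simp: iso2_iff)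
  have t: "\<beta> \<in> hom2 C g g'" using assms by (auto simp: iso2_iff)
  show ?thesis
    using whisker_right_vcomp[of \<beta> \<beta>' f] whisker_right_vcomp[of \<beta>' \<beta> f] csrc_ctrg[of \<beta>] t a assms(2,3)
    by (auto simp: iso2_iff hom2_iff intro!: exI[of _ "\<beta>' \<star> Id2 C f"])
qed

end

section \<open>Equivalences of categories\<close>

context category
begin

lemma dom_cod [simp]: "f \<in> Arr K \<Longrightarrow> Dom K f \<in> Obj K" "f \<in> Arr K \<Longrightarrow> Cod K f \<in> Obj K"
  by (auto intro: dom_obj cod_obj)

lemma one [simp]:
  assumes "x \<in> Obj K"
  shows "One K x \<in> Arr K" "Dom K (One K x) = x" "Cod K (One K x) = x"
  using one_hom[OF assms] by (auto simp: hom_iff)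

lemma cmp [simp]:
  assumes "f \<in> Arr K" "g \<in> Arr K" "Cod K f = Dom K g"
  shows "g \<odot> f \<in> Arr K" "Dom K (g \<odot> f) = Dom K f" "Cod K (g \<odot> f) = Cod K g"
  using cmp_hom[of f "Dom K f" "Cod K f" g "Cod K g"] assms by (auto simp: hom_iff)

lemma cmp_one [simp]:
  "f \<in> Arr K \<Longrightarrow> Dom K f = x \<Longrightarrow> f \<odot> One K x = f"
  "f \<in> Arr K \<Longrightarrow> Cod K f = x \<Longrightarrow> One K x \<odot> f = f"
  using one_left[of f "Dom K f" "Cod K f"] one_right[of f "Dom K f" "Cod K f"]
  by (auto simp: hom_iff)

lemma cmp_assoc' [simp]:
  assumes "f \<in> Arr K" "g \<in> Arr K" "h \<in> Arr K" "Cod K f = Dom K g" "Cod K g = Dom K h"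
  shows "(h \<odot> g) \<odot> f = h \<odot> g \<odot> f"
  using cmp_assoc[of f "Dom K f" "Cod K f" g "Cod K g" h "Cod K h"] assms by (auto simp: hom_iff)

lemma cmp_cancel:
  assumes "g \<odot> f = One K (Dom K f)" "h \<in> Arr K" "f \<in> Arr K" "g \<in> Arr K" "Cod K f = Dom K g"
    "Cod K h = Dom K f"
  shows "g \<odot> f \<odot> h = h"
  using assms cmp_assoc'[of h f g] by simp

lemma id_ftor_functor: "cat_functor (id_ftor K)"
  by unfold_locales (auto simp: id_ftor_def hom_iff)

end

context cat_functor
begin

sublocale dom: category "FDom F" by (rule dom_category)
sublocale cod: category "FCod F" by (rule cod_category)

lemma obj [simp]: "x \<in> Obj (FDom F) \<Longrightarrow> FObj F x \<in> Obj (FCod F)"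
  using obj_map by auto

lemma arr [simp]:
  assumes "f \<in> Arr (FDom F)"
  shows "FArr F f \<in> Arr (FCod F)" "Dom (FCod F) (FArr F f) = FObj F (Dom (FDom F) f)"
    "Cod (FCod F) (FArr F f) = FObj F (Cod (FDom F) f)"
  using arr_map[of f "Dom (FDom F) f" "Cod (FDom F) f"] assms by (auto simp: hom_iff)

lemma arr_one [simp]: "x \<in> Obj (FDom F) \<Longrightarrow> FArr F (One (FDom F) x) = One (FCod F) (FObj F x)"
  by (rule map_one)

lemma arr_cmp [simp]:
  "f \<in> Arr (FDom F) \<Longrightarrow> g \<in> Arr (FDom F) \<Longrightarrow> Cod (FDom F) f = Dom (FDom F) g
    \<Longrightarrow> FArr F (g \<odot>\<^bsub>FDom F\<^esub> f) = FArr F g \<odot>\<^bsub>FCod F\<^esub> FArr F f"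
  by (rule map_cmp) (auto simp: hom_iff)

end

lemma ftor_comp_functor:
  assumes "cat_functor F" "cat_functor G" "FDom G = FCod F"
  shows "cat_functor (ftor_comp G F)"
proof -
  interpret F: cat_functor F by fact
  interpret G: cat_functor G by fact
  note [simp] = assms(3)
  note [simp] = G.obj[unfolded assms(3)] G.arr[unfolded assms(3)] G.arr_one[unfolded assms(3)]
    G.arr_cmp[unfolded assms(3)]
  show ?thesis
    by unfold_locales (auto simp: ftor_comp_def hom_iff)
qed

lemma ftor_comp_sel [simp]:
  "FDom (ftor_comp G F) = FDom F" "FCod (ftor_comp G F) = FCod G"
  "x \<in> Obj (FDom F) \<Longrightarrow> FObj (ftor_comp G F) x = FObj G (FObj F x)"
  "f \<in> Arr (FDom F) \<Longrightarrow> FArr (ftor_comp G F) f = FArr G (FArr F f)"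
  by (simp_all add: ftor_comp_def)

lemma id_ftor_sel [simp]:
  "FDom (id_ftor K) = K" "FCod (id_ftor K) = K"
  "x \<in> Obj K \<Longrightarrow> FObj (id_ftor K) x = x" "f \<in> Arr K \<Longrightarrow> FArr (id_ftor K) f = f"
  by (simp_all add: id_ftor_def)

definition fully_faithful :: "('o, 'a, 'p, 'b) ftor \<Rightarrow> bool" where
  "fully_faithful L \<longleftrightarrow> (\<forall>x \<in> Obj (FDom L). \<forall>y \<in> Obj (FDom L).
     bij_betw (FArr L) (hom (FDom L) x y) (hom (FCod L) (FObj L x) (FObj L y)))"

definition essentially_surjective :: "('o, 'a, 'p, 'b) ftor \<Rightarrow> bool" where
  "essentially_surjective L \<longleftrightarrow> (\<forall>z \<in> Obj (FCod L). \<exists>x \<in> Obj (FDom L).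
     \<exists>e \<in> hom (FCod L) (FObj L x) z. iso_arr (FCod L) e)"

text \<open>Naturality of the unit and of the counit recovers every arrow from its image, so both \<open>L\<close> and its
  inverse \<open>R\<close> are faithful.  Fullness of \<open>L\<close> follows: for \<open>h : L x \<rightarrow> L y\<close>,
  conjugating \<open>R h\<close> with the unit gives an arrow \<open>f\<close> with \<open>R (L f) = R h\<close>.\<close>

lemma adjoint_equivalence_imp:
  assumes "adjoint_equivalence L"
  shows "fully_faithful L" "essentially_surjective L"
proof -
  interpret L: cat_functor L using assms by (simp add: adjoint_equivalence_def)
  define K D where "K = FDom L" and "D = FCod L"
  obtain R \<eta> \<epsilon> where R: "cat_functor R" "FDom R = D" "FCod R = K"
    and \<eta>: "nat_trans \<eta>" "NTDom \<eta> = id_ftor K" "NTCod \<eta> = ftor_comp R L"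
      "\<And>x. x \<in> Obj K \<Longrightarrow> iso_arr K (NTMap \<eta> x)"
    and \<epsilon>: "nat_trans \<epsilon>" "NTDom \<epsilon> = ftor_comp L R" "NTCod \<epsilon> = id_ftor D"
      "\<And>y. y \<in> Obj D \<Longrightarrow> iso_arr D (NTMap \<epsilon> y)"
    using assms unfolding adjoint_equivalence_def nat_iso_def K_def D_def by auto
  interpret R: cat_functor R by fact
  note L_simps [simp] = L.obj[folded K_def D_def] L.arr[folded K_def D_def]
    L.arr_one[folded K_def D_def] L.arr_cmp[folded K_def D_def]
  note R_simps [simp] = R.obj[unfolded R] R.arr[unfolded R] R.arr_one[unfolded R] R.arr_cmp[unfolded R]
  interpret K: category K unfolding K_def by (rule L.dom_category)
  interpret D: category D unfolding D_def by (rule L.cod_category)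
  have \<eta>_arr: "NTMap \<eta> x \<in> Arr K" "Dom K (NTMap \<eta> x) = x" "Cod K (NTMap \<eta> x) = FObj R (FObj L x)"
    if "x \<in> Obj K" for x
    using nat_trans.map_hom[OF \<eta>(1), of x] that R by (auto simp: \<eta> hom_iff K_def)
  have \<epsilon>_arr: "NTMap \<epsilon> y \<in> Arr D" "Dom D (NTMap \<epsilon> y) = FObj L (FObj R y)" "Cod D (NTMap \<epsilon> y) = y"
    if "y \<in> Obj D" for y
    using nat_trans.map_hom[OF \<epsilon>(1), of y] that R by (auto simp: \<epsilon> hom_iff D_def)
  have \<eta>_nat: "NTMap \<eta> (Cod K f) \<odot>\<^bsub>K\<^esub> f = FArr R (FArr L f) \<odot>\<^bsub>K\<^esub> NTMap \<eta> (Dom K f)"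
    if "f \<in> Arr K" for f
    using nat_trans.natural[OF \<eta>(1), of f "Dom K f" "Cod K f"] that R
    by (auto simp: \<eta> hom_iff K_def)
  have \<epsilon>_nat: "NTMap \<epsilon> (Cod D h) \<odot>\<^bsub>D\<^esub> FArr L (FArr R h) = h \<odot>\<^bsub>D\<^esub> NTMap \<epsilon> (Dom D h)"
    if "h \<in> Arr D" for h
    using nat_trans.natural[OF \<epsilon>(1), of h "Dom D h" "Cod D h"] that R
    by (auto simp: \<epsilon> hom_iff D_def)
  have "\<exists>j \<in> Arr K. Dom K j = FObj R (FObj L x) \<and> Cod K j = x \<and>
      j \<odot>\<^bsub>K\<^esub> NTMap \<eta> x = One K x \<and> NTMap \<eta> x \<odot>\<^bsub>K\<^esub> j = One K (FObj R (FObj L x))"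
    if "x \<in> Obj K" for x
    using \<eta>(4)[OF that] \<eta>_arr[OF that] by (auto simp: iso_arr_def hom_iff)
  then obtain j where j: "\<And>x. x \<in> Obj K \<Longrightarrow> j x \<in> Arr K"
      "\<And>x. x \<in> Obj K \<Longrightarrow> Dom K (j x) = FObj R (FObj L x)" "\<And>x. x \<in> Obj K \<Longrightarrow> Cod K (j x) = x"
      "\<And>x. x \<in> Obj K \<Longrightarrow> j x \<odot>\<^bsub>K\<^esub> NTMap \<eta> x = One K x"
      "\<And>x. x \<in> Obj K \<Longrightarrow> NTMap \<eta> x \<odot>\<^bsub>K\<^esub> j x = One K (FObj R (FObj L x))"
    by metis
  have "\<exists>i \<in> Arr D. Dom D i = y \<and> Cod D i = FObj L (FObj R y) \<and> NTMap \<epsilon> y \<odot>\<^bsub>D\<^esub> i = One D y"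
    if "y \<in> Obj D" for y
    using \<epsilon>(4)[OF that] \<epsilon>_arr[OF that] by (auto simp: iso_arr_def hom_iff)
  then obtain i where i: "\<And>y. y \<in> Obj D \<Longrightarrow> i y \<in> Arr D" "\<And>y. y \<in> Obj D \<Longrightarrow> Dom D (i y) = y"
      "\<And>y. y \<in> Obj D \<Longrightarrow> Cod D (i y) = FObj L (FObj R y)"
      "\<And>y. y \<in> Obj D \<Longrightarrow> NTMap \<epsilon> y \<odot>\<^bsub>D\<^esub> i y = One D y"
    by metis
  \<comment> \<open>Every arrow is recovered from its image, by conjugation with the unit or the counit.\<close>
  have L_rec: "j (Cod K f) \<odot>\<^bsub>K\<^esub> FArr R (FArr L f) \<odot>\<^bsub>K\<^esub> NTMap \<eta> (Dom K f) = f" if "f \<in> Arr K" for f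
  proof -
    have "j (Cod K f) \<odot>\<^bsub>K\<^esub> NTMap \<eta> (Cod K f) \<odot>\<^bsub>K\<^esub> f = f"
      by (rule K.cmp_cancel) (use that in \<open>auto simp: j \<eta>_arr\<close>)
    then show ?thesis using \<eta>_nat[OF that] by simp
  qed
  have R_rec: "NTMap \<epsilon> (Cod D h) \<odot>\<^bsub>D\<^esub> FArr L (FArr R h) \<odot>\<^bsub>D\<^esub> i (Dom D h) = h" if h: "h \<in> Arr D" for h
  proof -
    have "NTMap \<epsilon> (Cod D h) \<odot>\<^bsub>D\<^esub> FArr L (FArr R h) \<odot>\<^bsub>D\<^esub> i (Dom D h)
        = (NTMap \<epsilon> (Cod D h) \<odot>\<^bsub>D\<^esub> FArr L (FArr R h)) \<odot>\<^bsub>D\<^esub> i (Dom D h)"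
      using h by (simp add: i \<epsilon>_arr)
    also have "\<dots> = h \<odot>\<^bsub>D\<^esub> NTMap \<epsilon> (Dom D h) \<odot>\<^bsub>D\<^esub> i (Dom D h)"
      using h by (simp add: \<epsilon>_nat i \<epsilon>_arr)
    finally show ?thesis using h by (simp add: i)
  qed
  show "fully_faithful L"
    unfolding fully_faithful_def K_def[symmetric] D_def[symmetric]
  proof (intro ballI bij_betwI')
    fix x y f g
    assume f: "f \<in> hom K x y" and g: "g \<in> hom K x y"
    have "j y \<odot>\<^bsub>K\<^esub> FArr R (FArr L f) \<odot>\<^bsub>K\<^esub> NTMap \<eta> x = f"
      using L_rec[of f] f unfolding hom_iff by blast
    moreover have "j y \<odot>\<^bsub>K\<^esub> FArr R (FArr L g) \<odot>\<^bsub>K\<^esub> NTMap \<eta> x = g"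
      using L_rec[of g] g unfolding hom_iff by blast
    ultimately show "(FArr L f = FArr L g) = (f = g)" by metis
  next
    fix x y f
    assume "f \<in> hom K x y"
    then show "FArr L f \<in> hom D (FObj L x) (FObj L y)" by (auto simp: hom_iff)
  next
    fix x y h
    assume x: "x \<in> Obj K" and y: "y \<in> Obj K" and h: "h \<in> hom D (FObj L x) (FObj L y)"
    define f where "f = j y \<odot>\<^bsub>K\<^esub> FArr R h \<odot>\<^bsub>K\<^esub> NTMap \<eta> x"
    have f: "f \<in> hom K x y" using x y h by (simp add: hom_iff f_def j \<eta>_arr)
    have "NTMap \<eta> y \<odot>\<^bsub>K\<^esub> j y \<odot>\<^bsub>K\<^esub> FArr R h \<odot>\<^bsub>K\<^esub> NTMap \<eta> x = FArr R h \<odot>\<^bsub>K\<^esub> NTMap \<eta> x"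
      by (rule K.cmp_cancel) (use x y h in \<open>auto simp: j \<eta>_arr hom_iff\<close>)
    then have "FArr R (FArr L f) \<odot>\<^bsub>K\<^esub> NTMap \<eta> x = FArr R h \<odot>\<^bsub>K\<^esub> NTMap \<eta> x"
      using \<eta>_nat[of f] f by (simp add: f_def hom_iff)
    then have "(FArr R (FArr L f) \<odot>\<^bsub>K\<^esub> NTMap \<eta> x) \<odot>\<^bsub>K\<^esub> j x = (FArr R h \<odot>\<^bsub>K\<^esub> NTMap \<eta> x) \<odot>\<^bsub>K\<^esub> j x"
      by simp
    then have "FArr R (FArr L f) = FArr R h"
      using x y h f by (simp add: hom_iff j \<eta>_arr)
    then have "FArr L f = h"
      using R_rec[of h] R_rec[of "FArr L f"] f h x y by (simp add: hom_iff)
    then show "\<exists>f \<in> hom K x y. h = FArr L f" using f by auto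
  qed
  show "essentially_surjective L"
    unfolding essentially_surjective_def K_def[symmetric] D_def[symmetric]
  proof
    fix z assume "z \<in> Obj D"
    then show "\<exists>x \<in> Obj K. \<exists>e \<in> hom D (FObj L x) z. iso_arr D e"
      using \<epsilon>(4) \<epsilon>_arr
      by (intro bexI[of _ "FObj R z"] bexI[of _ "NTMap \<epsilon> z"]) (auto simp: hom_iff)
  qed
qed

text \<open>The inverse of \<open>L\<close> sends \<open>z\<close> to a chosen \<open>r z\<close> with an isomorphism \<open>e z : L (r z) \<rightarrow> z\<close>.
  Its arrows, and the unit, are the unique arrows that \<open>L\<close> maps to the composites forced by
  naturality of \<open>e\<close> and the triangle identities; all equations are then checked after applying the
  faithful functor \<open>L\<close>.\<close>

lemma adjoint_equivalenceI:
  assumes "cat_functor L" "fully_faithful L" "essentially_surjective L"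
  shows "adjoint_equivalence L"
proof -
  interpret L: cat_functor L by fact
  define K D where "K = FDom L" and "D = FCod L"
  note [simp] = L.obj[folded K_def D_def] L.arr[folded K_def D_def]
    L.arr_one[folded K_def D_def] L.arr_cmp[folded K_def D_def]
  interpret K: category K unfolding K_def by (rule L.dom_category)
  interpret D: category D unfolding D_def by (rule L.cod_category)
  have "\<exists>x e e'. x \<in> Obj K \<and> e \<in> hom D (FObj L x) z \<and> e' \<in> hom D z (FObj L x) \<and>
      e' \<odot>\<^bsub>D\<^esub> e = One D (FObj L x) \<and> e \<odot>\<^bsub>D\<^esub> e' = One D z" if "z \<in> Obj D" for z
  proof -
    have "\<exists>x \<in> Obj K. \<exists>e \<in> hom D (FObj L x) z. iso_arr D e"
      using assms(3) that unfolding essentially_surjective_def K_def D_def by (rule bspec)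
    then obtain x e where "x \<in> Obj K" "e \<in> hom D (FObj L x) z" "iso_arr D e" by blast
    moreover from this obtain e' where "e' \<in> hom D (Cod D e) (Dom D e)"
      "e' \<odot>\<^bsub>D\<^esub> e = One D (Dom D e)" "e \<odot>\<^bsub>D\<^esub> e' = One D (Cod D e)"
      unfolding iso_arr_def by blast
    ultimately show ?thesis
      by (intro exI[of _ x] exI[of _ e] exI[of _ e']) (simp add: hom_iff)
  qed
  then obtain r e e' where r [simp]: "\<And>z. z \<in> Obj D \<Longrightarrow> r z \<in> Obj K"
    and e: "\<And>z. z \<in> Obj D \<Longrightarrow> e z \<in> hom D (FObj L (r z)) z"
    and e': "\<And>z. z \<in> Obj D \<Longrightarrow> e' z \<in> hom D z (FObj L (r z))"
    and e'e: "\<And>z. z \<in> Obj D \<Longrightarrow> e' z \<odot>\<^bsub>D\<^esub> e z = One D (FObj L (r z))"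
    and ee': "\<And>z. z \<in> Obj D \<Longrightarrow> e z \<odot>\<^bsub>D\<^esub> e' z = One D z"
    by metis
  have e_arr [simp]: "e z \<in> Arr D" "Dom D (e z) = FObj L (r z)" "Cod D (e z) = z"
    "e' z \<in> Arr D" "Dom D (e' z) = z" "Cod D (e' z) = FObj L (r z)" if "z \<in> Obj D" for z
    using e[OF that] e'[OF that] by (auto simp: hom_iff)
  have c1 [simp]: "e' z \<odot>\<^bsub>D\<^esub> e z \<odot>\<^bsub>D\<^esub> h = h"
    if "z \<in> Obj D" "h \<in> Arr D" "Cod D h = FObj L (r z)" for z h
    by (rule D.cmp_cancel) (use that in \<open>auto simp: e'e\<close>)
  have c2 [simp]: "e z \<odot>\<^bsub>D\<^esub> e' z \<odot>\<^bsub>D\<^esub> h = h" if "z \<in> Obj D" "h \<in> Arr D" "Cod D h = z" for z h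
    by (rule D.cmp_cancel) (use that in \<open>auto simp: ee'\<close>)
  note [simp] = e'e ee'
  have bij: "bij_betw (FArr L) (hom K x y) (hom D (FObj L x) (FObj L y))"
    if "x \<in> Obj K" "y \<in> Obj K" for x y
    using assms(2) that unfolding fully_faithful_def K_def D_def by auto
  define lift where "lift x y h = inv_into (hom K x y) (FArr L) h" for x y h
  have lift: "lift x y h \<in> Arr K" "Dom K (lift x y h) = x" "Cod K (lift x y h) = y"
    "FArr L (lift x y h) = h"
    if "x \<in> Obj K" "y \<in> Obj K" "h \<in> Arr D" "Dom D h = FObj L x" "Cod D h = FObj L y" for x y h
  proof -
    have "h \<in> FArr L ` hom K x y" using bij[OF that(1,2)] that by (auto simp: bij_betw_def hom_iff)
    from inv_into_into[OF this] f_inv_into_f[OF this]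
    show "lift x y h \<in> Arr K" "Dom K (lift x y h) = x" "Cod K (lift x y h) = y"
      "FArr L (lift x y h) = h" by (auto simp: lift_def hom_iff)
  qed
  note [simp] = lift
  have faithful: "f = g" if "f \<in> Arr K" "g \<in> Arr K" "Dom K f = Dom K g" "Cod K f = Cod K g"
      "FArr L f = FArr L g" for f g
    using bij[of "Dom K f" "Cod K f"] that by (auto simp: bij_betw_def inj_on_def hom_iff)
  define R where "R = \<lparr>FDom = D, FCod = K, FObj = (\<lambda>z\<in>Obj D. r z),
    FArr = (\<lambda>h\<in>Arr D. lift (r (Dom D h)) (r (Cod D h)) (e' (Cod D h) \<odot>\<^bsub>D\<^esub> h \<odot>\<^bsub>D\<^esub> e (Dom D h)))\<rparr>"
  have R_sel [simp]: "FDom R = D" "FCod R = K"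
    "\<And>z. z \<in> Obj D \<Longrightarrow> FObj R z = r z"
    "\<And>h. h \<in> Arr D \<Longrightarrow> FArr R h
        = lift (r (Dom D h)) (r (Cod D h)) (e' (Cod D h) \<odot>\<^bsub>D\<^esub> h \<odot>\<^bsub>D\<^esub> e (Dom D h))"
    by (simp_all add: R_def)
  have R: "cat_functor R"
  proof (rule cat_functor.intro)
    show "category (FDom R)" "category (FCod R)" by (simp_all add: K.category_axioms D.category_axioms)
    show "FObj R \<in> Obj (FDom R) \<rightarrow>\<^sub>E Obj (FCod R)" "FArr R \<in> extensional (Arr (FDom R))"
      by (auto simp: R_def)
    fix x assume "x \<in> Obj (FDom R)"
    then show "FArr R (One (FDom R) x) = One (FCod R) (FObj R x)"
      by (auto intro!: faithful)
  next
    fix f x y assume "f \<in> hom (FDom R) x y"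
    then show "FArr R f \<in> hom (FCod R) (FObj R x) (FObj R y)" by (auto simp: hom_iff)
  next
    fix f x y g z assume "f \<in> hom (FDom R) x y" "g \<in> hom (FDom R) y z"
    then show "FArr R (g \<odot>\<^bsub>FDom R\<^esub> f) = FArr R g \<odot>\<^bsub>FCod R\<^esub> FArr R f"
      by (auto intro!: faithful simp: hom_iff)
  qed
  note LR = ftor_comp_functor[OF R assms(1), simplified, folded K_def D_def]
  note RL = ftor_comp_functor[OF assms(1) R, simplified, folded K_def D_def]
  note idK = K.id_ftor_functor and idD = D.id_ftor_functor
  define \<eta> where "\<eta> = \<lparr>NTDom = id_ftor K, NTCod = ftor_comp R L,
    NTMap = (\<lambda>x\<in>Obj K. lift x (r (FObj L x)) (e' (FObj L x)))\<rparr>"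
  define \<epsilon> where "\<epsilon> = \<lparr>NTDom = ftor_comp L R, NTCod = id_ftor D, NTMap = (\<lambda>z\<in>Obj D. e z)\<rparr>"
  have nt1: "nat_trans \<eta>"
    by (rule nat_trans.intro)
      (auto simp: \<eta>_def hom_iff idK RL K_def[symmetric] D_def[symmetric] intro!: faithful)
  have nt2: "nat_trans \<epsilon>"
    by (rule nat_trans.intro) (auto simp: \<epsilon>_def hom_iff idD LR K_def[symmetric] D_def[symmetric])
  have iso1: "iso_arr K (NTMap \<eta> x)" if "x \<in> Obj K" for x
    using that
    by (auto simp: iso_arr_def \<eta>_def hom_iff K_def[symmetric] D_def[symmetric]
        intro!: faithful bexI[of _ "lift (r (FObj L x)) x (e (FObj L x))"])
  have iso2: "iso_arr D (NTMap \<epsilon> z)" if "z \<in> Obj D" for z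
    using that
    by (auto simp: iso_arr_def \<epsilon>_def hom_iff K_def[symmetric] D_def[symmetric]
        intro!: faithful bexI[of _ "e' z"])
  show ?thesis
    unfolding adjoint_equivalence_def
  proof (intro conjI exI[of _ R] exI[of _ \<eta>] exI[of _ \<epsilon>] ballI)
    show "nat_iso \<eta> (id_ftor (FDom L)) (ftor_comp R L)"
      using nt1 iso1 by (auto simp: nat_iso_def K_def[symmetric] D_def[symmetric]) (auto simp: \<eta>_def)
    show "nat_iso \<epsilon> (ftor_comp L R) (id_ftor (FCod L))"
      using nt2 iso2 by (auto simp: nat_iso_def K_def[symmetric] D_def[symmetric]) (auto simp: \<epsilon>_def)
  next
    fix x assume "x \<in> Obj (FDom L)"
    then show "NTMap \<epsilon> (FObj L x) \<odot>\<^bsub>FCod L\<^esub> FArr L (NTMap \<eta> x) = One (FCod L) (FObj L x)"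
      by (auto simp: \<epsilon>_def \<eta>_def K_def[symmetric] D_def[symmetric])
  next
    fix y assume "y \<in> Obj (FCod L)"
    then show "FArr R (NTMap \<epsilon> y) \<odot>\<^bsub>FDom L\<^esub> NTMap \<eta> (FObj R y) = One (FDom L) (FObj R y)"
      by (auto simp: \<epsilon>_def \<eta>_def K_def[symmetric] D_def[symmetric] intro!: faithful)
  qed (use assms R in \<open>auto simp: K_def[symmetric] D_def[symmetric]\<close>)
qed

section \<open>Bi-terminal objects\<close>

lemma op2_sel [simp]:
  "Ob (op2 C) = Ob C" "Mor (op2 C) = Mor C" "Cell (op2 C) = Cell C"
  "Src (op2 C) = Trg C" "Trg (op2 C) = Src C" "CSrc (op2 C) = CSrc C" "CTrg (op2 C) = CTrg C"
  "Id1 (op2 C) = Id1 C" "Id2 (op2 C) = Id2 C" "g \<cdot>\<^bsub>op2 C\<^esub> f = f \<cdot>\<^bsub>C\<^esub> g"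
  "VComp (op2 C) = VComp C" "\<beta> \<star>\<^bsub>op2 C\<^esub> \<alpha> = \<alpha> \<star>\<^bsub>C\<^esub> \<beta>"
  by (simp_all add: op2_def)

lemma hom1_op2 [simp]: "hom1 (op2 C) X Y = hom1 C Y X"
  by (auto simp: hom1_def)

lemma hom2_op2 [simp]: "hom2 (op2 C) f g = hom2 C f g"
  by (auto simp: hom2_def)

lemma hom_cat_op2 [simp]: "hom_cat (op2 C) X Y = hom_cat C Y X"
  by (simp add: hom_cat_def)

lemma (in two_category) two_category_op2: "two_category (op2 C)"
  by (rule two_category.intro) (auto simp: hom1_iff hom2_iff interchange' hom_category)

lemma pseudo_slice_sel [simp]:
  "Ob (pseudo_slice A X) = slice_obs A X" "Mor (pseudo_slice A X) = slice_mors A X"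
  "Cell (pseudo_slice A X) = slice_cells A X"
  "Src (pseudo_slice A X) (p, m, q) = p" "Trg (pseudo_slice A X) (p, m, q) = q"
  "CSrc (pseudo_slice A X) (r, \<beta>, s) = r" "CTrg (pseudo_slice A X) (r, \<beta>, s) = s"
  "Id1 (pseudo_slice A X) = slice_id A" "Comp1 (pseudo_slice A X) = slice_comp A"
  "Id2 (pseudo_slice A X) (p, (a, \<psi>), q) = ((p, (a, \<psi>), q), Id2 A a, (p, (a, \<psi>), q))"
  "VComp (pseudo_slice A X) (r', \<beta>', s') (r, \<beta>, s) = (r, \<beta>' \<bullet>\<^bsub>A\<^esub> \<beta>, s')"
  "HComp (pseudo_slice A X) (r', \<beta>', s') (r, \<beta>, s)
    = (slice_comp A r' r, \<beta>' \<star>\<^bsub>A\<^esub> \<beta>, slice_comp A s' s)"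
  by (simp_all add: pseudo_slice_def)

lemma slice_proj_sel [simp]:
  "PObj (slice_proj A) = fst" "PMor (slice_proj A) (p, (a, \<psi>), q) = a"
  "PCell (slice_proj A) (r, \<beta>, s) = \<beta>"
  "PComp (slice_proj A) (p', (a', \<psi>'), q') (p, (a, \<psi>), q) = Id2 A (a' \<cdot>\<^bsub>A\<^esub> a)"
  by (simp_all add: slice_proj_def)

lemma slice_comp_simp [simp]:
  "slice_comp A (p', (a', \<psi>'), q') (p, (a, \<psi>), q)
    = (p, (a' \<cdot>\<^bsub>A\<^esub> a, (Id2 A a' \<star>\<^bsub>A\<^esub> \<psi>) \<bullet>\<^bsub>A\<^esub> \<psi>'), q')"
  by (simp add: slice_comp_def)

lemma slice_mors_iff:
  "((Y, f), (a, \<psi>), (Y', f')) \<in> slice_mors A X \<longleftrightarrow>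
    (Y, f) \<in> slice_obs A X \<and> (Y', f') \<in> slice_obs A X \<and>
    a \<in> hom1 A Y Y' \<and> \<psi> \<in> iso2 A f' (a \<cdot>\<^bsub>A\<^esub> f)"
  by (simp add: slice_mors_def)

lemma slice_cells_iff:
  "(((Y, f), (a, \<psi>), (Y', f')), \<beta>, ((Z, g), (b, \<phi>), (Z', g'))) \<in> slice_cells A X \<longleftrightarrow>
    ((Y, f), (a, \<psi>), (Y', f')) \<in> slice_mors A X \<and>
    ((Z, g), (b, \<phi>), (Z', g')) \<in> slice_mors A X \<and>
    (Z, g) = (Y, f) \<and> (Z', g') = (Y', f') \<and>
    \<beta> \<in> hom2 A a b \<and> (\<beta> \<star>\<^bsub>A\<^esub> Id2 A f) \<bullet>\<^bsub>A\<^esub> \<psi> = \<phi>"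
  by (simp add: slice_cells_def)

lemma slice_hom1E:
  assumes "m \<in> hom1 (pseudo_slice A X) p q"
  obtains Y f a \<psi> Y' f' where "p = (Y, f)" "q = (Y', f')" "m = ((Y, f), (a, \<psi>), (Y', f'))"
    "(Y, f) \<in> slice_obs A X" "(Y', f') \<in> slice_obs A X" "a \<in> hom1 A Y Y'" "\<psi> \<in> iso2 A f' (a \<cdot>\<^bsub>A\<^esub> f)"
  using assms by (cases m; cases p; cases q) (auto simp: hom1_def[of "pseudo_slice A X"] slice_mors_iff)

lemma slice_hom2E:
  assumes "x \<in> hom2 (pseudo_slice A X) m n"
  obtains Y f a \<psi> Y' f' b \<phi> \<beta> where "m = ((Y, f), (a, \<psi>), (Y', f'))" "n = ((Y, f), (b, \<phi>), (Y', f'))"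
    "x = (m, \<beta>, n)" "m \<in> slice_mors A X" "n \<in> slice_mors A X" "\<beta> \<in> hom2 A a b"
    "(\<beta> \<star>\<^bsub>A\<^esub> Id2 A f) \<bullet>\<^bsub>A\<^esub> \<psi> = \<phi>"
  using assms by (cases x) (auto simp: hom2_def[of "pseudo_slice A X"] slice_cells_def)

lemma (in two_category) slice_proj_two_functor:
  assumes X: "X \<in> Ob C"
  shows "two_functor (pseudo_slice C X) C (slice_proj C)"
proof -
  have "normal_pseudo_functor (pseudo_slice C X) C (slice_proj C)"
    by (rule normal_pseudo_functor.intro)
      (auto elim!: slice_hom1E slice_hom2E
        simp: slice_obs_def slice_mors_iff slice_cells_iff slice_id_def hom1_iff hom2_iff)
  then show ?thesis
    by (auto simp: two_functor_def slice_mors_def)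
qed

text \<open>If every hom-category out of \<open>X\<close> is contractible, the slice data over a morphism of \<open>C\<close> exist and
  are unique, so the projection lifts everything.  Conversely, lifting an identity \<open>Id1 C Z\<close>
  to the slice compares two morphisms \<open>f, g : X \<rightarrow> Z\<close> by an invertible \<open>\<psi> : g \<Rightarrow> f\<close>, and lifting
  a \<open>\<beta> : f \<Rightarrow> g\<close> between morphisms out of \<open>(X, Id1 C X)\<close> forces \<open>\<beta>\<close> to be inverse to \<open>\<psi>\<close>.\<close>

lemma (in two_category) bi_initial_iff:
  assumes X: "X \<in> Ob C"
  shows "bi_initial C X \<longleftrightarrow>
    (\<forall>Z \<in> Ob C. hom1 C X Z \<noteq> {} \<and> (\<forall>f \<in> hom1 C X Z. \<forall>g \<in> hom1 C X Z. \<exists>!\<beta>. \<beta> \<in> hom2 C f g))"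
    (is "_ \<longleftrightarrow> ?contr")
proof
  let ?S = "pseudo_slice C X" and ?G = "slice_proj C"
  assume "bi_initial C X"
  then have tf: "trivial_fibration ?S C ?G" by (simp add: bi_initial_def)
  show ?contr
  proof (intro ballI conjI)
    fix Z assume "Z \<in> Ob C"
    then have "Z \<in> fst ` slice_obs C X" using tf by (simp add: trivial_fibration_def)
    then show "hom1 C X Z \<noteq> {}" by (auto simp: slice_obs_def)
  next
    fix Z f g assume Z: "Z \<in> Ob C" and f: "f \<in> hom1 C X Z" and g: "g \<in> hom1 C X Z"
    have obs: "(Z, f) \<in> slice_obs C X" "(Z, g) \<in> slice_obs C X" "(X, Id1 C X) \<in> slice_obs C X"
      using Z X f g by (auto simp: slice_obs_def hom1_iff)
    have "Id1 C Z \<in> PMor ?G ` hom1 ?S (Z, f) (Z, g)"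
      using tf obs Z by (auto simp: trivial_fibration_def hom1_iff)
    then obtain \<psi> where \<psi>: "\<psi> \<in> iso2 C g f"
      using f by (auto elim!: slice_hom1E simp: hom1_iff)
    then obtain \<psi>' where \<psi>': "\<psi>' \<in> hom2 C f g" "\<psi> \<bullet> \<psi>' = Id2 C f" by (auto simp: iso2_iff)
    define m n where "m = ((X, Id1 C X), (f, \<psi>), (Z, g))"
      and "n = ((X, Id1 C X), (g, Id2 C g), (Z, g))"
    have mn: "m \<in> hom1 ?S (X, Id1 C X) (Z, g)"
      "n \<in> hom1 ?S (X, Id1 C X) (Z, g)"
      using obs f g \<psi> X by (auto simp: m_def n_def hom1_iff slice_mors_iff)
    have "\<beta> = \<psi>'" if \<beta>: "\<beta> \<in> hom2 C f g" for \<beta>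
    proof -
      have "bij_betw (PCell ?G) (hom2 ?S m n) (hom2 C f g)"
        using tf obs mn unfolding trivial_fibration_def
        by (metis (no_types, lifting) m_def n_def pseudo_slice_sel(1) slice_proj_sel(2))
      then have "\<beta> \<in> PCell ?G ` hom2 ?S m n"
        using \<beta> by (simp add: bij_betw_def)
      then have "(\<beta> \<star> Id2 C (Id1 C X)) \<bullet> \<psi> = Id2 C g"
        by (auto elim!: slice_hom2E simp: m_def n_def)
      then have "\<beta> \<bullet> \<psi> = Id2 C g" using \<beta> f by (simp add: hom2_iff hom1_iff)
      moreover have "\<beta> \<bullet> (\<psi> \<bullet> \<psi>') = (\<beta> \<bullet> \<psi>) \<bullet> \<psi>'"
        using \<beta> \<psi>' iso2_hom2[OF \<psi>] by (simp add: hom2_iff)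
      ultimately show ?thesis using \<psi>' \<beta> by (auto simp: hom2_iff)
    qed
    then show "\<exists>!\<beta>. \<beta> \<in> hom2 C f g" using \<psi>'(1) by blast
  qed
next
  let ?S = "pseudo_slice C X" and ?G = "slice_proj C"
  assume contr: ?contr
  have unique: "\<alpha> = \<beta>" if "\<alpha> \<in> hom2 C f g" "\<beta> \<in> hom2 C f g" "f \<in> hom1 C X Z" "g \<in> hom1 C X Z"
    for f g Z \<alpha> \<beta>
    using that contr by (metis hom1_iff trg_ob)
  have ex_iso: "\<exists>\<psi>. \<psi> \<in> iso2 C f g" if f: "f \<in> hom1 C X Z" and g: "g \<in> hom1 C X Z" for f g Z
  proof -
    obtain \<psi> \<psi>' where "\<psi> \<in> hom2 C f g" "\<psi>' \<in> hom2 C g f"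
      using f g contr by (metis hom1_iff trg_ob)
    moreover from this have "\<psi>' \<bullet> \<psi> = Id2 C f"
      using f by (intro unique[of _ f f _ Z]) (auto simp: hom2_iff hom1_iff)
    moreover from calculation(1,2) have "\<psi> \<bullet> \<psi>' = Id2 C g"
      using g by (intro unique[of _ g g _ Z]) (auto simp: hom2_iff hom1_iff)
    ultimately show ?thesis unfolding iso2_iff by blast
  qed
  have "trivial_fibration ?S C ?G"
    unfolding trivial_fibration_def
  proof (intro conjI ballI)
    show "two_functor ?S C ?G" by (rule slice_proj_two_functor[OF X])
    show "PObj ?G ` Ob ?S = Ob C"
      using contr by (force simp: slice_obs_def image_iff)
  next
    fix p q assume "p \<in> Ob ?S" "q \<in> Ob ?S"
    then obtain Y f Z g where pq: "p = (Y, f)" "q = (Z, g)" "(Y, f) \<in> slice_obs C X"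
      "(Z, g) \<in> slice_obs C X" "f \<in> hom1 C X Y" "g \<in> hom1 C X Z"
      by (auto simp: slice_obs_def)
    show "PMor ?G ` hom1 ?S p q = hom1 C (PObj ?G p) (PObj ?G q)"
    proof
      show "PMor ?G ` hom1 ?S p q \<subseteq> hom1 C (PObj ?G p) (PObj ?G q)"
        by (auto elim!: slice_hom1E)
    next
      show "hom1 C (PObj ?G p) (PObj ?G q) \<subseteq> PMor ?G ` hom1 ?S p q"
      proof
        fix a assume a: "a \<in> hom1 C (PObj ?G p) (PObj ?G q)"
        then obtain \<psi> where "\<psi> \<in> iso2 C g (a \<cdot> f)"
          using ex_iso[of g Z "a \<cdot> f"] pq by (auto simp: hom1_iff)
        then have "((Y, f), (a, \<psi>), (Z, g)) \<in> hom1 ?S p q"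
          using a pq unfolding hom1_iff[of _ ?S] by (simp add: slice_mors_iff)
        then show "a \<in> PMor ?G ` hom1 ?S p q" by force
      qed
    qed
    fix m n assume "m \<in> hom1 ?S p q" "n \<in> hom1 ?S p q"
    then obtain a \<psi> b \<phi> where mn: "m = ((Y, f), (a, \<psi>), (Z, g))" "n = ((Y, f), (b, \<phi>), (Z, g))"
      "a \<in> hom1 C Y Z" "b \<in> hom1 C Y Z" "\<psi> \<in> iso2 C g (a \<cdot> f)" "\<phi> \<in> iso2 C g (b \<cdot> f)"
      "m \<in> slice_mors C X" "n \<in> slice_mors C X"
      using pq by (auto elim!: slice_hom1E simp: slice_mors_iff)
    show "bij_betw (PCell ?G) (hom2 ?S m n) (hom2 C (PMor ?G m) (PMor ?G n))"
    proof (intro bij_betwI')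
      fix x y assume "x \<in> hom2 ?S m n" "y \<in> hom2 ?S m n"
      then show "(PCell ?G x = PCell ?G y) = (x = y)"
        by (auto elim!: slice_hom2E)
    next
      fix x assume "x \<in> hom2 ?S m n"
      then show "PCell ?G x \<in> hom2 C (PMor ?G m) (PMor ?G n)"
        by (auto elim!: slice_hom2E)
    next
      fix \<beta> assume \<beta>: "\<beta> \<in> hom2 C (PMor ?G m) (PMor ?G n)"
      have "(\<beta> \<star> Id2 C f) \<bullet> \<psi> = \<phi>"
        by (rule unique[of _ g "b \<cdot> f" _ Z])
          (use \<beta> mn pq iso2_hom2[OF mn(5)] iso2_hom2[OF mn(6)] in \<open>auto simp: hom1_iff hom2_iff\<close>)
      then have "(m, \<beta>, n) \<in> hom2 ?S m n"
        using mn \<beta> unfolding hom2_iff[of _ ?S] by (auto simp: slice_cells_iff)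
      then show "\<exists>x \<in> hom2 ?S m n. \<beta> = PCell ?G x" by force
    qed
  qed
  then show "bi_initial C X" using X by (simp add: bi_initial_def)
qed

lemma (in two_category) bi_terminal_iff:
  assumes "X \<in> Ob C"
  shows "bi_terminal C X \<longleftrightarrow>
    (\<forall>Z \<in> Ob C. hom1 C Z X \<noteq> {} \<and> (\<forall>f \<in> hom1 C Z X. \<forall>g \<in> hom1 C Z X. \<exists>!\<beta>. \<beta> \<in> hom2 C f g))"
  using two_category.bi_initial_iff[OF two_category_op2, of X] assms by (simp add: bi_terminal_def)

section \<open>Pseudo-cones\<close>

context normal_pseudo_functor
begin

lemma mor [simp]:
  assumes "u \<in> Mor A"
  shows "PMor F u \<in> Mor B" "Src B (PMor F u) = PObj F (Src A u)" "Trg B (PMor F u) = PObj F (Trg A u)"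
  using mor_map[of u "Src A u" "Trg A u"] assms by (auto simp: hom1_iff)

lemma cell [simp]:
  assumes "\<alpha> \<in> Cell A"
  shows "PCell F \<alpha> \<in> Cell B" "CSrc B (PCell F \<alpha>) = PMor F (CSrc A \<alpha>)"
    "CTrg B (PCell F \<alpha>) = PMor F (CTrg A \<alpha>)"
  using cell_map[of \<alpha> "CSrc A \<alpha>" "CTrg A \<alpha>"] assms by (auto simp: hom2_iff)

lemma compositor [simp]:
  assumes "u \<in> Mor A" "u' \<in> Mor A" "Src A u' = Trg A u"
  shows "PComp F u' u \<in> Cell B" "CSrc B (PComp F u' u) = PMor F u' \<cdot>\<^bsub>B\<^esub> PMor F u"
    "CTrg B (PComp F u' u) = PMor F (u' \<cdot>\<^bsub>A\<^esub> u)"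
  using comp_iso[of u "Src A u" "Trg A u" u' "Trg A u'"] assms by (auto simp: hom1_iff hom2_iff iso2_def)

end

type_synonym ('io, 'im, 'm, 'c) cone_data = "('io \<Rightarrow> 'm) \<times> ('im \<Rightarrow> 'c)"

locale diagram = I: two_category I + C: two_category C + F: normal_pseudo_functor I C F
  for I :: "('io, 'im, 'ic) two_cat" and C :: "('o, 'm, 'c) two_cat" (structure)
    and F :: "('io, 'im, 'ic, 'o, 'm, 'c) pfun"
begin

declare F.ob_map [simp]

text \<open>Both \<open>Ps(I, C)(\<Delta>Y, F)\<close> and \<open>Ps(I, Cat)(\<Delta>1, C(Y, F-))\<close> consist of the following elementary
  data: legs \<open>p i : Y \<rightarrow> F i\<close> and invertible cells \<open>q u : F u \<cdot> p i \<Rightarrow> p j\<close> for \<open>u : i \<rightarrow> j\<close>.\<close>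

definition pcone :: "'o \<Rightarrow> ('io, 'im, 'm, 'c) cone_data \<Rightarrow> bool" where
  "pcone Y = (\<lambda>(p, q).
    (\<forall>i \<in> Ob I. p i \<in> hom1 C Y (PObj F i)) \<and>
    (\<forall>u \<in> Mor I. q u \<in> iso2 C (PMor F u \<cdot> p (Src I u)) (p (Trg I u))) \<and>
    (\<forall>\<alpha> \<in> Cell I. q (CTrg I \<alpha>) \<bullet> (PCell F \<alpha> \<star> Id2 C (p (Src I (CSrc I \<alpha>)))) = q (CSrc I \<alpha>)) \<and>
    (\<forall>u \<in> Mor I. \<forall>u' \<in> Mor I. Src I u' = Trg I u \<longrightarrow>
      q (u' \<cdot>\<^bsub>I\<^esub> u) \<bullet> (PComp F u' u \<star> Id2 C (p (Src I u))) = q u' \<bullet> (Id2 C (PMor F u') \<star> q u)) \<and>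
    (\<forall>i \<in> Ob I. q (Id1 I i) = Id2 C (p i)))"

definition pmod :: "('io, 'im, 'm, 'c) cone_data \<Rightarrow> ('io, 'im, 'm, 'c) cone_data \<Rightarrow> ('io \<Rightarrow> 'c) \<Rightarrow> bool" where
  "pmod = (\<lambda>(p, q) (p', q') m.
    (\<forall>i \<in> Ob I. m i \<in> hom2 C (p i) (p' i)) \<and>
    (\<forall>u \<in> Mor I. m (Trg I u) \<bullet> q u = q' u \<bullet> (Id2 C (PMor F u) \<star> m (Src I u))))"

definition piso :: "('io, 'im, 'm, 'c) cone_data \<Rightarrow> ('io, 'im, 'm, 'c) cone_data \<Rightarrow> ('io \<Rightarrow> 'c) \<Rightarrow> bool" where
  "piso k k' m \<longleftrightarrow> pmod k k' m \<and> (\<forall>i \<in> Ob I. m i \<in> iso2 C (fst k i) (fst k' i))"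

definition precompose :: "('io, 'im, 'm, 'c) cone_data \<Rightarrow> 'm \<Rightarrow> ('io, 'im, 'm, 'c) cone_data" (infixl "\<triangleleft>" 71) where
  "k \<triangleleft> c = (\<lambda>i. fst k i \<cdot> c, \<lambda>u. snd k u \<star> Id2 C c)"

text \<open>The values outside \<open>I\<close> carry no information, so cone data are only compared on \<open>I\<close>.\<close>

definition same :: "('io, 'im, 'm, 'c) cone_data \<Rightarrow> ('io, 'im, 'm, 'c) cone_data \<Rightarrow> bool" (infix "\<simeq>" 50) where
  "k \<simeq> k' \<longleftrightarrow> (\<forall>i \<in> Ob I. fst k i = fst k' i) \<and> (\<forall>u \<in> Mor I. snd k u = snd k' u)"

lemma same_refl [simp]: "k \<simeq> k"
  by (simp add: same_def)

lemma same_sym: "k \<simeq> k' \<Longrightarrow> k' \<simeq> k"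
  by (simp add: same_def)

lemma precompose_sel [simp]: "fst (k \<triangleleft> c) i = fst k i \<cdot> c" "snd (k \<triangleleft> c) u = snd k u \<star> Id2 C c"
  by (simp_all add: precompose_def)

lemma pcone_cong: "k \<simeq> k' \<Longrightarrow> pcone Y k \<Longrightarrow> pcone Y k'"
  by (cases k; cases k') (simp add: pcone_def same_def)

lemma pmod_cong: "k \<simeq> k' \<Longrightarrow> l \<simeq> l' \<Longrightarrow> (\<And>i. i \<in> Ob I \<Longrightarrow> m i = m' i) \<Longrightarrow> pmod k l m \<Longrightarrow> pmod k' l' m'"
  by (cases k; cases k'; cases l; cases l') (simp add: pmod_def same_def)

lemma piso_cong: "k \<simeq> k' \<Longrightarrow> l \<simeq> l' \<Longrightarrow> (\<And>i. i \<in> Ob I \<Longrightarrow> m i = m' i) \<Longrightarrow> piso k l m \<Longrightarrow> piso k' l' m'"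
  using pmod_cong[of k k' l l' m m'] by (auto simp: piso_def same_def)

lemma pcone_leg:
  assumes "pcone Y k" "i \<in> Ob I"
  shows "fst k i \<in> Mor C" "Src C (fst k i) = Y" "Trg C (fst k i) = PObj F i"
  using assms by (auto simp: pcone_def hom1_iff split: prod.splits)

lemma pcone_iso2: "pcone Y k \<Longrightarrow> u \<in> Mor I \<Longrightarrow> snd k u \<in> iso2 C (PMor F u \<cdot> fst k (Src I u)) (fst k (Trg I u))"
  by (auto simp: pcone_def split: prod.splits)

lemma pcone_cell:
  assumes "pcone Y k" "u \<in> Mor I"
  shows "snd k u \<in> Cell C" "CSrc C (snd k u) = PMor F u \<cdot> fst k (Src I u)"
    "CTrg C (snd k u) = fst k (Trg I u)"
  using C.iso2_hom2[OF pcone_iso2[OF assms]] by (auto simp: hom2_iff)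

lemma pcone_nat:
  "pcone Y k \<Longrightarrow> \<alpha> \<in> Cell I
    \<Longrightarrow> snd k (CTrg I \<alpha>) \<bullet> (PCell F \<alpha> \<star> Id2 C (fst k (Src I (CSrc I \<alpha>)))) = snd k (CSrc I \<alpha>)"
  by (auto simp: pcone_def split: prod.splits)

lemma pcone_comp:
  "pcone Y k \<Longrightarrow> u \<in> Mor I \<Longrightarrow> u' \<in> Mor I \<Longrightarrow> Src I u' = Trg I u
    \<Longrightarrow> snd k (u' \<cdot>\<^bsub>I\<^esub> u) \<bullet> (PComp F u' u \<star> Id2 C (fst k (Src I u)))
        = snd k u' \<bullet> (Id2 C (PMor F u') \<star> snd k u)"
  by (auto simp: pcone_def split: prod.splits)

lemma pcone_id: "pcone Y k \<Longrightarrow> i \<in> Ob I \<Longrightarrow> snd k (Id1 I i) = Id2 C (fst k i)"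
  by (auto simp: pcone_def split: prod.splits)

lemma pconeI:
  assumes "\<And>i. i \<in> Ob I \<Longrightarrow> fst k i \<in> hom1 C Y (PObj F i)"
    and "\<And>u. u \<in> Mor I \<Longrightarrow> snd k u \<in> iso2 C (PMor F u \<cdot> fst k (Src I u)) (fst k (Trg I u))"
    and "\<And>\<alpha>. \<alpha> \<in> Cell I
      \<Longrightarrow> snd k (CTrg I \<alpha>) \<bullet> (PCell F \<alpha> \<star> Id2 C (fst k (Src I (CSrc I \<alpha>)))) = snd k (CSrc I \<alpha>)"
    and "\<And>u u'. u \<in> Mor I \<Longrightarrow> u' \<in> Mor I \<Longrightarrow> Src I u' = Trg I u
      \<Longrightarrow> snd k (u' \<cdot>\<^bsub>I\<^esub> u) \<bullet> (PComp F u' u \<star> Id2 C (fst k (Src I u)))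
          = snd k u' \<bullet> (Id2 C (PMor F u') \<star> snd k u)"
    and "\<And>i. i \<in> Ob I \<Longrightarrow> snd k (Id1 I i) = Id2 C (fst k i)"
  shows "pcone Y k"
  using assms by (auto simp: pcone_def split: prod.splits)

lemma pmod_cell:
  assumes "pmod k k' m" "i \<in> Ob I"
  shows "m i \<in> Cell C" "CSrc C (m i) = fst k i" "CTrg C (m i) = fst k' i"
  using assms by (auto simp: pmod_def hom2_iff split: prod.splits)

lemma pmod_compat:
  "pmod k k' m \<Longrightarrow> u \<in> Mor I
    \<Longrightarrow> m (Trg I u) \<bullet> snd k u = snd k' u \<bullet> (Id2 C (PMor F u) \<star> m (Src I u))"
  by (auto simp: pmod_def split: prod.splits)

lemma pmodI:
  assumes "\<And>i. i \<in> Ob I \<Longrightarrow> m i \<in> hom2 C (fst k i) (fst k' i)"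
    and "\<And>u. u \<in> Mor I
      \<Longrightarrow> m (Trg I u) \<bullet> snd k u = snd k' u \<bullet> (Id2 C (PMor F u) \<star> m (Src I u))"
  shows "pmod k k' m"
  using assms by (auto simp: pmod_def split: prod.splits)

lemma pcone_precompose:
  assumes k: "pcone X k" and c: "c \<in> hom1 C Y X"
  shows "pcone Y (k \<triangleleft> c)"
proof (rule pconeI)
  note [simp] = pcone_leg[OF k] pcone_cell[OF k]
  have [simp]: "c \<in> Mor C" "Src C c = Y" "Trg C c = X" using c by (auto simp: hom1_iff)
  show "fst (k \<triangleleft> c) i \<in> hom1 C Y (PObj F i)" if "i \<in> Ob I" for i
    using that by (simp add: hom1_iff)
  show "snd (k \<triangleleft> c) u \<in> iso2 C (PMor F u \<cdot> fst (k \<triangleleft> c) (Src I u)) (fst (k \<triangleleft> c) (Trg I u))"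
    if "u \<in> Mor I" for u
    using C.iso2_whisker_right[OF pcone_iso2[OF k that], of c] that by simp
  show "snd (k \<triangleleft> c) (CTrg I \<alpha>) \<bullet> (PCell F \<alpha> \<star> Id2 C (fst (k \<triangleleft> c) (Src I (CSrc I \<alpha>))))
      = snd (k \<triangleleft> c) (CSrc I \<alpha>)" if "\<alpha> \<in> Cell I" for \<alpha>
    using arg_cong[OF pcone_nat[OF k that], of "\<lambda>x. x \<star> Id2 C c"] that by simp
  show "snd (k \<triangleleft> c) (u' \<cdot>\<^bsub>I\<^esub> u) \<bullet> (PComp F u' u \<star> Id2 C (fst (k \<triangleleft> c) (Src I u)))
      = snd (k \<triangleleft> c) u' \<bullet> (Id2 C (PMor F u') \<star> snd (k \<triangleleft> c) u)"
    if "u \<in> Mor I" "u' \<in> Mor I" "Src I u' = Trg I u" for u u'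
    using arg_cong[OF pcone_comp[OF k that], of "\<lambda>x. x \<star> Id2 C c"] that by simp
  show "snd (k \<triangleleft> c) (Id1 I i) = Id2 C (fst (k \<triangleleft> c) i)" if "i \<in> Ob I" for i
    using that by (simp add: pcone_id[OF k])
qed

lemma precompose_precompose:
  assumes "pcone X k" "c \<in> hom1 C Y X" "d \<in> hom1 C Z Y"
  shows "k \<triangleleft> c \<triangleleft> d \<simeq> k \<triangleleft> (c \<cdot> d)"
  using assms by (auto simp: same_def hom1_iff pcone_leg pcone_cell)

lemma precompose_id: "pcone X k \<Longrightarrow> k \<triangleleft> Id1 C X \<simeq> k"
  using pcone_leg[of X k] pcone_cell[of X k] by (auto simp: same_def)

lemma pmod_precompose:
  assumes k: "pcone X k" and k': "pcone X k'" and m: "pmod k k' m" and c: "c \<in> hom1 C Y X"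
  shows "pmod (k \<triangleleft> c) (k' \<triangleleft> c) (\<lambda>i. m i \<star> Id2 C c)"
proof (rule pmodI)
  note [simp] = pcone_leg[OF k] pcone_cell[OF k] pcone_leg[OF k'] pcone_cell[OF k'] pmod_cell[OF m]
  have [simp]: "c \<in> Mor C" "Src C c = Y" "Trg C c = X" using c by (auto simp: hom1_iff)
  show "m i \<star> Id2 C c \<in> hom2 C (fst (k \<triangleleft> c) i) (fst (k' \<triangleleft> c) i)" if "i \<in> Ob I" for i
    using that by (simp add: hom2_iff)
  show "(m (Trg I u) \<star> Id2 C c) \<bullet> snd (k \<triangleleft> c) u
      = snd (k' \<triangleleft> c) u \<bullet> (Id2 C (PMor F u) \<star> m (Src I u) \<star> Id2 C c)" if "u \<in> Mor I" for u
    using arg_cong[OF pmod_compat[OF m that], of "\<lambda>x. x \<star> Id2 C c"] that by simp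
qed

lemma piso_precompose:
  assumes "pcone X k" "pcone X k'" "piso k k' m" "c \<in> hom1 C Y X"
  shows "piso (k \<triangleleft> c) (k' \<triangleleft> c) (\<lambda>i. m i \<star> Id2 C c)"
  using pmod_precompose[of X k k' m c Y] assms C.iso2_whisker_right[of "m _" _ _ c] pcone_leg[of X k]
  by (auto simp: piso_def hom1_iff)

lemma pmod_whisker:
  assumes k: "pcone X k" and c: "c \<in> hom1 C Y X" and \<beta>: "\<beta> \<in> hom2 C c d"
  shows "pmod (k \<triangleleft> c) (k \<triangleleft> d) (\<lambda>i. Id2 C (fst k i) \<star> \<beta>)"
proof (rule pmodI)
  note [simp] = pcone_leg[OF k] pcone_cell[OF k]
  have [simp]: "c \<in> Mor C" "Src C c = Y" "Trg C c = X" "\<beta> \<in> Cell C" "CSrc C \<beta> = c" "CTrg C \<beta> = d"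
    using c \<beta> by (auto simp: hom1_iff hom2_iff)
  have [simp]: "d \<in> Mor C" "Src C d = Y" "Trg C d = X"
    using C.csrc_ctrg[of \<beta>] by auto
  show "Id2 C (fst k i) \<star> \<beta> \<in> hom2 C (fst (k \<triangleleft> c) i) (fst (k \<triangleleft> d) i)" if "i \<in> Ob I" for i
    using that by (simp add: hom2_iff)
  show "(Id2 C (fst k (Trg I u)) \<star> \<beta>) \<bullet> snd (k \<triangleleft> c) u
      = snd (k \<triangleleft> d) u \<bullet> (Id2 C (PMor F u) \<star> Id2 C (fst k (Src I u)) \<star> \<beta>)" if "u \<in> Mor I" for u
    using C.whisker_exchange[of \<beta> c d "snd k u" "PMor F u \<cdot> fst k (Src I u)" "fst k (Trg I u)"] that
    by (simp add: hom2_iff)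
qed

lemma pmod_id: "pcone Y k \<Longrightarrow> pmod k k (\<lambda>i. Id2 C (fst k i))"
  by (rule pmodI) (auto simp: hom2_iff pcone_leg pcone_cell)

lemma piso_id: "pcone Y k \<Longrightarrow> piso k k (\<lambda>i. Id2 C (fst k i))"
  using pcone_leg[of Y k] by (auto simp: piso_def pmod_id)

lemma pmod_vcomp:
  assumes k: "pcone Y k" and k': "pcone Y k'" and k'': "pcone Y k''"
    and m: "pmod k k' m" and n: "pmod k' k'' n"
  shows "pmod k k'' (\<lambda>i. n i \<bullet> m i)"
proof (rule pmodI)
  note [simp] = pcone_leg[OF k] pcone_cell[OF k] pcone_leg[OF k'] pcone_cell[OF k']
    pcone_leg[OF k''] pcone_cell[OF k''] pmod_cell[OF m] pmod_cell[OF n]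
  show "n i \<bullet> m i \<in> hom2 C (fst k i) (fst k'' i)" if "i \<in> Ob I" for i
    using that by (simp add: hom2_iff)
  fix u assume [simp]: "u \<in> Mor I"
  have "(n (Trg I u) \<bullet> m (Trg I u)) \<bullet> snd k u = n (Trg I u) \<bullet> m (Trg I u) \<bullet> snd k u" by simp
  also have "\<dots> = n (Trg I u) \<bullet> snd k' u \<bullet> (Id2 C (PMor F u) \<star> m (Src I u))"
    by (simp only: pmod_compat[OF m \<open>u \<in> Mor I\<close>])
  also have "\<dots> = (n (Trg I u) \<bullet> snd k' u) \<bullet> (Id2 C (PMor F u) \<star> m (Src I u))" by simp
  also have "\<dots> = (snd k'' u \<bullet> (Id2 C (PMor F u) \<star> n (Src I u))) \<bullet> (Id2 C (PMor F u) \<star> m (Src I u))"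
    by (simp only: pmod_compat[OF n \<open>u \<in> Mor I\<close>])
  also have "\<dots> = snd k'' u \<bullet> (Id2 C (PMor F u) \<star> (n (Src I u) \<bullet> m (Src I u)))" by simp
  finally show "(n (Trg I u) \<bullet> m (Trg I u)) \<bullet> snd k u
      = snd k'' u \<bullet> (Id2 C (PMor F u) \<star> (n (Src I u) \<bullet> m (Src I u)))" .
qed

lemma piso_vcomp:
  assumes "pcone Y k" "pcone Y k'" "pcone Y k''" "piso k k' m" "piso k' k'' n"
  shows "piso k k'' (\<lambda>i. n i \<bullet> m i)"
  using assms pmod_vcomp[of Y k k' k'' m n] C.iso2_vcomp by (auto simp: piso_def)

lemma piso_inverse:
  assumes k: "pcone Y k" and k': "pcone Y k'" and m: "piso k k' m"
  obtains n where "piso k' k n" "\<And>i. i \<in> Ob I \<Longrightarrow> n i \<bullet> m i = Id2 C (fst k i)"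
    "\<And>i. i \<in> Ob I \<Longrightarrow> m i \<bullet> n i = Id2 C (fst k' i)"
proof -
  have "\<forall>i \<in> Ob I. \<exists>n. n \<in> hom2 C (fst k' i) (fst k i) \<and> n \<bullet> m i = Id2 C (fst k i) \<and>
      m i \<bullet> n = Id2 C (fst k' i)"
    using m by (auto simp: piso_def C.iso2_iff)
  then obtain n where n: "\<And>i. i \<in> Ob I \<Longrightarrow> n i \<in> hom2 C (fst k' i) (fst k i)"
    "\<And>i. i \<in> Ob I \<Longrightarrow> n i \<bullet> m i = Id2 C (fst k i)" "\<And>i. i \<in> Ob I \<Longrightarrow> m i \<bullet> n i = Id2 C (fst k' i)"
    by metis
  have m': "pmod k k' m" using m by (simp add: piso_def)
  note [simp] = pcone_leg[OF k] pcone_cell[OF k] pcone_leg[OF k'] pcone_cell[OF k'] pmod_cell[OF m']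
  have [simp]: "n i \<in> Cell C" "CSrc C (n i) = fst k' i" "CTrg C (n i) = fst k i" if "i \<in> Ob I" for i
    using n(1)[OF that] by (auto simp: hom2_iff)
  have "pmod k' k n"
  proof (rule pmodI)
    fix u assume [simp]: "u \<in> Mor I"
    let ?i = "Src I u" and ?j = "Trg I u"
    have "n ?j \<bullet> snd k' u = n ?j \<bullet> snd k' u \<bullet> (Id2 C (PMor F u) \<star> (m ?i \<bullet> n ?i))"
      by (simp add: n del: C.whisker_left_vcomp)
    also have "\<dots> = n ?j \<bullet> (snd k' u \<bullet> (Id2 C (PMor F u) \<star> m ?i)) \<bullet> (Id2 C (PMor F u) \<star> n ?i)" by simp
    also have "\<dots> = n ?j \<bullet> (m ?j \<bullet> snd k u) \<bullet> (Id2 C (PMor F u) \<star> n ?i)"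
      by (simp only: pmod_compat[OF m' \<open>u \<in> Mor I\<close>])
    also have "\<dots> = (n ?j \<bullet> m ?j) \<bullet> snd k u \<bullet> (Id2 C (PMor F u) \<star> n ?i)" by simp
    also have "\<dots> = snd k u \<bullet> (Id2 C (PMor F u) \<star> n ?i)" by (simp add: n del: C.vcomp_assoc)
    finally show "n ?j \<bullet> snd k' u = snd k u \<bullet> (Id2 C (PMor F u) \<star> n ?i)" .
  qed (use n in auto)
  moreover have "n i \<in> iso2 C (fst k' i) (fst k i)" if "i \<in> Ob I" for i
    using n m' that by (auto simp: C.iso2_iff hom2_iff intro!: exI[of _ "m i"])
  ultimately have "piso k' k n" by (simp add: piso_def)
  then show ?thesis by (rule that) (use n in auto)
qed

end

section \<open>The pseudo-slice of cones\<close>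

lemma Ps_sel [simp]:
  "Ob (Ps A B) = {F. normal_pseudo_functor A B F}" "Mor (Ps A B) = {\<theta>. pseudo_nat A B \<theta>}"
  "Cell (Ps A B) = {\<Gamma>. modification A B \<Gamma>}"
  "Src (Ps A B) = NDom" "Trg (Ps A B) = NCod" "CSrc (Ps A B) = MDom" "CTrg (Ps A B) = MCod"
  "Id1 (Ps A B) = id_psnat A B" "Comp1 (Ps A B) = psnat_comp A B"
  "Id2 (Ps A B) = id_modif A B" "VComp (Ps A B) = modif_vcomp A B" "HComp (Ps A B) = modif_hcomp A B"
  by (simp_all add: Ps_def)

lemma diag_ob_sel [simp]:
  "PObj (diag_ob B X) i = X" "PMor (diag_ob B X) u = Id1 B X" "PCell (diag_ob B X) \<alpha> = Id2 B (Id1 B X)"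
  "PComp (diag_ob B X) u v = Id2 B (Id1 B X)"
  by (simp_all add: diag_ob_def)

lemma diag_mor_sel [simp]:
  "NDom (diag_mor A B f) = diag_ob B (Src B f)" "NCod (diag_mor A B f) = diag_ob B (Trg B f)"
  "i \<in> Ob A \<Longrightarrow> NObj (diag_mor A B f) i = f" "u \<in> Mor A \<Longrightarrow> NMor (diag_mor A B f) u = Id2 B f"
  by (simp_all add: diag_mor_def)

lemma diag_cell_sel [simp]:
  "MDom (diag_cell A B \<beta>) = diag_mor A B (CSrc B \<beta>)" "MCod (diag_cell A B \<beta>) = diag_mor A B (CTrg B \<beta>)"
  "i \<in> Ob A \<Longrightarrow> MObj (diag_cell A B \<beta>) i = \<beta>"
  by (simp_all add: diag_cell_def)

lemma psnat_comp_sel [simp]: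
  "NDom (psnat_comp A B \<upsilon> \<theta>) = NDom \<theta>" "NCod (psnat_comp A B \<upsilon> \<theta>) = NCod \<upsilon>"
  "i \<in> Ob A \<Longrightarrow> NObj (psnat_comp A B \<upsilon> \<theta>) i = NObj \<upsilon> i \<cdot>\<^bsub>B\<^esub> NObj \<theta> i"
  "u \<in> Mor A \<Longrightarrow> NMor (psnat_comp A B \<upsilon> \<theta>) u = (Id2 B (NObj \<upsilon> (Trg A u)) \<star>\<^bsub>B\<^esub> NMor \<theta> u) \<bullet>\<^bsub>B\<^esub>
                        (NMor \<upsilon> u \<star>\<^bsub>B\<^esub> Id2 B (NObj \<theta> (Src A u)))"
  "NObj (psnat_comp A B \<upsilon> \<theta>) \<in> extensional (Ob A)" "NMor (psnat_comp A B \<upsilon> \<theta>) \<in> extensional (Mor A)"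
  by (simp_all add: psnat_comp_def)

lemma modif_sel [simp]:
  "MDom (modif_vcomp A B \<Delta> \<Gamma>) = MDom \<Gamma>" "MCod (modif_vcomp A B \<Delta> \<Gamma>) = MCod \<Delta>"
  "i \<in> Ob A \<Longrightarrow> MObj (modif_vcomp A B \<Delta> \<Gamma>) i = MObj \<Delta> i \<bullet>\<^bsub>B\<^esub> MObj \<Gamma> i"
  "MObj (modif_vcomp A B \<Delta> \<Gamma>) \<in> extensional (Ob A)"
  "MDom (modif_hcomp A B \<Delta> \<Gamma>) = psnat_comp A B (MDom \<Delta>) (MDom \<Gamma>)"
  "MCod (modif_hcomp A B \<Delta> \<Gamma>) = psnat_comp A B (MCod \<Delta>) (MCod \<Gamma>)"
  "i \<in> Ob A \<Longrightarrow> MObj (modif_hcomp A B \<Delta> \<Gamma>) i = MObj \<Delta> i \<star>\<^bsub>B\<^esub> MObj \<Gamma> i"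
  "MObj (modif_hcomp A B \<Delta> \<Gamma>) \<in> extensional (Ob A)"
  "MDom (id_modif A B \<theta>) = \<theta>" "MCod (id_modif A B \<theta>) = \<theta>"
  "i \<in> Ob A \<Longrightarrow> MObj (id_modif A B \<theta>) i = Id2 B (NObj \<theta> i)"
  "MObj (id_modif A B \<theta>) \<in> extensional (Ob A)"
  by (simp_all add: modif_vcomp_def modif_hcomp_def id_modif_def)

lemma psnat_eqI:
  fixes \<theta> \<theta>' :: "('ao, 'am, 'ac, 'bo, 'bm, 'bc) psnat"
  assumes "NDom \<theta> = NDom \<theta>'" "NCod \<theta> = NCod \<theta>'"
    and "NObj \<theta> \<in> extensional S" "NObj \<theta>' \<in> extensional S" "\<And>i. i \<in> S \<Longrightarrow> NObj \<theta> i = NObj \<theta>' i"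
    and "NMor \<theta> \<in> extensional T" "NMor \<theta>' \<in> extensional T" "\<And>u. u \<in> T \<Longrightarrow> NMor \<theta> u = NMor \<theta>' u"
  shows "\<theta> = \<theta>'"
  using assms extensionalityI[of "NObj \<theta>" S "NObj \<theta>'"] extensionalityI[of "NMor \<theta>" T "NMor \<theta>'"]
  by (cases \<theta>; cases \<theta>') simp

lemma modif_eqI:
  fixes \<Gamma> \<Gamma>' :: "('ao, 'am, 'ac, 'bo, 'bm, 'bc) modif"
  assumes "MDom \<Gamma> = MDom \<Gamma>'" "MCod \<Gamma> = MCod \<Gamma>'"
    and "MObj \<Gamma> \<in> extensional S" "MObj \<Gamma>' \<in> extensional S" "\<And>i. i \<in> S \<Longrightarrow> MObj \<Gamma> i = MObj \<Gamma>' i"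
  shows "\<Gamma> = \<Gamma>'"
  using assms extensionalityI[of "MObj \<Gamma>" S "MObj \<Gamma>'"] by (cases \<Gamma>; cases \<Gamma>') simp

context diagram
begin

lemma diag_ob_pseudo_functor:
  assumes "X \<in> Ob C"
  shows "normal_pseudo_functor I C (diag_ob C X)"
  by (rule normal_pseudo_functor.intro) (use assms in \<open>auto simp: hom1_iff hom2_iff\<close>)

definition data :: "('io, 'im, 'ic, 'o, 'm, 'c) psnat \<Rightarrow> ('io, 'im, 'm, 'c) cone_data" where
  "data \<kappa> = (NObj \<kappa>, NMor \<kappa>)"

lemma data_sel [simp]: "fst (data \<kappa>) = NObj \<kappa>" "snd (data \<kappa>) = NMor \<kappa>"
  by (simp_all add: data_def)

text \<open>Since \<open>\<Delta>Y\<close> sends everything to identities, the factors of the pseudo-naturality axioms that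
  involve the domain are trivial.\<close>

lemma psnat_iff_pcone:
  assumes Y: "Y \<in> Ob C"
  shows "\<kappa> \<in> hom1 (Ps I C) (diag_ob C Y) F \<longleftrightarrow> NDom \<kappa> = diag_ob C Y \<and> NCod \<kappa> = F \<and>
    NObj \<kappa> \<in> extensional (Ob I) \<and> NMor \<kappa> \<in> extensional (Mor I) \<and> pcone Y (data \<kappa>)" (is "?l \<longleftrightarrow> ?r")
proof
  assume ?l
  then have d: "NDom \<kappa> = diag_ob C Y" "NCod \<kappa> = F" and "pseudo_nat I C \<kappa>" by (auto simp: hom1_iff)
  then interpret \<kappa>: pseudo_nat I C \<kappa> by simp
  have leg [simp]: "NObj \<kappa> i \<in> Mor C" "Src C (NObj \<kappa> i) = Y" "Trg C (NObj \<kappa> i) = PObj F i"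
    if "i \<in> Ob I" for i
    using \<kappa>.obj_comp[OF that] by (auto simp: d hom1_iff)
  have iso: "NMor \<kappa> u \<in> iso2 C (PMor F u \<cdot> NObj \<kappa> (Src I u)) (NObj \<kappa> (Trg I u))" if "u \<in> Mor I" for u
    using \<kappa>.mor_comp[of u "Src I u" "Trg I u"] that by (auto simp: d hom1_iff)
  have [simp]: "NMor \<kappa> u \<in> Cell C" "CSrc C (NMor \<kappa> u) = PMor F u \<cdot> NObj \<kappa> (Src I u)"
    "CTrg C (NMor \<kappa> u) = NObj \<kappa> (Trg I u)" if "u \<in> Mor I" for u
    using C.iso2_hom2[OF iso[OF that]] by (auto simp: hom2_iff)
  have "pcone Y (data \<kappa>)"
  proof (rule pconeI)
    show "snd (data \<kappa>) (CTrg I \<alpha>) \<bullet> (PCell F \<alpha> \<star> Id2 C (fst (data \<kappa>) (Src I (CSrc I \<alpha>))))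
        = snd (data \<kappa>) (CSrc I \<alpha>)" if "\<alpha> \<in> Cell I" for \<alpha>
      using \<kappa>.natural[of "CSrc I \<alpha>" "Src I (CSrc I \<alpha>)" "Trg I (CSrc I \<alpha>)" \<alpha> "CTrg I \<alpha>"] that
      by (simp add: d hom1_iff hom2_iff)
    show "snd (data \<kappa>) (u' \<cdot>\<^bsub>I\<^esub> u) \<bullet> (PComp F u' u \<star> Id2 C (fst (data \<kappa>) (Src I u)))
        = snd (data \<kappa>) u' \<bullet> (Id2 C (PMor F u') \<star> snd (data \<kappa>) u)"
      if "u \<in> Mor I" "u' \<in> Mor I" "Src I u' = Trg I u" for u u'
      using \<kappa>.respects_comp[of u "Src I u" "Trg I u" u' "Trg I u'"] that
      by (simp add: d hom1_iff hom2_iff)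
    show "snd (data \<kappa>) (Id1 I i) = Id2 C (fst (data \<kappa>) i)" if "i \<in> Ob I" for i
      using \<kappa>.respects_id[OF that] by simp
  qed (auto simp: hom1_iff iso)
  then show ?r using d \<kappa>.obj_ext \<kappa>.mor_ext by simp
next
  assume r: ?r
  then have k: "pcone Y (data \<kappa>)" and d: "NDom \<kappa> = diag_ob C Y" "NCod \<kappa> = F" by auto
  note [simp] = pcone_leg[OF k, simplified] pcone_cell[OF k, simplified]
  have "pseudo_nat I C \<kappa>"
  proof (rule pseudo_nat.intro)
    show "NMor \<kappa> u \<in> iso2 C (PMor (NCod \<kappa>) u \<cdot> NObj \<kappa> i) (NObj \<kappa> j \<cdot> PMor (NDom \<kappa>) u)"
      if "u \<in> hom1 I i j" for u i j
      using pcone_iso2[OF k, of u] that by (auto simp: d hom1_iff)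
    show "NMor \<kappa> v \<bullet> (PCell (NCod \<kappa>) \<alpha> \<star> Id2 C (NObj \<kappa> i))
        = (Id2 C (NObj \<kappa> j) \<star> PCell (NDom \<kappa>) \<alpha>) \<bullet> NMor \<kappa> u"
      if "u \<in> hom1 I i j" "\<alpha> \<in> hom2 I u v" for u i j \<alpha> v
      using pcone_nat[OF k, of \<alpha>] that by (auto simp: d hom1_iff hom2_iff)
    show "NMor \<kappa> (u' \<cdot>\<^bsub>I\<^esub> u) \<bullet> (PComp (NCod \<kappa>) u' u \<star> Id2 C (NObj \<kappa> i))
        = (Id2 C (NObj \<kappa> h) \<star> PComp (NDom \<kappa>) u' u) \<bullet>
          (NMor \<kappa> u' \<star> Id2 C (PMor (NDom \<kappa>) u)) \<bullet> (Id2 C (PMor (NCod \<kappa>) u') \<star> NMor \<kappa> u)"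
      if "u \<in> hom1 I i j" "u' \<in> hom1 I j h" for u i j u' h
      using pcone_comp[OF k, of u u'] that by (auto simp: d hom1_iff hom2_iff)
    show "NMor \<kappa> (Id1 I i) = Id2 C (NObj \<kappa> i)" if "i \<in> Ob I" for i
      using pcone_id[OF k that] by simp
  qed (use r in \<open>auto simp: diag_ob_pseudo_functor[OF Y] F.normal_pseudo_functor_axioms hom1_iff\<close>)
  then show ?l using d by (simp add: hom1_iff)
qed

lemma modif_iff_pmod:
  assumes Y: "Y \<in> Ob C" and \<kappa>: "\<kappa> \<in> hom1 (Ps I C) (diag_ob C Y) F"
    and \<kappa>': "\<kappa>' \<in> hom1 (Ps I C) (diag_ob C Y) F"
  shows "\<Gamma> \<in> hom2 (Ps I C) \<kappa> \<kappa>' \<longleftrightarrow> MDom \<Gamma> = \<kappa> \<and> MCod \<Gamma> = \<kappa>' \<and>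
    MObj \<Gamma> \<in> extensional (Ob I) \<and> pmod (data \<kappa>) (data \<kappa>') (MObj \<Gamma>)" (is "?l \<longleftrightarrow> ?r")
proof -
  have d: "NDom \<kappa> = diag_ob C Y" "NCod \<kappa> = F" "NDom \<kappa>' = diag_ob C Y" "NCod \<kappa>' = F"
    and k: "pcone Y (data \<kappa>)" and k': "pcone Y (data \<kappa>')"
    using \<kappa> \<kappa>' by (simp_all add: psnat_iff_pcone[OF Y])
  note [simp] = pcone_leg[OF k, simplified] pcone_cell[OF k, simplified]
    pcone_leg[OF k', simplified] pcone_cell[OF k', simplified]
  show ?thesis
  proof
    assume ?l
    then have md: "MDom \<Gamma> = \<kappa>" "MCod \<Gamma> = \<kappa>'" and "modification I C \<Gamma>" by (auto simp: hom2_iff)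
    then interpret \<Gamma>: modification I C \<Gamma> by simp
    have "MObj \<Gamma> i \<in> hom2 C (NObj \<kappa> i) (NObj \<kappa>' i)" if "i \<in> Ob I" for i
      using \<Gamma>.comp_cell[OF that] by (simp add: md)
    moreover have "MObj \<Gamma> (Trg I u) \<bullet> NMor \<kappa> u = NMor \<kappa>' u \<bullet> (Id2 C (PMor F u) \<star> MObj \<Gamma> (Src I u))"
      if "u \<in> Mor I" for u
      using \<Gamma>.compatible[of u "Src I u" "Trg I u"] calculation that
      by (auto simp: md d hom1_iff hom2_iff)
    ultimately have "pmod (data \<kappa>) (data \<kappa>') (MObj \<Gamma>)" by (intro pmodI) auto
    then show ?r using md \<Gamma>.comp_ext by simp
  next
    assume r: ?r
    then have m: "pmod (data \<kappa>) (data \<kappa>') (MObj \<Gamma>)" and md: "MDom \<Gamma> = \<kappa>" "MCod \<Gamma> = \<kappa>'" by auto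
    note [simp] = pmod_cell[OF m, simplified]
    have "modification I C \<Gamma>"
      by (rule modification.intro)
        (use r \<kappa> \<kappa>' pmod_compat[OF m] in \<open>auto simp: d hom1_iff hom2_iff\<close>)
    then show ?l using md by (simp add: hom2_iff)
  qed
qed

lemma modif_iso_iff_piso:
  assumes Y: "Y \<in> Ob C" and \<kappa>: "\<kappa> \<in> hom1 (Ps I C) (diag_ob C Y) F"
    and \<kappa>': "\<kappa>' \<in> hom1 (Ps I C) (diag_ob C Y) F"
  shows "\<Gamma> \<in> iso2 (Ps I C) \<kappa> \<kappa>' \<longleftrightarrow> MDom \<Gamma> = \<kappa> \<and> MCod \<Gamma> = \<kappa>' \<and>
    MObj \<Gamma> \<in> extensional (Ob I) \<and> piso (data \<kappa>) (data \<kappa>') (MObj \<Gamma>)" (is "?l \<longleftrightarrow> ?r")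
proof
  assume ?l
  then obtain \<Delta> where \<Gamma>: "\<Gamma> \<in> hom2 (Ps I C) \<kappa> \<kappa>'" and \<Delta>: "\<Delta> \<in> hom2 (Ps I C) \<kappa>' \<kappa>"
    and eq: "modif_vcomp I C \<Delta> \<Gamma> = id_modif I C \<kappa>" "modif_vcomp I C \<Gamma> \<Delta> = id_modif I C \<kappa>'"
    by (auto simp: iso2_def)
  have "MObj \<Gamma> i \<in> iso2 C (NObj \<kappa> i) (NObj \<kappa>' i)" if "i \<in> Ob I" for i
  proof -
    have "MObj (modif_vcomp I C \<Delta> \<Gamma>) i = Id2 C (NObj \<kappa> i)"
      "MObj (modif_vcomp I C \<Gamma> \<Delta>) i = Id2 C (NObj \<kappa>' i)"
      unfolding eq using that by simp_all
    then show ?thesis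
      using \<Gamma> \<Delta> that unfolding modif_iff_pmod[OF Y \<kappa> \<kappa>'] modif_iff_pmod[OF Y \<kappa>' \<kappa>]
      by (auto simp: C.iso2_iff hom2_iff pmod_cell intro!: exI[of _ "MObj \<Delta> i"])
  qed
  then show ?r using \<Gamma> by (simp add: modif_iff_pmod[OF Y \<kappa> \<kappa>'] piso_def)
next
  assume r: ?r
  have k: "pcone Y (data \<kappa>)" and k': "pcone Y (data \<kappa>')"
    using \<kappa> \<kappa>' by (simp_all add: psnat_iff_pcone[OF Y])
  obtain n where n: "piso (data \<kappa>') (data \<kappa>) n" "\<And>i. i \<in> Ob I \<Longrightarrow> n i \<bullet> MObj \<Gamma> i = Id2 C (NObj \<kappa> i)"
    "\<And>i. i \<in> Ob I \<Longrightarrow> MObj \<Gamma> i \<bullet> n i = Id2 C (NObj \<kappa>' i)"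
    using piso_inverse[OF k k', of "MObj \<Gamma>"] r by auto
  define \<Delta> where "\<Delta> = \<lparr>MDom = \<kappa>', MCod = \<kappa>, MObj = restrict n (Ob I)\<rparr>"
  have "\<Gamma> \<in> hom2 (Ps I C) \<kappa> \<kappa>'" using r by (simp add: modif_iff_pmod[OF Y \<kappa> \<kappa>'] piso_def)
  moreover have "\<Delta> \<in> hom2 (Ps I C) \<kappa>' \<kappa>"
    using n(1) pmod_cong[of "data \<kappa>'" "data \<kappa>'" "data \<kappa>" "data \<kappa>" n "MObj \<Delta>"]
    by (simp add: modif_iff_pmod[OF Y \<kappa>' \<kappa>] piso_def \<Delta>_def same_def)
  moreover have "modif_vcomp I C \<Delta> \<Gamma> = id_modif I C \<kappa>" "modif_vcomp I C \<Gamma> \<Delta> = id_modif I C \<kappa>'"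
    using r n by (auto intro!: modif_eqI[of _ _ "Ob I"] simp: \<Delta>_def)
  ultimately show ?l by (auto simp: iso2_def)
qed

text \<open>\<open>\<kappa> \<cdot> \<Delta>c\<close> is precomposition of the legs and cells with \<open>c\<close>: the structure cells of \<open>\<Delta>c\<close> are
  identities.\<close>

abbreviation cone_pre :: "('io, 'im, 'ic, 'o, 'm, 'c) psnat \<Rightarrow> 'm \<Rightarrow> ('io, 'im, 'ic, 'o, 'm, 'c) psnat" where
  "cone_pre \<kappa> c \<equiv> psnat_comp I C \<kappa> (diag_mor I C c)"

lemma coneD:
  assumes "(X, \<kappa>) \<in> cones I C F"
  shows "X \<in> Ob C" "\<kappa> \<in> hom1 (Ps I C) (diag_ob C X) F" "NDom \<kappa> = diag_ob C X" "NCod \<kappa> = F"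
    "NObj \<kappa> \<in> extensional (Ob I)" "NMor \<kappa> \<in> extensional (Mor I)" "pcone X (data \<kappa>)"
  using assms by (auto simp: cones_def psnat_iff_pcone)

lemma data_cone_pre:
  assumes "(X, \<kappa>) \<in> cones I C F" "c \<in> hom1 C Y X"
  shows "data \<kappa> \<triangleleft> c \<simeq> data (cone_pre \<kappa> c)"
  using assms pcone_leg[OF coneD(7)[OF assms(1)]] pcone_cell[OF coneD(7)[OF assms(1)]]
  by (simp add: same_def hom1_iff)

lemma cone_pre_cone:
  assumes "(X, \<kappa>) \<in> cones I C F" "c \<in> hom1 C Y X"
  shows "(Y, cone_pre \<kappa> c) \<in> cones I C F"
proof -
  have "Y \<in> Ob C" using assms(2) by (auto simp: hom1_iff)
  moreover have "pcone Y (data (cone_pre \<kappa> c))"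
    by (rule pcone_cong[OF data_cone_pre[OF assms] pcone_precompose[OF coneD(7)[OF assms(1)] assms(2)]])
  moreover have "Src C c = Y" using assms(2) by (simp add: hom1_iff)
  ultimately show ?thesis
    using coneD(4)[OF assms(1)] unfolding cones_def by (simp add: psnat_iff_pcone)
qed

lemma cone_pre_comp:
  assumes "(X, \<kappa>) \<in> cones I C F" "c \<in> hom1 C Y X" "b \<in> hom1 C Z Y"
  shows "cone_pre (cone_pre \<kappa> c) b = cone_pre \<kappa> (c \<cdot> b)"
  using assms pcone_leg[OF coneD(7)[OF assms(1)]] pcone_cell[OF coneD(7)[OF assms(1)]]
  by (auto intro!: psnat_eqI[of _ _ "Ob I" "Mor I"] simp: hom1_iff)

lemma cone_pre_id:
  assumes "(X, \<kappa>) \<in> cones I C F"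
  shows "cone_pre \<kappa> (Id1 C X) = \<kappa>"
  using coneD(1,3,5,6)[OF assms] pcone_leg[OF coneD(7)[OF assms(1)]] pcone_cell[OF coneD(7)[OF assms(1)]]
  by (auto intro!: psnat_eqI[of _ _ "Ob I" "Mor I"] simp: hom1_iff)

lemma cone_mors_iff:
  "((X, \<kappa>), (c, \<Psi>), (X', \<kappa>')) \<in> cone_mors I C F \<longleftrightarrow>
    (X, \<kappa>) \<in> cones I C F \<and> (X', \<kappa>') \<in> cones I C F \<and> c \<in> hom1 C X X' \<and>
    MDom \<Psi> = cone_pre \<kappa>' c \<and> MCod \<Psi> = \<kappa> \<and> MObj \<Psi> \<in> extensional (Ob I) \<and>
    piso (data \<kappa>' \<triangleleft> c) (data \<kappa>) (MObj \<Psi>)"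
proof -
  have "\<Psi> \<in> iso2 (Ps I C) (cone_pre \<kappa>' c) \<kappa> \<longleftrightarrow> MDom \<Psi> = cone_pre \<kappa>' c \<and> MCod \<Psi> = \<kappa> \<and>
      MObj \<Psi> \<in> extensional (Ob I) \<and> piso (data \<kappa>' \<triangleleft> c) (data \<kappa>) (MObj \<Psi>)"
    if \<kappa>: "(X, \<kappa>) \<in> cones I C F" and \<kappa>': "(X', \<kappa>') \<in> cones I C F" and c: "c \<in> hom1 C X X'"
  proof -
    have "piso (data (cone_pre \<kappa>' c)) (data \<kappa>) (MObj \<Psi>) \<longleftrightarrow> piso (data \<kappa>' \<triangleleft> c) (data \<kappa>) (MObj \<Psi>)"
      using data_cone_pre[OF \<kappa>' c] same_sym[OF data_cone_pre[OF \<kappa>' c]]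
      by (auto intro: piso_cong[rotated 3] simp: same_def[of "data \<kappa>"])
    then show ?thesis
      using modif_iso_iff_piso[OF coneD(1)[OF \<kappa>] coneD(2)[OF cone_pre_cone[OF \<kappa>' c]] coneD(2)[OF \<kappa>]]
      by simp
  qed
  then show ?thesis unfolding cone_mors_def by auto
qed

text \<open>The defining equation of a 2-morphism of cones holds as soon as it holds leg by leg, since
  the sources and targets of the two modifications agree.\<close>

lemma cone_cells_iff:
  "(((X, \<kappa>), (c, \<Psi>), (X', \<kappa>')), \<beta>, ((Y, \<mu>), (d, \<Phi>), (Y', \<mu>'))) \<in> cone_cells I C F \<longleftrightarrow>
    ((X, \<kappa>), (c, \<Psi>), (X', \<kappa>')) \<in> cone_mors I C F \<and> ((Y, \<mu>), (d, \<Phi>), (Y', \<mu>')) \<in> cone_mors I C F \<and>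
    (Y, \<mu>) = (X, \<kappa>) \<and> (Y', \<mu>') = (X', \<kappa>') \<and> \<beta> \<in> hom2 C c d \<and>
    (\<forall>i \<in> Ob I. MObj \<Phi> i \<bullet> (Id2 C (NObj \<kappa>' i) \<star> \<beta>) = MObj \<Psi> i)"
proof -
  have "modif_vcomp I C \<Phi> (modif_hcomp I C (id_modif I C \<kappa>') (diag_cell I C \<beta>)) = \<Psi> \<longleftrightarrow>
      (\<forall>i \<in> Ob I. MObj \<Phi> i \<bullet> (Id2 C (NObj \<kappa>' i) \<star> \<beta>) = MObj \<Psi> i)" (is "?m = \<Psi> \<longleftrightarrow> _")
    if mors: "((X, \<kappa>), (c, \<Psi>), (X', \<kappa>')) \<in> cone_mors I C F"
      "((X, \<kappa>), (d, \<Phi>), (X', \<kappa>')) \<in> cone_mors I C F" "\<beta> \<in> hom2 C c d"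
  proof -
    have "?m = \<Psi>" if "\<And>i. i \<in> Ob I \<Longrightarrow> MObj ?m i = MObj \<Psi> i"
      by (rule modif_eqI[of _ _ "Ob I", OF _ _ _ _ that])
        (use mors in \<open>auto simp: cone_mors_iff hom2_iff\<close>)
    then show ?thesis by auto
  qed
  then show ?thesis unfolding cone_cells_def by auto
qed

end

lemma cone_slice_sel [simp]:
  "Ob (cone_slice I C F) = cones I C F" "Mor (cone_slice I C F) = cone_mors I C F"
  "Cell (cone_slice I C F) = cone_cells I C F"
  "Src (cone_slice I C F) (p, m, q) = p" "Trg (cone_slice I C F) (p, m, q) = q"
  "CSrc (cone_slice I C F) (r, \<beta>, s) = r" "CTrg (cone_slice I C F) (r, \<beta>, s) = s"
  "Id1 (cone_slice I C F) = cone_id I C" "Comp1 (cone_slice I C F) = cone_comp I C"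
  "Id2 (cone_slice I C F) (p, (c, \<Psi>), q) = ((p, (c, \<Psi>), q), Id2 C c, (p, (c, \<Psi>), q))"
  "VComp (cone_slice I C F) (r', \<beta>', s') (r, \<beta>, s) = (r, \<beta>' \<bullet>\<^bsub>C\<^esub> \<beta>, s')"
  "HComp (cone_slice I C F) (r', \<beta>', s') (r, \<beta>, s)
    = (cone_comp I C r' r, \<beta>' \<star>\<^bsub>C\<^esub> \<beta>, cone_comp I C s' s)"
  by (simp_all add: cone_slice_def)

lemma cone_comp_simp [simp]:
  "cone_comp I C (p', (c', \<Psi>'), q') (p, (c, \<Psi>), q) = (p, (c' \<cdot>\<^bsub>C\<^esub> c,
    modif_vcomp I C \<Psi> (modif_hcomp I C \<Psi>' (id_modif I C (diag_mor I C c)))), q')"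
  by (simp add: cone_comp_def)

lemma cone_id_simp [simp]:
  "cone_id I C (X, \<kappa>) = ((X, \<kappa>), (Id1 C X, id_modif I C \<kappa>), (X, \<kappa>))"
  by (simp add: cone_id_def)

context diagram
begin

lemma cone_morD:
  assumes "((X, \<kappa>), (c, \<Psi>), (X', \<kappa>')) \<in> cone_mors I C F"
  shows "(X, \<kappa>) \<in> cones I C F" "(X', \<kappa>') \<in> cones I C F" "c \<in> Mor C" "Src C c = X" "Trg C c = X'"
    "\<And>i. i \<in> Ob I \<Longrightarrow> MObj \<Psi> i \<in> Cell C" "\<And>i. i \<in> Ob I \<Longrightarrow> CSrc C (MObj \<Psi> i) = NObj \<kappa>' i \<cdot> c"
    "\<And>i. i \<in> Ob I \<Longrightarrow> CTrg C (MObj \<Psi> i) = NObj \<kappa> i"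
    "\<And>i. i \<in> Ob I \<Longrightarrow> NObj \<kappa> i \<in> Mor C" "\<And>i. i \<in> Ob I \<Longrightarrow> Src C (NObj \<kappa> i) = X"
    "\<And>i. i \<in> Ob I \<Longrightarrow> Trg C (NObj \<kappa> i) = PObj F i"
    "\<And>i. i \<in> Ob I \<Longrightarrow> NObj \<kappa>' i \<in> Mor C" "\<And>i. i \<in> Ob I \<Longrightarrow> Src C (NObj \<kappa>' i) = X'"
    "\<And>i. i \<in> Ob I \<Longrightarrow> Trg C (NObj \<kappa>' i) = PObj F i"
    "MDom \<Psi> = cone_pre \<kappa>' c" "MCod \<Psi> = \<kappa>" "MObj \<Psi> \<in> extensional (Ob I)"
  using assms pmod_cell[of "data \<kappa>' \<triangleleft> c" "data \<kappa>" "MObj \<Psi>"] pcone_leg[of X "data \<kappa>"] pcone_leg[of X' "data \<kappa>'"]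
  by (auto simp: cone_mors_iff piso_def hom1_iff dest: coneD(7))

lemma cone_id_mor:
  assumes "(X, \<kappa>) \<in> cones I C F"
  shows "cone_id I C (X, \<kappa>) \<in> cone_mors I C F"
proof -
  have k: "pcone X (data \<kappa>)" by (rule coneD(7)[OF assms])
  have "piso (data \<kappa> \<triangleleft> Id1 C X) (data \<kappa>) (MObj (id_modif I C \<kappa>))"
    by (rule piso_cong[OF same_sym[OF precompose_id[OF k]] _ _ piso_id[OF k]]) (auto simp: same_def)
  then show ?thesis
    using assms coneD(1)[OF assms] by (simp add: cone_mors_iff hom1_iff cone_pre_id)
qed

lemma cone_comp_mor:
  assumes m: "((X, \<kappa>), (c, \<Psi>), (X', \<kappa>')) \<in> cone_mors I C F"
    and m': "((X', \<kappa>'), (c', \<Psi>'), (X'', \<kappa>'')) \<in> cone_mors I C F"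
  shows "cone_comp I C ((X', \<kappa>'), (c', \<Psi>'), (X'', \<kappa>'')) ((X, \<kappa>), (c, \<Psi>), (X', \<kappa>')) \<in> cone_mors I C F"
proof -
  have k: "pcone X (data \<kappa>)" "pcone X' (data \<kappa>')" "pcone X'' (data \<kappa>'')"
    and c: "c \<in> hom1 C X X'" and c': "c' \<in> hom1 C X' X''"
    and p: "piso (data \<kappa>' \<triangleleft> c) (data \<kappa>) (MObj \<Psi>)" and p': "piso (data \<kappa>'' \<triangleleft> c') (data \<kappa>') (MObj \<Psi>')"
    using m m' by (auto simp: cone_mors_iff dest: coneD(7))
  note k'' = pcone_precompose[OF k(3) c']
  have "piso (data \<kappa>'' \<triangleleft> c' \<triangleleft> c) (data \<kappa>) (\<lambda>i. MObj \<Psi> i \<bullet> (MObj \<Psi>' i \<star> Id2 C c))"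
    by (rule piso_vcomp[OF pcone_precompose[OF k'' c] pcone_precompose[OF k(2) c] k(1)
          piso_precompose[OF k'' k(2) p' c] p])
  then have "piso (data \<kappa>'' \<triangleleft> (c' \<cdot> c)) (data \<kappa>)
      (MObj (modif_vcomp I C \<Psi> (modif_hcomp I C \<Psi>' (id_modif I C (diag_mor I C c)))))"
    by (rule piso_cong[OF precompose_precompose[OF k(3) c' c], rotated 2]) (auto simp: same_def)
  moreover have "c' \<cdot> c \<in> hom1 C X X''" using c c' by (simp add: hom1_iff)
  ultimately show ?thesis
    using m m' cone_pre_comp[OF _ c' c, of \<kappa>''] by (simp add: cone_mors_iff)
qed

lemma cone_mor_eqI:
  assumes m: "((X, \<kappa>), (c, \<Psi>), (X', \<kappa>')) \<in> cone_mors I C F"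
    and m': "((X, \<kappa>), (c, \<Psi>'), (X', \<kappa>')) \<in> cone_mors I C F"
    and "\<And>i. i \<in> Ob I \<Longrightarrow> MObj \<Psi> i = MObj \<Psi>' i"
  shows "\<Psi> = \<Psi>'"
  using assms(3) cone_morD(15-17)[OF m] cone_morD(15-17)[OF m'] by (intro modif_eqI[of _ _ "Ob I"]) auto

lemma cone_hom1E:
  assumes "m \<in> hom1 (cone_slice I C F) p q"
  obtains X \<kappa> c \<Psi> X' \<kappa>' where "p = (X, \<kappa>)" "q = (X', \<kappa>')" "m = ((X, \<kappa>), (c, \<Psi>), (X', \<kappa>'))"
    "((X, \<kappa>), (c, \<Psi>), (X', \<kappa>')) \<in> cone_mors I C F"
  using assms by (cases m; cases p; cases q) (auto simp: hom1_def)

lemma cone_hom2E: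
  assumes "x \<in> hom2 (cone_slice I C F) m n"
  obtains X \<kappa> c \<Psi> X' \<kappa>' d \<Phi> \<beta> where "m = ((X, \<kappa>), (c, \<Psi>), (X', \<kappa>'))" "n = ((X, \<kappa>), (d, \<Phi>), (X', \<kappa>'))"
    "x = (((X, \<kappa>), (c, \<Psi>), (X', \<kappa>')), \<beta>, ((X, \<kappa>), (d, \<Phi>), (X', \<kappa>')))"
    "((X, \<kappa>), (c, \<Psi>), (X', \<kappa>')) \<in> cone_mors I C F" "((X, \<kappa>), (d, \<Phi>), (X', \<kappa>')) \<in> cone_mors I C F"
    "\<beta> \<in> hom2 C c d" "\<And>i. i \<in> Ob I \<Longrightarrow> MObj \<Phi> i \<bullet> (Id2 C (NObj \<kappa>' i) \<star> \<beta>) = MObj \<Psi> i"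
proof -
  obtain X \<kappa> c \<Psi> X' \<kappa>' Y \<mu> d \<Phi> Y' \<mu>' \<beta>
    where x: "x = (((X, \<kappa>), (c, \<Psi>), (X', \<kappa>')), \<beta>, ((Y, \<mu>), (d, \<Phi>), (Y', \<mu>')))"
    by (metis prod.exhaust)
  have "x \<in> cone_cells I C F" "m = ((X, \<kappa>), (c, \<Psi>), (X', \<kappa>'))" "n = ((Y, \<mu>), (d, \<Phi>), (Y', \<mu>'))"
    using assms unfolding hom2_iff x by auto
  then show ?thesis using that unfolding x cone_cells_iff by blast
qed

lemma cone_cellI:
  assumes "((X, \<kappa>), (c, \<Psi>), (X', \<kappa>')) \<in> cone_mors I C F" "((X, \<kappa>), (d, \<Phi>), (X', \<kappa>')) \<in> cone_mors I C F"
    "\<beta> \<in> hom2 C c d" "\<And>i. i \<in> Ob I \<Longrightarrow> MObj \<Phi> i \<bullet> (Id2 C (NObj \<kappa>' i) \<star> \<beta>) = MObj \<Psi> i"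
  shows "(((X, \<kappa>), (c, \<Psi>), (X', \<kappa>')), \<beta>, ((X, \<kappa>), (d, \<Phi>), (X', \<kappa>')))
    \<in> hom2 (cone_slice I C F) ((X, \<kappa>), (c, \<Psi>), (X', \<kappa>')) ((X, \<kappa>), (d, \<Phi>), (X', \<kappa>'))"
  using assms by (simp add: hom2_def cone_cells_iff)

lemma cone_cell_vcomp:
  assumes "x \<in> hom2 (cone_slice I C F) m n" "y \<in> hom2 (cone_slice I C F) n r"
  shows "VComp (cone_slice I C F) y x \<in> hom2 (cone_slice I C F) m r"
  using assms(1)
proof (rule cone_hom2E)
  fix X \<kappa> c \<Psi> X' \<kappa>' d \<Phi> \<beta>
  assume m: "m = ((X, \<kappa>), (c, \<Psi>), (X', \<kappa>'))" and n: "n = ((X, \<kappa>), (d, \<Phi>), (X', \<kappa>'))"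
    and x: "x = (((X, \<kappa>), (c, \<Psi>), (X', \<kappa>')), \<beta>, ((X, \<kappa>), (d, \<Phi>), (X', \<kappa>')))"
    and mm: "((X, \<kappa>), (c, \<Psi>), (X', \<kappa>')) \<in> cone_mors I C F"
    and nm: "((X, \<kappa>), (d, \<Phi>), (X', \<kappa>')) \<in> cone_mors I C F"
    and \<beta>: "\<beta> \<in> hom2 C c d" and eq: "\<And>i. i \<in> Ob I \<Longrightarrow> MObj \<Phi> i \<bullet> (Id2 C (NObj \<kappa>' i) \<star> \<beta>) = MObj \<Psi> i"
  obtain e \<Theta> \<gamma> where r: "r = ((X, \<kappa>), (e, \<Theta>), (X', \<kappa>'))"
    and y: "y = (((X, \<kappa>), (d, \<Phi>), (X', \<kappa>')), \<gamma>, ((X, \<kappa>), (e, \<Theta>), (X', \<kappa>')))"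
    and rm: "((X, \<kappa>), (e, \<Theta>), (X', \<kappa>')) \<in> cone_mors I C F"
    and \<gamma>: "\<gamma> \<in> hom2 C d e" and eq': "\<And>i. i \<in> Ob I \<Longrightarrow> MObj \<Theta> i \<bullet> (Id2 C (NObj \<kappa>' i) \<star> \<gamma>) = MObj \<Phi> i"
    using assms(2) unfolding n by (auto elim!: cone_hom2E)
  have "MObj \<Theta> i \<bullet> (Id2 C (NObj \<kappa>' i) \<star> (\<gamma> \<bullet> \<beta>)) = MObj \<Psi> i" if "i \<in> Ob I" for i
  proof -
    have "MObj \<Theta> i \<bullet> (Id2 C (NObj \<kappa>' i) \<star> (\<gamma> \<bullet> \<beta>))
        = (MObj \<Theta> i \<bullet> (Id2 C (NObj \<kappa>' i) \<star> \<gamma>)) \<bullet> (Id2 C (NObj \<kappa>' i) \<star> \<beta>)"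
      using \<beta> \<gamma> that by (simp add: hom2_iff cone_morD[OF mm] cone_morD[OF nm] cone_morD[OF rm])
    then show ?thesis by (simp only: eq[OF that] eq'[OF that])
  qed
  moreover have "\<gamma> \<bullet> \<beta> \<in> hom2 C c e" using \<beta> \<gamma> by (simp add: hom2_iff)
  ultimately show ?thesis using mm rm unfolding m x r y by (simp add: cone_cellI)
qed

text \<open>With \<open>\<beta>' \<star> \<beta> = (\<beta>' \<star> d) \<bullet> (c' \<star> \<beta>)\<close>, the equation of \<open>\<beta>'\<close> absorbs \<open>\<beta>' \<star> d\<close>, the exchange law moves
  \<open>\<beta>\<close> past \<open>\<Psi>'\<close>, and the equation of \<open>\<beta>\<close> absorbs it.\<close>

lemma cone_cell_hcomp:
  assumes x: "x \<in> hom2 (cone_slice I C F) m n" and x': "x' \<in> hom2 (cone_slice I C F) m' n'"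
    and "Trg (cone_slice I C F) m = Src (cone_slice I C F) m'"
  shows "HComp (cone_slice I C F) x' x \<in> hom2 (cone_slice I C F) (cone_comp I C m' m) (cone_comp I C n' n)"
  using x
proof (rule cone_hom2E)
  fix X \<kappa> c \<Psi> X' \<kappa>' d \<Phi> \<beta>
  assume m: "m = ((X, \<kappa>), (c, \<Psi>), (X', \<kappa>'))" and n: "n = ((X, \<kappa>), (d, \<Phi>), (X', \<kappa>'))"
    and x: "x = (((X, \<kappa>), (c, \<Psi>), (X', \<kappa>')), \<beta>, ((X, \<kappa>), (d, \<Phi>), (X', \<kappa>')))"
    and mm: "((X, \<kappa>), (c, \<Psi>), (X', \<kappa>')) \<in> cone_mors I C F"
    and nm: "((X, \<kappa>), (d, \<Phi>), (X', \<kappa>')) \<in> cone_mors I C F"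
    and \<beta>: "\<beta> \<in> hom2 C c d" and eq: "\<And>i. i \<in> Ob I \<Longrightarrow> MObj \<Phi> i \<bullet> (Id2 C (NObj \<kappa>' i) \<star> \<beta>) = MObj \<Psi> i"
  obtain c' \<Psi>' X'' \<kappa>'' d' \<Phi>' \<beta>'
    where m': "m' = ((X', \<kappa>'), (c', \<Psi>'), (X'', \<kappa>''))" and n': "n' = ((X', \<kappa>'), (d', \<Phi>'), (X'', \<kappa>''))"
    and x': "x' = (((X', \<kappa>'), (c', \<Psi>'), (X'', \<kappa>'')), \<beta>', ((X', \<kappa>'), (d', \<Phi>'), (X'', \<kappa>'')))"
    and mm': "((X', \<kappa>'), (c', \<Psi>'), (X'', \<kappa>'')) \<in> cone_mors I C F"
    and nm': "((X', \<kappa>'), (d', \<Phi>'), (X'', \<kappa>'')) \<in> cone_mors I C F"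
    and \<beta>': "\<beta>' \<in> hom2 C c' d'"
    and eq': "\<And>i. i \<in> Ob I \<Longrightarrow> MObj \<Phi>' i \<bullet> (Id2 C (NObj \<kappa>'' i) \<star> \<beta>') = MObj \<Psi>' i"
    using x' assms(3) unfolding m by (auto elim!: cone_hom2E)
  note t [simp] = cone_morD(3-14)[OF mm] cone_morD(3-14)[OF nm] cone_morD(3-14)[OF mm'] cone_morD(3-14)[OF nm']
  have [simp]: "\<beta> \<in> Cell C" "CSrc C \<beta> = c" "CTrg C \<beta> = d" "\<beta>' \<in> Cell C" "CSrc C \<beta>' = c'" "CTrg C \<beta>' = d'"
    using \<beta> \<beta>' by (auto simp: hom2_iff)
  have "(MObj \<Phi> i \<bullet> (MObj \<Phi>' i \<star> Id2 C d)) \<bullet> (Id2 C (NObj \<kappa>'' i) \<star> (\<beta>' \<star> \<beta>))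
      = MObj \<Psi> i \<bullet> (MObj \<Psi>' i \<star> Id2 C c)" if [simp]: "i \<in> Ob I" for i
  proof -
    have "\<beta>' \<star> \<beta> = (\<beta>' \<star> Id2 C d) \<bullet> (Id2 C c' \<star> \<beta>)"
      using C.interchange'[of \<beta> "Id2 C d" "Id2 C c'" \<beta>'] by simp
    then have "(MObj \<Phi> i \<bullet> (MObj \<Phi>' i \<star> Id2 C d)) \<bullet> (Id2 C (NObj \<kappa>'' i) \<star> (\<beta>' \<star> \<beta>))
        = MObj \<Phi> i \<bullet> ((MObj \<Phi>' i \<bullet> (Id2 C (NObj \<kappa>'' i) \<star> \<beta>')) \<star> Id2 C d) \<bullet> (Id2 C (NObj \<kappa>'' i \<cdot> c') \<star> \<beta>)"
      by simp
    also have "\<dots> = MObj \<Phi> i \<bullet> (MObj \<Psi>' i \<star> Id2 C d) \<bullet> (Id2 C (NObj \<kappa>'' i \<cdot> c') \<star> \<beta>)"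
      by (simp only: eq'[OF that])
    also have "(MObj \<Psi>' i \<star> Id2 C d) \<bullet> (Id2 C (NObj \<kappa>'' i \<cdot> c') \<star> \<beta>)
        = (Id2 C (NObj \<kappa>' i) \<star> \<beta>) \<bullet> (MObj \<Psi>' i \<star> Id2 C c)"
      using C.whisker_exchange[of \<beta> c d "MObj \<Psi>' i" "NObj \<kappa>'' i \<cdot> c'" "NObj \<kappa>' i"] by (simp add: hom2_iff)
    also have "MObj \<Phi> i \<bullet> (Id2 C (NObj \<kappa>' i) \<star> \<beta>) \<bullet> (MObj \<Psi>' i \<star> Id2 C c)
        = (MObj \<Phi> i \<bullet> (Id2 C (NObj \<kappa>' i) \<star> \<beta>)) \<bullet> (MObj \<Psi>' i \<star> Id2 C c)" by simp
    also have "\<dots> = MObj \<Psi> i \<bullet> (MObj \<Psi>' i \<star> Id2 C c)" by (simp only: eq[OF that])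
    finally show ?thesis .
  qed
  moreover have "\<beta>' \<star> \<beta> \<in> hom2 C (c' \<cdot> c) (d' \<cdot> d)" by (simp add: hom2_iff)
  ultimately show ?thesis
    using cone_comp_mor[OF mm mm'] cone_comp_mor[OF nm nm'] unfolding m n x m' n' x'
    by (auto intro!: cone_cellI)
qed

lemma cone_comp1_id:
  assumes "((X, \<kappa>), (c, \<Psi>), (X', \<kappa>')) \<in> cone_mors I C F"
  shows "cone_comp I C (cone_id I C (X', \<kappa>')) ((X, \<kappa>), (c, \<Psi>), (X', \<kappa>')) = ((X, \<kappa>), (c, \<Psi>), (X', \<kappa>'))"
    "cone_comp I C ((X, \<kappa>), (c, \<Psi>), (X', \<kappa>')) (cone_id I C (X, \<kappa>)) = ((X, \<kappa>), (c, \<Psi>), (X', \<kappa>'))"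
  using cone_comp_mor[OF assms cone_id_mor[OF cone_morD(2)[OF assms], simplified]] cone_morD[OF assms]
    cone_comp_mor[OF cone_id_mor[OF cone_morD(1)[OF assms], simplified] assms]
  by (auto intro!: cone_mor_eqI[OF _ assms])

lemma cone_comp1_assoc:
  assumes m: "((X, \<kappa>), (c, \<Psi>), (X', \<kappa>')) \<in> cone_mors I C F"
    and m': "((X', \<kappa>'), (c', \<Psi>'), (X'', \<kappa>'')) \<in> cone_mors I C F"
    and m'': "((X'', \<kappa>''), (c'', \<Psi>''), (Z, \<zeta>)) \<in> cone_mors I C F"
  shows "cone_comp I C (cone_comp I C ((X'', \<kappa>''), (c'', \<Psi>''), (Z, \<zeta>)) ((X', \<kappa>'), (c', \<Psi>'), (X'', \<kappa>'')))
        ((X, \<kappa>), (c, \<Psi>), (X', \<kappa>'))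
      = cone_comp I C ((X'', \<kappa>''), (c'', \<Psi>''), (Z, \<zeta>))
        (cone_comp I C ((X', \<kappa>'), (c', \<Psi>'), (X'', \<kappa>'')) ((X, \<kappa>), (c, \<Psi>), (X', \<kappa>')))"
  using cone_comp_mor[OF m cone_comp_mor[OF m' m'', simplified], simplified]
    cone_comp_mor[OF cone_comp_mor[OF m m', simplified] m'', simplified]
    cone_morD[OF m] cone_morD[OF m'] cone_morD[OF m'']
  by (auto intro!: cone_mor_eqI)

end

context diagram
begin

lemma cone_cell_id:
  assumes "m \<in> cone_mors I C F"
  shows "Id2 (cone_slice I C F) m \<in> hom2 (cone_slice I C F) m m"
proof -
  obtain X \<kappa> c \<Psi> X' \<kappa>' where m: "m = ((X, \<kappa>), (c, \<Psi>), (X', \<kappa>'))" by (metis prod.exhaust)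
  show ?thesis
    using assms cone_morD[of X \<kappa> c \<Psi> X' \<kappa>'] unfolding m
    by (simp only: cone_slice_sel) (rule cone_cellI; auto simp: hom2_iff)
qed

lemma cone_slice_hom_category:
  "category (hom_cat (cone_slice I C F) p q)"
proof (rule category.intro)
  let ?S = "cone_slice I C F"
  let ?K = "hom_cat ?S p q"
  have h: "x \<in> hom ?K m n \<longleftrightarrow> x \<in> hom2 ?S m n \<and> m \<in> hom1 ?S p q" for x m n
    by (auto simp: hom_iff hom_cat_sel hom2_iff)
  have arr: "\<exists>m n. x \<in> hom2 ?S m n \<and> m \<in> hom1 ?S p q \<and> n \<in> hom1 ?S p q"
    if "x \<in> Arr ?K" for x
  proof -
    have x: "x \<in> hom2 ?S (CSrc ?S x) (CTrg ?S x)" "CSrc ?S x \<in> hom1 ?S p q"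
      using that by (auto simp: hom_cat_sel hom2_iff)
    moreover from x have "CTrg ?S x \<in> hom1 ?S p q"
      by (auto elim!: cone_hom2E simp: hom1_def)
    ultimately show ?thesis by blast
  qed
  show "Dom ?K x \<in> Obj ?K" "Cod ?K x \<in> Obj ?K"
    if "x \<in> Arr ?K" for x
    using arr[OF that] by (auto simp: hom_cat_sel hom2_iff)
  show "One ?K m \<in> hom ?K m m" if "m \<in> Obj ?K" for m
    using that cone_cell_id[of m] unfolding h by (simp add: hom_cat_sel hom1_iff)
  show "y \<odot>\<^bsub>?K\<^esub> x \<in> hom ?K m r"
    if "x \<in> hom ?K m n" "y \<in> hom ?K n r" for x y m n r
    using that cone_cell_vcomp[of x m n y r] unfolding h by (simp add: hom_cat_sel)
  show "One ?K n \<odot>\<^bsub>?K\<^esub> x = x" "x \<odot>\<^bsub>?K\<^esub> One ?K m = x"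
    if "x \<in> hom ?K m n" for x m n
    using that unfolding h by (auto elim!: cone_hom2E simp: hom_cat_sel hom2_iff[of _ C])
  show "(z \<odot>\<^bsub>?K\<^esub> y) \<odot>\<^bsub>?K\<^esub> x = z \<odot>\<^bsub>?K\<^esub> y \<odot>\<^bsub>?K\<^esub> x"
    if "x \<in> hom ?K m n" "y \<in> hom ?K n r" "z \<in> hom ?K r s"
    for x y z m n r s
    using that unfolding h by (auto elim!: cone_hom2E simp: hom_cat_sel hom2_iff[of _ C])
qed

text \<open>A modification between cones is determined by its components, so the laws of the slice are laws
  of \<open>C\<close> in each component.\<close>

lemma two_category_cone_slice: "two_category (cone_slice I C F)"
proof (rule two_category.intro)
  let ?S = "cone_slice I C F"
  show "Src ?S m \<in> Ob ?S" "Trg ?S m \<in> Ob ?S" if "m \<in> Mor ?S" for m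
    using that by (cases m; auto simp: cone_mors_iff)+
  show "CSrc ?S x \<in> Mor ?S" "CTrg ?S x \<in> hom1 ?S (Src ?S (CSrc ?S x)) (Trg ?S (CSrc ?S x))"
    if "x \<in> Cell ?S" for x
  proof -
    have "x \<in> hom2 ?S (CSrc ?S x) (CTrg ?S x)" using that by (simp add: hom2_def)
    then show "CSrc ?S x \<in> Mor ?S" "CTrg ?S x \<in> hom1 ?S (Src ?S (CSrc ?S x)) (Trg ?S (CSrc ?S x))"
      by (auto elim!: cone_hom2E simp: hom1_def)
  qed
  show "category (hom_cat ?S p q)" for p q by (rule cone_slice_hom_category)
  show "Id1 ?S p \<in> hom1 ?S p p" if "p \<in> Ob ?S" for p
    using that cone_id_mor by (cases p) (simp add: hom1_def)
  show "n \<cdot>\<^bsub>?S\<^esub> m \<in> hom1 ?S p r" if mn: "m \<in> hom1 ?S p q" "n \<in> hom1 ?S q r" for m n p q r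
  proof -
    obtain X \<kappa> c \<Psi> X' \<kappa>' where m: "m = ((X, \<kappa>), (c, \<Psi>), (X', \<kappa>'))" "p = (X, \<kappa>)" "q = (X', \<kappa>')"
      "((X, \<kappa>), (c, \<Psi>), (X', \<kappa>')) \<in> cone_mors I C F" using mn(1) by (rule cone_hom1E)
    then obtain c' \<Psi>' X'' \<kappa>'' where n: "n = ((X', \<kappa>'), (c', \<Psi>'), (X'', \<kappa>''))" "r = (X'', \<kappa>'')"
      "((X', \<kappa>'), (c', \<Psi>'), (X'', \<kappa>'')) \<in> cone_mors I C F" using mn(2) by (auto elim!: cone_hom1E)
    show ?thesis using cone_comp_mor m n by (simp add: hom1_def)
  qed
  show "y \<star>\<^bsub>?S\<^esub> x \<in> hom2 ?S (n \<cdot>\<^bsub>?S\<^esub> m) (n' \<cdot>\<^bsub>?S\<^esub> m')"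
    if "m \<in> hom1 ?S p q" "n \<in> hom1 ?S q r" "x \<in> hom2 ?S m m'" "y \<in> hom2 ?S n n'" for m m' n n' p q r x y
    using that cone_cell_hcomp[of x m m' y n n'] by (simp add: hom1_def)
  show "Id1 ?S q \<cdot>\<^bsub>?S\<^esub> m = m" "m \<cdot>\<^bsub>?S\<^esub> Id1 ?S p = m" if "m \<in> hom1 ?S p q" for m p q
    using that cone_comp1_id by (auto elim!: cone_hom1E)
  show "(r \<cdot>\<^bsub>?S\<^esub> n) \<cdot>\<^bsub>?S\<^esub> m = r \<cdot>\<^bsub>?S\<^esub> n \<cdot>\<^bsub>?S\<^esub> m"
    if "m \<in> hom1 ?S p p'" "n \<in> hom1 ?S p' q" "r \<in> hom1 ?S q q'" for m n r p p' q q'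
    using that cone_comp1_assoc by (auto elim!: cone_hom1E simp del: cone_comp_simp)
  show "Id2 ?S (Id1 ?S q) \<star>\<^bsub>?S\<^esub> x = x" "x \<star>\<^bsub>?S\<^esub> Id2 ?S (Id1 ?S p) = x"
    if "m \<in> hom1 ?S p q" "x \<in> hom2 ?S m m'" for m m' p q x
    using that(2,1)
    by (auto elim!: cone_hom2E simp: hom1_def[of ?S] hom2_iff[of _ C] cone_morD
        cone_comp1_id[simplified])
  show "(z \<star>\<^bsub>?S\<^esub> y) \<star>\<^bsub>?S\<^esub> x = z \<star>\<^bsub>?S\<^esub> y \<star>\<^bsub>?S\<^esub> x"
    if "m \<in> hom1 ?S p p'" "n \<in> hom1 ?S p' q" "r \<in> hom1 ?S q q'"
      "x \<in> hom2 ?S m m'" "y \<in> hom2 ?S n n'" "z \<in> hom2 ?S r r'" for m n r p p' q q' x y z m' n' r'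
    using that(4-6,1-3)
    by (auto elim!: cone_hom2E simp: hom1_def[of ?S] hom2_iff[of _ C] cone_morD(3-5)
        cone_comp1_assoc[simplified])
  show "Id2 ?S n \<star>\<^bsub>?S\<^esub> Id2 ?S m = Id2 ?S (n \<cdot>\<^bsub>?S\<^esub> m)" if "m \<in> hom1 ?S p q" "n \<in> hom1 ?S q r" for m n p q r
    using that by (auto elim!: cone_hom1E simp: cone_morD(3-5))
  show "(y' \<bullet>\<^bsub>?S\<^esub> y) \<star>\<^bsub>?S\<^esub> (x' \<bullet>\<^bsub>?S\<^esub> x) = (y' \<star>\<^bsub>?S\<^esub> x') \<bullet>\<^bsub>?S\<^esub> (y \<star>\<^bsub>?S\<^esub> x)"
    if "m \<in> hom1 ?S p q" "n \<in> hom1 ?S q r" "x \<in> hom2 ?S m m'" "x' \<in> hom2 ?S m' m''"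
      "y \<in> hom2 ?S n n'" "y' \<in> hom2 ?S n' n''" for m n p q r x x' y y' m' m'' n' n''
    using that(3-6,1,2)
    by (auto elim!: cone_hom2E simp: hom1_def[of ?S] hom2_iff[of _ C] cone_morD(3-5) C.interchange')
qed

text \<open>The two universal properties of a cone \<open>k\<close> on \<open>X\<close> are made of three conditions at an object
  \<open>Y\<close>: every cone on \<open>Y\<close> factors through \<open>k\<close> up to isomorphism; two such factorizations of the same cone are compared by a unique cell; and every modification, invertible or not, between
  cones \<open>k \<triangleleft> c\<close> and \<open>k \<triangleleft> d\<close> comes from a unique cell.\<close>

definition factors_at :: "'o \<Rightarrow> ('io, 'im, 'm, 'c) cone_data \<Rightarrow> 'o \<Rightarrow> bool" where
  "factors_at X k Y \<longleftrightarrow> (\<forall>k'. pcone Y k' \<longrightarrow> (\<exists>c \<in> hom1 C Y X. \<exists>m. piso (k \<triangleleft> c) k' m))"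

definition compares_at :: "'o \<Rightarrow> ('io, 'im, 'm, 'c) cone_data \<Rightarrow> 'o \<Rightarrow> bool" where
  "compares_at X k Y \<longleftrightarrow> (\<forall>c \<in> hom1 C Y X. \<forall>d \<in> hom1 C Y X. \<forall>k' m n.
    pcone Y k' \<and> piso (k \<triangleleft> c) k' m \<and> piso (k \<triangleleft> d) k' n \<longrightarrow>
    (\<exists>!\<beta>. \<beta> \<in> hom2 C c d \<and> (\<forall>i \<in> Ob I. n i \<bullet> (Id2 C (fst k i) \<star> \<beta>) = m i)))"

definition lifts_at :: "'o \<Rightarrow> ('io, 'im, 'm, 'c) cone_data \<Rightarrow> 'o \<Rightarrow> bool" where
  "lifts_at X k Y \<longleftrightarrow> (\<forall>c \<in> hom1 C Y X. \<forall>d \<in> hom1 C Y X. \<forall>m. pmod (k \<triangleleft> c) (k \<triangleleft> d) m \<longrightarrow>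
    (\<exists>!\<beta>. \<beta> \<in> hom2 C c d \<and> (\<forall>i \<in> Ob I. Id2 C (fst k i) \<star> \<beta> = m i)))"

definition cone_of :: "'o \<Rightarrow> ('io, 'im, 'm, 'c) cone_data \<Rightarrow> ('io, 'im, 'ic, 'o, 'm, 'c) psnat" where
  "cone_of Y k = \<lparr>NDom = diag_ob C Y, NCod = F, NObj = restrict (fst k) (Ob I), NMor = restrict (snd k) (Mor I)\<rparr>"

lemma data_cone_of: "data (cone_of Y k) \<simeq> k"
  by (simp add: cone_of_def same_def)

lemma cone_of:
  assumes "Y \<in> Ob C" "pcone Y k"
  shows "(Y, cone_of Y k) \<in> cones I C F"
  using assms pcone_cong[OF same_sym[OF data_cone_of] assms(2)]
  by (auto simp: cones_def psnat_iff_pcone) (auto simp: cone_of_def)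

lemma cone_mor_of:
  assumes "(Y, \<kappa>) \<in> cones I C F" "(X, l) \<in> cones I C F" "c \<in> hom1 C Y X"
    and "k' \<simeq> data \<kappa>" "piso (data l \<triangleleft> c) k' m"
  shows "((Y, \<kappa>), (c, \<lparr>MDom = cone_pre l c, MCod = \<kappa>, MObj = restrict m (Ob I)\<rparr>), (X, l)) \<in> cone_mors I C F"
  using assms piso_cong[OF _ assms(4) _ assms(5), of "data l \<triangleleft> c" "restrict m (Ob I)"]
  by (simp add: cone_mors_iff same_def)

text \<open>Between two fixed morphisms into \<open>(X, l)\<close>, the 2-morphisms of the slice are the cells of \<open>C\<close> that
  satisfy the equation in \<open>compares_at\<close>, so contractibility of the hom-categories is the conjunction
  of the first two properties.\<close>

lemma bi_terminal_cone_iff: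
  assumes l: "(X, l) \<in> cones I C F"
  shows "bi_terminal (cone_slice I C F) (X, l) \<longleftrightarrow>
    (\<forall>Y \<in> Ob C. factors_at X (data l) Y \<and> compares_at X (data l) Y)" (is "?b \<longleftrightarrow> ?r")
proof -
  let ?S = "cone_slice I C F"
  have b: "?b \<longleftrightarrow> (\<forall>p \<in> cones I C F. hom1 ?S p (X, l) \<noteq> {} \<and>
      (\<forall>f \<in> hom1 ?S p (X, l). \<forall>g \<in> hom1 ?S p (X, l). \<exists>!\<beta>. \<beta> \<in> hom2 ?S f g))"
    using two_category.bi_terminal_iff[OF two_category_cone_slice, of "(X, l)"] l by simp
  show ?thesis
  proof
    assume ?b
    note contr = this[unfolded b]
    show ?r
    proof (intro ballI conjI)
      fix Y assume Y: "Y \<in> Ob C"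
      show "factors_at X (data l) Y"
        unfolding factors_at_def
      proof (intro allI impI)
        fix k' assume "pcone Y k'"
        then have "hom1 ?S (Y, cone_of Y k') (X, l) \<noteq> {}" using contr cone_of[OF Y] by blast
        then obtain c \<Psi> where m: "((Y, cone_of Y k'), (c, \<Psi>), (X, l)) \<in> cone_mors I C F"
          by (auto elim!: cone_hom1E)
        then have c: "c \<in> hom1 C Y X" and "piso (data l \<triangleleft> c) (data (cone_of Y k')) (MObj \<Psi>)"
          by (auto simp: cone_mors_iff)
        then have "piso (data l \<triangleleft> c) k' (MObj \<Psi>)"
          by (auto intro: piso_cong[OF same_refl data_cone_of refl])
        then show "\<exists>c \<in> hom1 C Y X. \<exists>m. piso (data l \<triangleleft> c) k' m"
          using c by blast
      qed
      show "compares_at X (data l) Y"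
        unfolding compares_at_def
      proof (intro ballI allI impI, elim conjE)
        fix c d k' m n
        assume c: "c \<in> hom1 C Y X" and d: "d \<in> hom1 C Y X" and k': "pcone Y k'"
          and m: "piso (data l \<triangleleft> c) k' m" and n: "piso (data l \<triangleleft> d) k' n"
        define \<kappa> where "\<kappa> = cone_of Y k'"
        have \<kappa>: "(Y, \<kappa>) \<in> cones I C F" "k' \<simeq> data \<kappa>"
          using cone_of[OF Y k'] same_sym[OF data_cone_of] by (auto simp: \<kappa>_def)
        define f where "f = ((Y, \<kappa>), (c, \<lparr>MDom = cone_pre l c, MCod = \<kappa>, MObj = restrict m (Ob I)\<rparr>), (X, l))"
        define g where "g = ((Y, \<kappa>), (d, \<lparr>MDom = cone_pre l d, MCod = \<kappa>, MObj = restrict n (Ob I)\<rparr>), (X, l))"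
        have "f \<in> cone_mors I C F" "g \<in> cone_mors I C F"
          unfolding f_def g_def by (rule cone_mor_of; fact \<kappa> l c d m n)+
        then have fg: "\<exists>!x. x \<in> hom2 ?S f g"
          using contr \<kappa>(1) by (auto simp: hom1_def f_def g_def)
        have cell: "(f, \<beta>, g) \<in> hom2 ?S f g \<longleftrightarrow>
            \<beta> \<in> hom2 C c d \<and> (\<forall>i \<in> Ob I. n i \<bullet> (Id2 C (fst (data l) i) \<star> \<beta>) = m i)" for \<beta>
          using \<open>f \<in> _\<close> \<open>g \<in> _\<close> unfolding f_def g_def hom2_iff[of _ ?S] by (simp add: cone_cells_iff)
        have "\<exists>\<beta>. x = (f, \<beta>, g)" if "x \<in> hom2 ?S f g" for x
          using that by (auto elim!: cone_hom2E)
        then show "\<exists>!\<beta>. \<beta> \<in> hom2 C c d \<and> (\<forall>i \<in> Ob I. n i \<bullet> (Id2 C (fst (data l) i) \<star> \<beta>) = m i)"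
          using fg unfolding cell[symmetric] by blast
      qed
    qed
  next
    assume r: ?r
    show ?b
      unfolding b
    proof (intro ballI conjI)
      fix p assume "p \<in> cones I C F"
      then obtain Y \<kappa> where p: "p = (Y, \<kappa>)" and \<kappa>: "(Y, \<kappa>) \<in> cones I C F" by (cases p) auto
      have Y: "Y \<in> Ob C" by (rule coneD(1)[OF \<kappa>])
      obtain c m where "c \<in> hom1 C Y X" "piso (data l \<triangleleft> c) (data \<kappa>) m"
        using r Y coneD(7)[OF \<kappa>] unfolding factors_at_def by blast
      then show "hom1 ?S p (X, l) \<noteq> {}"
        using cone_mor_of[OF \<kappa> l, of c "data \<kappa>" m] unfolding p
        by (auto simp: hom1_def same_def)
      fix f g assume "f \<in> hom1 ?S p (X, l)" "g \<in> hom1 ?S p (X, l)"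
      then obtain c \<Psi> d \<Phi> where f: "f = ((Y, \<kappa>), (c, \<Psi>), (X, l))" "f \<in> cone_mors I C F"
        and g: "g = ((Y, \<kappa>), (d, \<Phi>), (X, l))" "g \<in> cone_mors I C F"
        unfolding p by (auto elim!: cone_hom1E)
      have "c \<in> hom1 C Y X" "d \<in> hom1 C Y X" "piso (data l \<triangleleft> c) (data \<kappa>) (MObj \<Psi>)"
        "piso (data l \<triangleleft> d) (data \<kappa>) (MObj \<Phi>)"
        using f g by (auto simp: cone_mors_iff)
      then have ex: "\<exists>!\<beta>. \<beta> \<in> hom2 C c d \<and>
          (\<forall>i \<in> Ob I. MObj \<Phi> i \<bullet> (Id2 C (fst (data l) i) \<star> \<beta>) = MObj \<Psi> i)"
        using r Y coneD(7)[OF \<kappa>] unfolding compares_at_def by blast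
      have cell: "(f, \<beta>, g) \<in> hom2 ?S f g \<longleftrightarrow>
          \<beta> \<in> hom2 C c d \<and> (\<forall>i \<in> Ob I. MObj \<Phi> i \<bullet> (Id2 C (fst (data l) i) \<star> \<beta>) = MObj \<Psi> i)" for \<beta>
        using f g unfolding hom2_iff[of _ ?S] by (simp add: cone_cells_iff)
      have "\<exists>\<beta>. x = (f, \<beta>, g)" if "x \<in> hom2 ?S f g" for x
        using that by (auto elim!: cone_hom2E)
      then show "\<exists>!x. x \<in> hom2 ?S f g" using ex unfolding cell[symmetric] by blast
    qed
  qed
qed

end

section \<open>Tensors by the arrow category\<close>

lemma ftor_eqI:
  fixes G H :: "('o, 'a, 'p, 'b) ftor"
  assumes "FDom G = FDom H" "FCod G = FCod H"
    and "FObj G \<in> extensional S" "FObj H \<in> extensional S" "\<And>x. x \<in> S \<Longrightarrow> FObj G x = FObj H x"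
    and "FArr G \<in> extensional T" "FArr H \<in> extensional T" "\<And>f. f \<in> T \<Longrightarrow> FArr G f = FArr H f"
  shows "G = H"
  using assms extensionalityI[of "FObj G" S "FObj H"] extensionalityI[of "FArr G" T "FArr H"]
  by (cases G; cases H) simp

lemma arrow_cat_sel [simp]:
  "Obj arrow_cat = UNIV" "Arr arrow_cat = {(x, y). x \<le> y}" "Dom arrow_cat = fst" "Cod arrow_cat = snd"
  "One arrow_cat x = (x, x)" "g \<odot>\<^bsub>arrow_cat\<^esub> f = (fst f, snd g)"
  by (simp_all add: arrow_cat_def)

lemma category_arrow_cat: "category arrow_cat"
  by (rule category.intro) (auto simp: hom_iff)

lemma arrow_cases:
  assumes "f \<in> Arr arrow_cat"
  obtains "f = (False, False)" | "f = (False, True)" | "f = (True, True)"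
  using assms by (cases f) auto

lemma postcomp_sel [simp]:
  "FDom (postcomp C X h) = hom_cat C X (Src C h)" "FCod (postcomp C X h) = hom_cat C X (Trg C h)"
  "f \<in> hom1 C X (Src C h) \<Longrightarrow> FObj (postcomp C X h) f = h \<cdot>\<^bsub>C\<^esub> f"
  "\<alpha> \<in> Arr (hom_cat C X (Src C h)) \<Longrightarrow> FArr (postcomp C X h) \<alpha> = Id2 C h \<star>\<^bsub>C\<^esub> \<alpha>"
  by (simp_all add: postcomp_def hom_cat_sel)

lemma postcomp2_sel [simp]:
  "NTDom (postcomp2 C X \<theta>) = postcomp C X (CSrc C \<theta>)" "NTCod (postcomp2 C X \<theta>) = postcomp C X (CTrg C \<theta>)"
  "f \<in> hom1 C X (Src C (CSrc C \<theta>)) \<Longrightarrow> NTMap (postcomp2 C X \<theta>) f = \<theta> \<star>\<^bsub>C\<^esub> Id2 C f"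
  by (simp_all add: postcomp2_def hom_cat_sel)

lemma fun_cat_sel [simp]:
  "Obj (fun_cat K L) = {F. cat_functor F \<and> FDom F = K \<and> FCod F = L}"
  "Arr (fun_cat K L) = {\<tau>. nat_trans \<tau> \<and> FDom (NTDom \<tau>) = K \<and> FCod (NTDom \<tau>) = L}"
  "Dom (fun_cat K L) = NTDom" "Cod (fun_cat K L) = NTCod"
  by (simp_all add: fun_cat_def)

text \<open>The universal property of a tensor by the arrow category, with the functor \<open>\<zeta>\<close> written out
  as a cell \<open>z : z0 \<Rightarrow> z1\<close>.\<close>

locale arrow_tensor = two_category C for C :: "('o, 'm, 'c) two_cat" (structure) +
  fixes X T :: 'o and z0 z1 :: 'm and z :: 'c
  assumes tensor_ob: "T \<in> Ob C"
    and z0: "z0 \<in> hom1 C X T" and z1: "z1 \<in> hom1 C X T" and z: "z \<in> hom2 C z0 z1"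
    and ex_mor: "\<lbrakk>f \<in> hom1 C X Y; \<alpha> \<in> hom2 C f g\<rbrakk>
      \<Longrightarrow> \<exists>h \<in> hom1 C T Y. h \<cdot> z0 = f \<and> h \<cdot> z1 = g \<and> Id2 C h \<star> z = \<alpha>"
    and mor_eqI: "\<lbrakk>h \<in> hom1 C T Y; h' \<in> hom1 C T Y; Id2 C h \<star> z = Id2 C h' \<star> z\<rbrakk> \<Longrightarrow> h = h'"
    and ex_cell: "\<lbrakk>h \<in> hom1 C T Y; h' \<in> hom1 C T Y; a \<in> hom2 C (h \<cdot> z0) (h' \<cdot> z0);
        b \<in> hom2 C (h \<cdot> z1) (h' \<cdot> z1); b \<bullet> (Id2 C h \<star> z) = (Id2 C h' \<star> z) \<bullet> a\<rbrakk>
      \<Longrightarrow> \<exists>\<theta> \<in> hom2 C h h'. \<theta> \<star> Id2 C z0 = a \<and> \<theta> \<star> Id2 C z1 = b"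
    and cell_eqI: "\<lbrakk>h \<in> hom1 C T Y; \<theta> \<in> hom2 C h h'; \<theta>' \<in> hom2 C h h';
        \<theta> \<star> Id2 C z0 = \<theta>' \<star> Id2 C z0; \<theta> \<star> Id2 C z1 = \<theta>' \<star> Id2 C z1\<rbrakk> \<Longrightarrow> \<theta> = \<theta>'"

text \<open>A functor from the arrow category to \<open>C(X, Y)\<close> is a cell of \<open>C\<close>, and a transformation between two
  such functors is a commutative square of cells.  The four properties of \<open>z\<close> therefore express that
  the comparison is bijective on objects and on arrows.\<close>

lemma (in two_category) arrow_tensor_of:
  assumes X: "X \<in> Ob C" and tensor: "is_tensor C arrow_cat X T \<zeta>"
  shows "\<exists>z0 z1 z. arrow_tensor C X T z0 z1 z"
proof -
  let ?K = "tensor_comparison C arrow_cat X T \<zeta>"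
  have T: "T \<in> Ob C" and \<zeta>: "cat_functor \<zeta>" "FDom \<zeta> = arrow_cat" "FCod \<zeta> = hom_cat C X T"
    and iso: "\<And>Y. Y \<in> Ob C \<Longrightarrow> cat_iso (?K Y)"
    using tensor by (auto simp: is_tensor_def)
  interpret \<zeta>: cat_functor \<zeta> by (rule \<zeta>(1))
  define z0 z1 z where "z0 = FObj \<zeta> False" and "z1 = FObj \<zeta> True" and "z = FArr \<zeta> (False, True)"
  have z01: "z0 \<in> hom1 C X T" "z1 \<in> hom1 C X T" "FObj \<zeta> x \<in> hom1 C X T" for x
    using \<zeta>.obj[of False] \<zeta>.obj[of True] \<zeta>.obj[of x] by (auto simp: \<zeta> z0_def z1_def hom_cat_sel)
  have zz: "z \<in> hom2 C z0 z1"
    using \<zeta>.arr[of "(False, True)"] by (auto simp: \<zeta> z0_def z1_def z_def hom_cat_sel hom2_iff)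
  have \<zeta>_arr: "FArr \<zeta> (False, False) = Id2 C z0" "FArr \<zeta> (True, True) = Id2 C z1" "FArr \<zeta> (x, x) = Id2 C (FObj \<zeta> x)" for x
    using \<zeta>.arr_one[of False] \<zeta>.arr_one[of True] \<zeta>.arr_one[of x] by (auto simp: \<zeta> z0_def z1_def hom_cat_sel)
  note [simp] = z01[unfolded hom1_iff] zz[unfolded hom2_iff]
  define P where "P h = ftor_comp (postcomp C X h) \<zeta>" for h
  have P_sel: "FDom (P h) = arrow_cat" "FCod (P h) = hom_cat C X Y"
    "FObj (P h) False = h \<cdot> z0" "FObj (P h) True = h \<cdot> z1"
    "FArr (P h) (False, False) = Id2 C (h \<cdot> z0)" "FArr (P h) (True, True) = Id2 C (h \<cdot> z1)"
    "FArr (P h) (False, True) = Id2 C h \<star> z"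
    "FObj (P h) \<in> extensional UNIV" "FArr (P h) \<in> extensional (Arr arrow_cat)"
    if "h \<in> hom1 C T Y" for h Y
    using that
    by (auto simp: P_def \<zeta> \<zeta>_arr hom1_iff hom_cat_sel z_def[symmetric] z0_def[symmetric] z1_def[symmetric])
      (simp add: ftor_comp_def \<zeta>)
  define Q where "Q \<theta> = nt_hcomp (postcomp2 C X \<theta>) (id_nt \<zeta>)" for \<theta>
  have Q_sel: "NTDom (Q \<theta>) = P (CSrc C \<theta>)" "NTCod (Q \<theta>) = P (CTrg C \<theta>)"
    "NTMap (Q \<theta>) False = \<theta> \<star> Id2 C z0" "NTMap (Q \<theta>) True = \<theta> \<star> Id2 C z1"
    if "\<theta> \<in> Cell C" "Src C (CSrc C \<theta>) = T" for \<theta>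
    using that by (simp_all add: Q_def P_def nt_hcomp_def id_nt_def \<zeta> hom_cat_sel hom1_iff
        z0_def[symmetric] z1_def[symmetric])
  have "arrow_tensor C X T z0 z1 z"
  proof (intro arrow_tensor.intro arrow_tensor_axioms.intro two_category_axioms T z01(1) z01(2) zz)
    fix f Y \<alpha> g assume f: "f \<in> hom1 C X Y" and \<alpha>: "\<alpha> \<in> hom2 C f g"
    have Y: "Y \<in> Ob C" using f by (auto simp: hom1_iff)
    obtain G where G: "cat_functor G" "FDom G = fun_cat arrow_cat (hom_cat C X Y)" "FCod G = hom_cat C T Y"
      and KG: "ftor_comp (?K Y) G = id_ftor (fun_cat arrow_cat (hom_cat C X Y))"
      using iso[OF Y] by (auto simp: cat_iso_def tensor_comparison_def)
    have [simp]: "f \<in> Mor C" "g \<in> Mor C" "Src C f = X" "Src C g = X" "Trg C f = Y" "Trg C g = Y"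
      "\<alpha> \<in> Cell C" "CSrc C \<alpha> = f" "CTrg C \<alpha> = g"
      using f \<alpha> csrc_ctrg[of \<alpha>] by (auto simp: hom1_iff hom2_iff)
    define A where "A = \<lparr>FDom = arrow_cat, FCod = hom_cat C X Y, FObj = (\<lambda>x. if x then g else f),
      FArr = (\<lambda>e\<in>Arr arrow_cat. if e = (False, True) then \<alpha> else Id2 C (if fst e then g else f))\<rparr>"
    have "cat_functor A"
      by (rule cat_functor.intro)
        (auto simp: A_def category_arrow_cat hom_category X Y hom_iff hom_cat_sel hom1_iff split: if_splits)
    then have A: "A \<in> Obj (FDom G)" by (simp add: G) (simp add: A_def)
    define h where "h = FObj G A"
    have h: "h \<in> hom1 C T Y"
      using cat_functor.obj[OF G(1) A] by (simp add: h_def G hom_cat_sel)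
    have "FObj (?K Y) h = A"
      using arg_cong[OF KG, of "\<lambda>H. FObj H A"] A by (simp add: G h_def)
    then have "P h = A" using h by (simp add: tensor_comparison_def P_def hom_cat_sel)
    then have "h \<cdot> z0 = f" "h \<cdot> z1 = g" "Id2 C h \<star> z = \<alpha>"
      using P_sel[OF h] by (simp_all add: A_def)
    then show "\<exists>h \<in> hom1 C T Y. h \<cdot> z0 = f \<and> h \<cdot> z1 = g \<and> Id2 C h \<star> z = \<alpha>" using h by blast
  next
    fix h Y h' assume h: "h \<in> hom1 C T Y" and h': "h' \<in> hom1 C T Y" and eq: "Id2 C h \<star> z = Id2 C h' \<star> z"
    have Y: "Y \<in> Ob C" using h by (auto simp: hom1_iff)
    obtain G where GK: "ftor_comp G (?K Y) = id_ftor (hom_cat C T Y)"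
      using iso[OF Y] by (auto simp: cat_iso_def tensor_comparison_def)
    have G: "FObj G (P k) = k" if "k \<in> hom1 C T Y" for k
      using arg_cong[OF GK, of "\<lambda>H. FObj H k"] that
      by (simp add: ftor_comp_def id_ftor_def tensor_comparison_def hom_cat_sel P_def)
    note [simp] = h[unfolded hom1_iff] h'[unfolded hom1_iff]
    have z': "h \<cdot> z0 = h' \<cdot> z0" "h \<cdot> z1 = h' \<cdot> z1"
      using arg_cong[OF eq, of "CSrc C"] arg_cong[OF eq, of "CTrg C"] by simp_all
    have "P h = P h'"
    proof (rule ftor_eqI[of _ _ UNIV "Arr arrow_cat"])
      show "FObj (P h) x = FObj (P h') x" for x
        by (cases x) (simp_all add: P_sel[OF h] P_sel[OF h'] z')
      show "FArr (P h) e = FArr (P h') e" if "e \<in> Arr arrow_cat" for e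
        using that by (cases rule: arrow_cases) (simp_all add: P_sel[OF h] P_sel[OF h'] z' eq)
    qed (simp_all only: P_sel[OF h] P_sel[OF h'])
    then show "h = h'" using G[OF h] G[OF h'] by metis
  next
    fix h Y h' a b
    assume h: "h \<in> hom1 C T Y" and h': "h' \<in> hom1 C T Y" and a: "a \<in> hom2 C (h \<cdot> z0) (h' \<cdot> z0)"
      and b: "b \<in> hom2 C (h \<cdot> z1) (h' \<cdot> z1)" and eq: "b \<bullet> (Id2 C h \<star> z) = (Id2 C h' \<star> z) \<bullet> a"
    have Y: "Y \<in> Ob C" using h by (auto simp: hom1_iff)
    obtain G where G: "cat_functor G" "FDom G = fun_cat arrow_cat (hom_cat C X Y)" "FCod G = hom_cat C T Y"
      and K: "cat_functor (?K Y)"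
      and KG: "ftor_comp (?K Y) G = id_ftor (fun_cat arrow_cat (hom_cat C X Y))"
      and GK: "ftor_comp G (?K Y) = id_ftor (hom_cat C T Y)"
      using iso[OF Y] by (auto simp: cat_iso_def tensor_comparison_def)
    have GP: "FObj G (P k) = k" if "k \<in> hom1 C T Y" for k
      using arg_cong[OF GK, of "\<lambda>H. FObj H k"] that
      by (simp add: ftor_comp_def id_ftor_def tensor_comparison_def hom_cat_sel P_def)
    have P: "cat_functor (P k)" if "k \<in> hom1 C T Y" for k
      using cat_functor.obj[OF K, of k] that by (simp add: tensor_comparison_def hom_cat_sel P_def)
    have [simp]: "h \<in> Mor C" "Src C h = T" "Trg C h = Y" "h' \<in> Mor C" "Src C h' = T" "Trg C h' = Y"
      "a \<in> Cell C" "CSrc C a = h \<cdot> z0" "CTrg C a = h' \<cdot> z0" "b \<in> Cell C" "CSrc C b = h \<cdot> z1" "CTrg C b = h' \<cdot> z1"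
      using h h' a b by (auto simp: hom1_iff hom2_iff)
    define \<tau> where "\<tau> = \<lparr>NTDom = P h, NTCod = P h', NTMap = (\<lambda>x. if x then b else a)\<rparr>"
    have "nat_trans \<tau>"
    proof (rule nat_trans.intro)
      show "NTMap \<tau> y \<odot>\<^bsub>FCod (NTDom \<tau>)\<^esub> FArr (NTDom \<tau>) e = FArr (NTCod \<tau>) e \<odot>\<^bsub>FCod (NTDom \<tau>)\<^esub> NTMap \<tau> x"
        if "e \<in> hom (FDom (NTDom \<tau>)) x y" for e x y
      proof -
        have e: "e \<in> Arr arrow_cat" "x = fst e" "y = snd e"
          using that by (auto simp: \<tau>_def hom_iff P_sel[OF h])
        show ?thesis
          using e(1) unfolding e(2,3)
          by (cases rule: arrow_cases)
            (simp_all add: \<tau>_def P_sel[OF h] P_sel[OF h'] hom_cat_sel eq)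
      qed
      show "NTMap \<tau> x \<in> hom (FCod (NTDom \<tau>)) (FObj (NTDom \<tau>) x) (FObj (NTCod \<tau>) x)" for x
        by (cases x) (auto simp: \<tau>_def P_sel[OF h] P_sel[OF h'] hom_iff hom_cat_sel hom1_iff)
    qed (auto simp: \<tau>_def P[OF h] P[OF h'] P_sel[OF h] P_sel[OF h'])
    then have \<tau>: "\<tau> \<in> Arr (FDom G)" by (simp add: G) (simp add: \<tau>_def P_sel[OF h])
    define \<theta> where "\<theta> = FArr G \<tau>"
    have \<theta>: "\<theta> \<in> hom2 C h h'"
      using cat_functor.arr[OF G(1) \<tau>] GP[OF h] GP[OF h']
      by (simp add: \<theta>_def G hom_cat_sel hom2_iff) (simp add: \<tau>_def)
    have "FArr (?K Y) \<theta> = \<tau>"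
      using arg_cong[OF KG, of "\<lambda>H. FArr H \<tau>"] \<tau> by (simp add: G \<theta>_def)
    then have "Q \<theta> = \<tau>" using \<theta> h by (simp add: tensor_comparison_def Q_def hom_cat_sel hom2_iff)
    then have Q: "NTMap (Q \<theta>) False = a" "NTMap (Q \<theta>) True = b" by (simp_all add: \<tau>_def)
    have \<theta>_cell: "\<theta> \<in> Cell C" "Src C (CSrc C \<theta>) = T" using \<theta> by (auto simp: hom2_iff)
    have "\<theta> \<star> Id2 C z0 = a" "\<theta> \<star> Id2 C z1 = b"
      using Q_sel(3,4)[OF \<theta>_cell] unfolding Q by simp_all
    then show "\<exists>\<theta> \<in> hom2 C h h'. \<theta> \<star> Id2 C z0 = a \<and> \<theta> \<star> Id2 C z1 = b" using \<theta> by blast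
  next
    fix h Y \<theta> h' \<theta>'
    assume h: "h \<in> hom1 C T Y" and \<theta>: "\<theta> \<in> hom2 C h h'" "\<theta>' \<in> hom2 C h h'"
      and eq: "\<theta> \<star> Id2 C z0 = \<theta>' \<star> Id2 C z0" "\<theta> \<star> Id2 C z1 = \<theta>' \<star> Id2 C z1"
    have Y: "Y \<in> Ob C" using h by (auto simp: hom1_iff)
    obtain G where GK: "ftor_comp G (?K Y) = id_ftor (hom_cat C T Y)"
      using iso[OF Y] by (auto simp: cat_iso_def tensor_comparison_def)
    have G: "FArr G (Q \<phi>) = \<phi>" if "\<phi> \<in> hom2 C h h'" for \<phi>
      using arg_cong[OF GK, of "\<lambda>H. FArr H \<phi>"] that h
      by (simp add: ftor_comp_def id_ftor_def tensor_comparison_def hom_cat_sel Q_def hom2_iff)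
    have "NTMap (Q \<theta>) x = NTMap (Q \<theta>') x" for x
      using Q_sel[of \<theta>] Q_sel[of \<theta>'] \<theta> h eq by (cases x) (simp_all add: hom2_iff hom1_iff)
    then have "Q \<theta> = Q \<theta>'"
      using Q_sel(1,2)[of \<theta>] Q_sel(1,2)[of \<theta>'] \<theta> h
      by (cases "Q \<theta>"; cases "Q \<theta>'") (auto simp: hom2_iff hom1_iff)
    then show "\<theta> = \<theta>'" using G[OF \<theta>(1)] G[OF \<theta>(2)] by metis
  qed
  then show ?thesis by blast
qed

lemma (in two_category) has_arrow_tensor:
  assumes "has_tensors_by C arrow_cat" "X \<in> Ob C"
  obtains T z0 z1 z where "arrow_tensor C X T z0 z1 z"
  using assms arrow_tensor_of unfolding has_tensors_by_def by blast

text \<open>The inverses of \<open>a\<close> and \<open>b\<close> also form a square; the cells of the two squares are mutually inverse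
  because their composites restrict to identities along \<open>z0\<close> and \<open>z1\<close>.\<close>

lemma (in arrow_tensor) ex_iso2:
  assumes h: "h \<in> hom1 C T Y" "h' \<in> hom1 C T Y"
    and a: "a \<in> iso2 C (h \<cdot> z0) (h' \<cdot> z0)" and b: "b \<in> iso2 C (h \<cdot> z1) (h' \<cdot> z1)"
    and eq: "b \<bullet> (Id2 C h \<star> z) = (Id2 C h' \<star> z) \<bullet> a"
  shows "\<exists>\<theta> \<in> iso2 C h h'. \<theta> \<star> Id2 C z0 = a \<and> \<theta> \<star> Id2 C z1 = b"
proof -
  obtain a' where a': "a' \<in> hom2 C (h' \<cdot> z0) (h \<cdot> z0)" "a' \<bullet> a = Id2 C (h \<cdot> z0)" "a \<bullet> a' = Id2 C (h' \<cdot> z0)"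
    using a by (auto simp: iso2_iff)
  obtain b' where b': "b' \<in> hom2 C (h' \<cdot> z1) (h \<cdot> z1)" "b' \<bullet> b = Id2 C (h \<cdot> z1)" "b \<bullet> b' = Id2 C (h' \<cdot> z1)"
    using b by (auto simp: iso2_iff)
  note [simp] = z0[unfolded hom1_iff] z1[unfolded hom1_iff] z[unfolded hom2_iff]
    h[unfolded hom1_iff] a'(1)[unfolded hom2_iff] b'(1)[unfolded hom2_iff]
    iso2_hom2[OF a, unfolded hom2_iff] iso2_hom2[OF b, unfolded hom2_iff]
  have "b' \<bullet> (Id2 C h' \<star> z) = b' \<bullet> (Id2 C h' \<star> z) \<bullet> a \<bullet> a'"
    by (simp add: a')
  also have "\<dots> = b' \<bullet> ((Id2 C h' \<star> z) \<bullet> a) \<bullet> a'" by simp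
  also have "\<dots> = b' \<bullet> (b \<bullet> (Id2 C h \<star> z)) \<bullet> a'" by (simp only: eq)
  also have "\<dots> = (b' \<bullet> b) \<bullet> (Id2 C h \<star> z) \<bullet> a'" by simp
  also have "\<dots> = (Id2 C h \<star> z) \<bullet> a'" by (simp add: b' del: vcomp_assoc)
  finally have eq': "b' \<bullet> (Id2 C h' \<star> z) = (Id2 C h \<star> z) \<bullet> a'" .
  obtain \<theta> where \<theta>: "\<theta> \<in> hom2 C h h'" "\<theta> \<star> Id2 C z0 = a" "\<theta> \<star> Id2 C z1 = b"
    using ex_cell[OF h iso2_hom2[OF a] iso2_hom2[OF b] eq] by blast
  obtain \<theta>' where \<theta>': "\<theta>' \<in> hom2 C h' h" "\<theta>' \<star> Id2 C z0 = a'" "\<theta>' \<star> Id2 C z1 = b'"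
    using ex_cell[OF h(2,1) a'(1) b'(1) eq'] by blast
  note [simp] = \<theta>(1)[unfolded hom2_iff] \<theta>'(1)[unfolded hom2_iff]
  have "\<theta>' \<bullet> \<theta> = Id2 C h"
    by (rule cell_eqI[OF h(1)]) (simp_all add: hom2_iff \<theta> \<theta>' a' b')
  moreover have "\<theta> \<bullet> \<theta>' = Id2 C h'"
    by (rule cell_eqI[OF h(2)]) (simp_all add: hom2_iff \<theta> \<theta>' a' b')
  ultimately have "\<theta> \<in> iso2 C h h'" using \<theta>(1) \<theta>'(1) unfolding iso2_iff by blast
  then show ?thesis using \<theta>(2,3) by blast
qed

section \<open>Lifting modifications by tensors\<close>

context diagram
begin

lemma piso_pmod: "piso k k' m \<Longrightarrow> pmod k k' m"
  by (simp add: piso_def)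

text \<open>The comparison cell between two factorizations \<open>m\<close> and \<open>n\<close> is the lift of \<open>m\<close> followed by the inverse
  of \<open>n\<close>.\<close>

lemma compares_atI:
  assumes k: "pcone X k" and lifts: "lifts_at X k Y"
  shows "compares_at X k Y"
  unfolding compares_at_def
proof (intro ballI allI impI, elim conjE)
  fix c d k' m n
  assume c: "c \<in> hom1 C Y X" and d: "d \<in> hom1 C Y X" and k': "pcone Y k'"
    and m: "piso (k \<triangleleft> c) k' m" and n: "piso (k \<triangleleft> d) k' n"
  note kc = pcone_precompose[OF k c] and kd = pcone_precompose[OF k d]
  obtain n' where n': "piso k' (k \<triangleleft> d) n'" "\<And>i. i \<in> Ob I \<Longrightarrow> n' i \<bullet> n i = Id2 C (fst (k \<triangleleft> d) i)"
    "\<And>i. i \<in> Ob I \<Longrightarrow> n i \<bullet> n' i = Id2 C (fst k' i)"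
    using piso_inverse[OF kd k' n] by metis
  have "pmod (k \<triangleleft> c) (k \<triangleleft> d) (\<lambda>i. n' i \<bullet> m i)"
    by (rule pmod_vcomp[OF kc k' kd piso_pmod[OF m] piso_pmod[OF n'(1)]])
  then have "\<exists>!\<beta>. \<beta> \<in> hom2 C c d \<and> (\<forall>i \<in> Ob I. Id2 C (fst k i) \<star> \<beta> = n' i \<bullet> m i)"
    using lifts c d unfolding lifts_at_def by blast
  moreover have "Id2 C (fst k i) \<star> \<beta> = n' i \<bullet> m i \<longleftrightarrow> n i \<bullet> (Id2 C (fst k i) \<star> \<beta>) = m i"
    if \<beta>: "\<beta> \<in> hom2 C c d" and [simp]: "i \<in> Ob I" for \<beta> i
  proof -
    note [simp] = pmod_cell[OF piso_pmod[OF m]] pmod_cell[OF piso_pmod[OF n]]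
      pmod_cell[OF piso_pmod[OF n'(1)]] c[unfolded hom1_iff] d[unfolded hom1_iff] \<beta>[unfolded hom2_iff]
      pcone_leg[OF k] pcone_leg[OF k']
    have "n i \<bullet> (n' i \<bullet> m i) = (n i \<bullet> n' i) \<bullet> m i" by simp
    then have 1: "n i \<bullet> (n' i \<bullet> m i) = m i" by (simp add: n' del: C.vcomp_assoc)
    have "n' i \<bullet> n i \<bullet> (Id2 C (fst k i) \<star> \<beta>) = (n' i \<bullet> n i) \<bullet> (Id2 C (fst k i) \<star> \<beta>)" by simp
    then have 2: "n' i \<bullet> n i \<bullet> (Id2 C (fst k i) \<star> \<beta>) = Id2 C (fst k i) \<star> \<beta>"
      by (simp add: n' del: C.vcomp_assoc)
    show ?thesis using 1 2 by metis
  qed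
  ultimately show "\<exists>!\<beta>. \<beta> \<in> hom2 C c d \<and> (\<forall>i \<in> Ob I. n i \<bullet> (Id2 C (fst k i) \<star> \<beta>) = m i)"
    by (metis (no_types, lifting))
qed

text \<open>A modification between cones on \<open>Y\<close> is the same as a cone on the tensor of \<open>Y\<close> by the arrow
  category.  Its axioms and the invertibility of its cells are inherited from the two ends, because
  restriction along \<open>z0\<close> and \<open>z1\<close> is jointly faithful.\<close>

lemma pcone_of_pmod:
  assumes "arrow_tensor C Y T z0 z1 z" and k: "pcone Y k" and k': "pcone Y k'" and m: "pmod k k' m"
  obtains h where "pcone T h" "h \<triangleleft> z0 \<simeq> k" "h \<triangleleft> z1 \<simeq> k'" "\<And>i. i \<in> Ob I \<Longrightarrow> Id2 C (fst h i) \<star> z = m i"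
proof -
  interpret T: arrow_tensor C Y T z0 z1 z by fact
  note [simp] = pcone_leg[OF k] pcone_cell[OF k] pcone_leg[OF k'] pcone_cell[OF k'] pmod_cell[OF m]
    T.z0[unfolded hom1_iff] T.z1[unfolded hom1_iff] T.z[unfolded hom2_iff] T.tensor_ob
  have "\<forall>i \<in> Ob I. \<exists>h \<in> hom1 C T (PObj F i). h \<cdot> z0 = fst k i \<and> h \<cdot> z1 = fst k' i \<and> Id2 C h \<star> z = m i"
    by (intro ballI T.ex_mor) (simp_all add: hom1_iff hom2_iff)
  then obtain h where h: "\<And>i. i \<in> Ob I \<Longrightarrow> h i \<in> hom1 C T (PObj F i)"
    "\<And>i. i \<in> Ob I \<Longrightarrow> h i \<cdot> z0 = fst k i" "\<And>i. i \<in> Ob I \<Longrightarrow> h i \<cdot> z1 = fst k' i"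
    "\<And>i. i \<in> Ob I \<Longrightarrow> Id2 C (h i) \<star> z = m i"
    by metis
  have [simp]: "h i \<in> Mor C" "Src C (h i) = T" "Trg C (h i) = PObj F i" if "i \<in> Ob I" for i
    using h(1)[OF that] by (auto simp: hom1_iff)
  have "\<forall>u \<in> Mor I. \<exists>\<theta> \<in> iso2 C (PMor F u \<cdot> h (Src I u)) (h (Trg I u)).
      \<theta> \<star> Id2 C z0 = snd k u \<and> \<theta> \<star> Id2 C z1 = snd k' u"
  proof
    fix u assume [simp]: "u \<in> Mor I"
    have "Id2 C (PMor F u \<cdot> h (Src I u)) \<star> z = Id2 C (PMor F u) \<star> Id2 C (h (Src I u)) \<star> z" by simp
    also have "\<dots> = Id2 C (PMor F u) \<star> m (Src I u)" by (simp only: h I.src_trg \<open>u \<in> Mor I\<close>)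
    finally show "\<exists>\<theta> \<in> iso2 C (PMor F u \<cdot> h (Src I u)) (h (Trg I u)).
        \<theta> \<star> Id2 C z0 = snd k u \<and> \<theta> \<star> Id2 C z1 = snd k' u"
      using pcone_iso2[OF k, of u] pcone_iso2[OF k', of u] pmod_compat[OF m, of u]
      by (intro T.ex_iso2[of _ "PObj F (Trg I u)"]) (simp_all add: hom1_iff h)
  qed
  then obtain \<theta> where \<theta>: "\<And>u. u \<in> Mor I \<Longrightarrow> \<theta> u \<in> iso2 C (PMor F u \<cdot> h (Src I u)) (h (Trg I u))"
    "\<And>u. u \<in> Mor I \<Longrightarrow> \<theta> u \<star> Id2 C z0 = snd k u" "\<And>u. u \<in> Mor I \<Longrightarrow> \<theta> u \<star> Id2 C z1 = snd k' u"
    by metis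
  have [simp]: "\<theta> u \<in> Cell C" "CSrc C (\<theta> u) = PMor F u \<cdot> h (Src I u)" "CTrg C (\<theta> u) = h (Trg I u)"
    if "u \<in> Mor I" for u
    using C.iso2_hom2[OF \<theta>(1)[OF that]] by (auto simp: hom2_iff)
  have "pcone T (h, \<theta>)"
  proof (rule pconeI)
    show "snd (h, \<theta>) (CTrg I \<alpha>) \<bullet> (PCell F \<alpha> \<star> Id2 C (fst (h, \<theta>) (Src I (CSrc I \<alpha>)))) = snd (h, \<theta>) (CSrc I \<alpha>)"
      if "\<alpha> \<in> Cell I" for \<alpha>
      by (rule T.cell_eqI[of "PMor F (CSrc I \<alpha>) \<cdot> h (Src I (CSrc I \<alpha>))" "PObj F (Trg I (CSrc I \<alpha>))"])
        (use that pcone_nat[OF k that] pcone_nat[OF k' that] in \<open>simp_all add: hom1_iff hom2_iff h \<theta>\<close>)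
    show "snd (h, \<theta>) (u' \<cdot>\<^bsub>I\<^esub> u) \<bullet> (PComp F u' u \<star> Id2 C (fst (h, \<theta>) (Src I u)))
        = snd (h, \<theta>) u' \<bullet> (Id2 C (PMor F u') \<star> snd (h, \<theta>) u)"
      if "u \<in> Mor I" "u' \<in> Mor I" "Src I u' = Trg I u" for u u'
      by (rule T.cell_eqI[of "PMor F u' \<cdot> PMor F u \<cdot> h (Src I u)" "PObj F (Trg I u')"])
        (use that pcone_comp[OF k that] pcone_comp[OF k' that] in \<open>simp_all add: hom1_iff hom2_iff h \<theta>\<close>)
    show "snd (h, \<theta>) (Id1 I i) = Id2 C (fst (h, \<theta>) i)" if "i \<in> Ob I" for i
      by (rule T.cell_eqI[of "h i" "PObj F i"])
        (use that pcone_id[OF k that] pcone_id[OF k' that] in \<open>simp_all add: hom1_iff hom2_iff h \<theta> F.map_id1\<close>)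
  qed (simp_all add: hom1_iff \<theta>)
  then show ?thesis by (rule that) (simp_all add: same_def h \<theta>)
qed

lemma compares_atD:
  assumes "compares_at X k Y" "c \<in> hom1 C Y X" "d \<in> hom1 C Y X" "pcone Y k'"
    "piso (k \<triangleleft> c) k' m" "piso (k \<triangleleft> d) k' n"
  shows "\<exists>!\<beta>. \<beta> \<in> hom2 C c d \<and> (\<forall>i \<in> Ob I. n i \<bullet> (Id2 C (fst k i) \<star> \<beta>) = m i)"
  using assms unfolding compares_at_def by blast

text \<open>Both \<open>\<beta>\<close> and the identity compare the factorization of \<open>k \<triangleleft> c\<close> through \<open>c\<close> with itself.\<close>

lemma cell_eq_id:
  assumes k: "pcone X k" and comp: "compares_at X k Y" and c: "c \<in> hom1 C Y X"
    and \<beta>: "\<beta> \<in> hom2 C c c" "\<And>i. i \<in> Ob I \<Longrightarrow> Id2 C (fst k i) \<star> \<beta> = Id2 C (fst k i \<cdot> c)"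
  shows "\<beta> = Id2 C c"
proof -
  note [simp] = pcone_leg[OF k] c[unfolded hom1_iff] \<beta>(1)[unfolded hom2_iff]
  note id = piso_id[OF pcone_precompose[OF k c]]
  let ?P = "\<lambda>\<gamma>. \<gamma> \<in> hom2 C c c \<and>
    (\<forall>i \<in> Ob I. Id2 C (fst (k \<triangleleft> c) i) \<bullet> (Id2 C (fst k i) \<star> \<gamma>) = Id2 C (fst (k \<triangleleft> c) i))"
  have "\<exists>!\<gamma>. ?P \<gamma>" by (rule compares_atD[OF comp c c pcone_precompose[OF k c] id id])
  moreover have "?P \<beta>" using \<beta> by simp
  moreover have "?P (Id2 C c)" by (simp add: hom2_iff)
  ultimately show ?thesis by blast
qed

text \<open>Two cells \<open>\<beta>1, \<beta>2 : a \<Rightarrow> b\<close> with the same image correspond to \<open>h1, h2 : T \<rightarrow> X\<close> that agree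
  after composition with the cone \<open>k\<close>.  The comparison cell \<open>h1 \<Rightarrow> h2\<close> restricts to identities at
  both ends, and its naturality in \<open>z\<close> says \<open>\<beta>1 = \<beta>2\<close>.\<close>

lemma lifts_unique:
  assumes "arrow_tensor C Y T z0 z1 z" and k: "pcone X k"
    and compY: "compares_at X k Y" and compT: "compares_at X k T"
    and a: "a \<in> hom1 C Y X" and b: "b \<in> hom1 C Y X"
    and \<beta>1: "\<beta>1 \<in> hom2 C a b" and \<beta>2: "\<beta>2 \<in> hom2 C a b"
    and eq: "\<And>i. i \<in> Ob I \<Longrightarrow> Id2 C (fst k i) \<star> \<beta>1 = Id2 C (fst k i) \<star> \<beta>2"
  shows "\<beta>1 = \<beta>2"
proof -
  interpret T: arrow_tensor C Y T z0 z1 z by fact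
  note [simp] = pcone_leg[OF k] pcone_cell[OF k] a[unfolded hom1_iff] b[unfolded hom1_iff]
    T.z0[unfolded hom1_iff] T.z1[unfolded hom1_iff] T.z[unfolded hom2_iff] T.tensor_ob
  obtain h1 where h1: "h1 \<in> hom1 C T X" "h1 \<cdot> z0 = a" "h1 \<cdot> z1 = b" "Id2 C h1 \<star> z = \<beta>1"
    using T.ex_mor[OF a \<beta>1] by blast
  obtain h2 where h2: "h2 \<in> hom1 C T X" "h2 \<cdot> z0 = a" "h2 \<cdot> z1 = b" "Id2 C h2 \<star> z = \<beta>2"
    using T.ex_mor[OF a \<beta>2] by blast
  note [simp] = h1(1)[unfolded hom1_iff] h2(1)[unfolded hom1_iff]
  have legs: "fst k i \<cdot> h1 = fst k i \<cdot> h2" if [simp]: "i \<in> Ob I" for i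
  proof (rule T.mor_eqI[of _ "PObj F i"])
    have "Id2 C (fst k i) \<star> Id2 C h1 \<star> z = Id2 C (fst k i) \<star> Id2 C h2 \<star> z"
      unfolding h1(4) h2(4) by (rule eq[OF that])
    then show "Id2 C (fst k i \<cdot> h1) \<star> z = Id2 C (fst k i \<cdot> h2) \<star> z" by simp
  qed (simp_all add: hom1_iff)
  have cells: "snd k u \<star> Id2 C h1 = snd k u \<star> Id2 C h2" if [simp]: "u \<in> Mor I" for u
    by (rule T.cell_eqI[of "PMor F u \<cdot> fst k (Src I u) \<cdot> h1" "PObj F (Trg I u)" _ "fst k (Trg I u) \<cdot> h1"])
      (simp_all add: hom1_iff hom2_iff h1 h2 legs)
  have same: "k \<triangleleft> h1 \<simeq> k \<triangleleft> h2" by (simp add: same_def legs cells)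
  note id = piso_id[OF pcone_precompose[OF k h2(1)]]
  have id': "piso (k \<triangleleft> h1) (k \<triangleleft> h2) (\<lambda>i. Id2 C (fst (k \<triangleleft> h2) i))"
    by (rule piso_cong[OF same_sym[OF same] same_refl refl id])
  obtain \<theta> where \<theta>: "\<theta> \<in> hom2 C h1 h2"
    "\<And>i. i \<in> Ob I \<Longrightarrow> Id2 C (fst k i \<cdot> h2) \<bullet> (Id2 C (fst k i) \<star> \<theta>) = Id2 C (fst k i \<cdot> h2)"
    using compares_atD[OF compT h1(1) h2(1) pcone_precompose[OF k h2(1)] id' id] by auto
  note [simp] = \<theta>(1)[unfolded hom2_iff]
  have \<theta>_id: "Id2 C (fst k i) \<star> \<theta> = Id2 C (fst k i \<cdot> h2)" if "i \<in> Ob I" for i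
    using \<theta>(2)[OF that] that by simp
  have ends: "Id2 C (fst k i) \<star> (\<theta> \<star> Id2 C w) = Id2 C (fst k i \<cdot> h2 \<cdot> w)"
    if "i \<in> Ob I" "w \<in> Mor C" "Trg C w = T" for i w
    using arg_cong[OF \<theta>_id[OF that(1)], of "\<lambda>x. x \<star> Id2 C w"] that by simp
  have "\<theta> \<star> Id2 C z0 = Id2 C a"
    by (rule cell_eq_id[OF k compY a]) (simp_all add: hom2_iff h1 h2 ends)
  moreover have "\<theta> \<star> Id2 C z1 = Id2 C b"
    by (rule cell_eq_id[OF k compY b]) (simp_all add: hom2_iff h1 h2 ends)
  moreover have "(Id2 C h2 \<star> z) \<bullet> (\<theta> \<star> Id2 C z0) = (\<theta> \<star> Id2 C z1) \<bullet> (Id2 C h1 \<star> z)"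
    by (rule C.whisker_exchange) (simp_all add: hom2_iff)
  ultimately show ?thesis using \<beta>1 \<beta>2 by (simp add: h1 h2 hom2_iff)
qed

text \<open>A modification \<open>m : k \<triangleleft> a \<Rightarrow> k \<triangleleft> b\<close>, viewed as a cone on the tensor \<open>T\<close>, factors through \<open>k\<close> by
  some \<open>c : T \<rightarrow> X\<close>.  The cell \<open>c \<star> z\<close> then has image \<open>m\<close> up to the isomorphisms at its two ends, and
  those come from comparison cells \<open>a \<Rightarrow> c \<cdot> z0\<close> and \<open>c \<cdot> z1 \<Rightarrow> b\<close>.\<close>

lemma lifts_exist:
  assumes "arrow_tensor C Y T z0 z1 z" and k: "pcone X k"
    and compY: "compares_at X k Y" and fac: "factors_at X k T"
    and a: "a \<in> hom1 C Y X" and b: "b \<in> hom1 C Y X" and m: "pmod (k \<triangleleft> a) (k \<triangleleft> b) m"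
  obtains \<beta> where "\<beta> \<in> hom2 C a b" "\<And>i. i \<in> Ob I \<Longrightarrow> Id2 C (fst k i) \<star> \<beta> = m i"
proof -
  interpret T: arrow_tensor C Y T z0 z1 z by fact
  note ka = pcone_precompose[OF k a] and kb = pcone_precompose[OF k b]
  obtain h where h: "pcone T h" "h \<triangleleft> z0 \<simeq> k \<triangleleft> a" "h \<triangleleft> z1 \<simeq> k \<triangleleft> b"
    "\<And>i. i \<in> Ob I \<Longrightarrow> Id2 C (fst h i) \<star> z = m i"
    using pcone_of_pmod[OF assms(1) ka kb m] by blast
  obtain c p where c: "c \<in> hom1 C T X" and p: "piso (k \<triangleleft> c) h p"
    using fac h(1) unfolding factors_at_def by blast
  note kc = pcone_precompose[OF k c]
  note [simp] = pcone_leg[OF k] pcone_leg[OF h(1)] a[unfolded hom1_iff] b[unfolded hom1_iff] c[unfolded hom1_iff]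
    T.z0[unfolded hom1_iff] T.z1[unfolded hom1_iff] T.z[unfolded hom2_iff] T.tensor_ob
    pmod_cell[OF piso_pmod[OF p]] pmod_cell[OF m]
  have cz: "c \<cdot> z0 \<in> hom1 C Y X" "c \<cdot> z1 \<in> hom1 C Y X" by (simp_all add: hom1_iff)
  have p0: "piso (k \<triangleleft> (c \<cdot> z0)) (k \<triangleleft> a) (\<lambda>i. p i \<star> Id2 C z0)"
    by (rule piso_cong[OF precompose_precompose[OF k c T.z0] h(2) refl piso_precompose[OF kc h(1) p T.z0]])
  have p1: "piso (k \<triangleleft> (c \<cdot> z1)) (k \<triangleleft> b) (\<lambda>i. p i \<star> Id2 C z1)"
    by (rule piso_cong[OF precompose_precompose[OF k c T.z1] h(3) refl piso_precompose[OF kc h(1) p T.z1]])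
  obtain \<beta>0 where \<beta>0: "\<beta>0 \<in> hom2 C a (c \<cdot> z0)"
    "\<And>i. i \<in> Ob I \<Longrightarrow> (p i \<star> Id2 C z0) \<bullet> (Id2 C (fst k i) \<star> \<beta>0) = Id2 C (fst k i \<cdot> a)"
    using compares_atD[OF compY a cz(1) ka piso_id[OF ka] p0] by auto
  obtain \<beta>1 where \<beta>1: "\<beta>1 \<in> hom2 C (c \<cdot> z1) b"
    "\<And>i. i \<in> Ob I \<Longrightarrow> Id2 C (fst k i \<cdot> b) \<bullet> (Id2 C (fst k i) \<star> \<beta>1) = p i \<star> Id2 C z1"
    using compares_atD[OF compY cz(2) b kb p1 piso_id[OF kb]] by auto
  note [simp] = \<beta>0(1)[unfolded hom2_iff] \<beta>1(1)[unfolded hom2_iff]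
  have k\<beta>1: "Id2 C (fst k i) \<star> \<beta>1 = p i \<star> Id2 C z1" if "i \<in> Ob I" for i
    using \<beta>1(2)[OF that] that by simp
  define \<beta> where "\<beta> = \<beta>1 \<bullet> (Id2 C c \<star> z) \<bullet> \<beta>0"
  have "Id2 C (fst k i) \<star> \<beta> = m i" if [simp]: "i \<in> Ob I" for i
  proof -
    have hz: "fst h i \<cdot> z0 = fst k i \<cdot> a" "fst h i \<cdot> z1 = fst k i \<cdot> b"
      using h(2,3) that by (auto simp: same_def)
    have "Id2 C (fst k i) \<star> \<beta>
        = (Id2 C (fst k i) \<star> \<beta>1) \<bullet> (Id2 C (fst k i \<cdot> c) \<star> z) \<bullet> (Id2 C (fst k i) \<star> \<beta>0)"
      by (simp add: \<beta>_def)
    also have "\<dots> = ((p i \<star> Id2 C z1) \<bullet> (Id2 C (fst k i \<cdot> c) \<star> z)) \<bullet> (Id2 C (fst k i) \<star> \<beta>0)"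
      by (simp add: k\<beta>1 hz)
    also have "(p i \<star> Id2 C z1) \<bullet> (Id2 C (fst k i \<cdot> c) \<star> z) = (Id2 C (fst h i) \<star> z) \<bullet> (p i \<star> Id2 C z0)"
      by (rule C.whisker_exchange[symmetric]) (simp_all add: hom2_iff)
    also have "((Id2 C (fst h i) \<star> z) \<bullet> (p i \<star> Id2 C z0)) \<bullet> (Id2 C (fst k i) \<star> \<beta>0)
        = (Id2 C (fst h i) \<star> z) \<bullet> (p i \<star> Id2 C z0) \<bullet> (Id2 C (fst k i) \<star> \<beta>0)"
      by (simp add: hz)
    also have "\<dots> = m i" by (simp only: \<beta>0(2)[OF that] h(4)[OF that]) simp
    finally show ?thesis .
  qed
  moreover have "\<beta> \<in> hom2 C a b" by (simp add: \<beta>_def hom2_iff)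
  ultimately show ?thesis using that by blast
qed

lemma lifts_iff_compares:
  assumes tensors: "has_tensors_by C arrow_cat" and k: "pcone X k"
    and fac: "\<And>Y. Y \<in> Ob C \<Longrightarrow> factors_at X k Y"
  shows "(\<forall>Y \<in> Ob C. lifts_at X k Y) \<longleftrightarrow> (\<forall>Y \<in> Ob C. compares_at X k Y)"
proof
  assume "\<forall>Y \<in> Ob C. lifts_at X k Y"
  then show "\<forall>Y \<in> Ob C. compares_at X k Y" using compares_atI[OF k] by blast
next
  assume comp: "\<forall>Y \<in> Ob C. compares_at X k Y"
  show "\<forall>Y \<in> Ob C. lifts_at X k Y"
  proof
    fix Y assume Y: "Y \<in> Ob C"
    obtain T z0 z1 z where t: "arrow_tensor C Y T z0 z1 z" by (rule C.has_arrow_tensor[OF tensors Y])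
    have T: "T \<in> Ob C" using t by (rule arrow_tensor.tensor_ob)
    show "lifts_at X k Y"
      unfolding lifts_at_def
    proof (intro ballI allI impI)
      fix c d m assume c: "c \<in> hom1 C Y X" and d: "d \<in> hom1 C Y X" and m: "pmod (k \<triangleleft> c) (k \<triangleleft> d) m"
      obtain \<beta> where \<beta>: "\<beta> \<in> hom2 C c d" "\<And>i. i \<in> Ob I \<Longrightarrow> Id2 C (fst k i) \<star> \<beta> = m i"
        using lifts_exist[OF t k bspec[OF comp Y] fac[OF T] c d m] by blast
      then show "\<exists>!\<beta>. \<beta> \<in> hom2 C c d \<and> (\<forall>i \<in> Ob I. Id2 C (fst k i) \<star> \<beta> = m i)"
        using lifts_unique[OF t k bspec[OF comp Y] bspec[OF comp T] c d] by (intro ex1I[of _ \<beta>]) auto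
    qed
  qed
qed

end

section \<open>Cones of hom-categories\<close>

lemma Cat_sel [simp]:
  "Ob Cat = {K. category K}" "Mor Cat = {F. cat_functor F}" "Cell Cat = {\<tau>. nat_trans \<tau>}"
  "Src Cat = FDom" "Trg Cat = FCod" "CSrc Cat = NTDom" "CTrg Cat = NTCod"
  "Id1 Cat = id_ftor" "Comp1 Cat = ftor_comp" "Id2 Cat = id_nt" "VComp Cat = nt_vcomp" "HComp Cat = nt_hcomp"
  by (simp_all add: Cat_def)

lemma one_cat_sel [simp]:
  "Obj one_cat = {undefined}" "Arr one_cat = {undefined}" "Dom one_cat f = undefined" "Cod one_cat f = undefined"
  "One one_cat x = undefined" "g \<odot>\<^bsub>one_cat\<^esub> f = undefined"
  by (simp_all add: one_cat_def)

lemma category_one_cat: "category one_cat"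
  by (rule category.intro) (auto simp: hom_iff)

lemma id_nt_sel [simp]:
  "NTDom (id_nt F) = F" "NTCod (id_nt F) = F" "x \<in> Obj (FDom F) \<Longrightarrow> NTMap (id_nt F) x = One (FCod F) (FObj F x)"
  by (simp_all add: id_nt_def)

lemma ntrans_eqI:
  fixes \<sigma> \<tau> :: "('o, 'a, 'p, 'b) ntrans"
  assumes "NTDom \<sigma> = NTDom \<tau>" "NTCod \<sigma> = NTCod \<tau>"
    and "NTMap \<sigma> \<in> extensional S" "NTMap \<tau> \<in> extensional S" "\<And>x. x \<in> S \<Longrightarrow> NTMap \<sigma> x = NTMap \<tau> x"
  shows "\<sigma> = \<tau>"
  using assms extensionalityI[of "NTMap \<sigma>" S "NTMap \<tau>"] by (cases \<sigma>; cases \<tau>) simp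

text \<open>Functors out of the terminal category are objects, and transformations between them are arrows.\<close>

definition point :: "('o, 'a) cat \<Rightarrow> 'o \<Rightarrow> ('p, 'b, 'o, 'a) ftor" where
  "point K x = \<lparr>FDom = one_cat, FCod = K, FObj = (\<lambda>_\<in>{undefined}. x), FArr = (\<lambda>_\<in>{undefined}. One K x)\<rparr>"

definition point_arr :: "('o, 'a) cat \<Rightarrow> 'o \<Rightarrow> 'o \<Rightarrow> 'a \<Rightarrow> ('p, 'b, 'o, 'a) ntrans" where
  "point_arr K x y a = \<lparr>NTDom = point K x, NTCod = point K y, NTMap = (\<lambda>_\<in>{undefined}. a)\<rparr>"

lemma point_sel [simp]:
  "FDom (point K x) = one_cat" "FCod (point K x) = K" "FObj (point K x) undefined = x"
  "FArr (point K x) undefined = One K x"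
  by (simp_all add: point_def)

lemma point_arr_sel [simp]:
  "NTDom (point_arr K x y a) = point K x" "NTCod (point_arr K x y a) = point K y"
  "NTMap (point_arr K x y a) undefined = a"
  by (simp_all add: point_arr_def)

lemma point_eq_iff [simp]: "point K x = point K y \<longleftrightarrow> x = y"
  by (metis point_sel(3))

lemma point_arr_eq_iff [simp]: "point_arr K x y a = point_arr K x' y' a' \<longleftrightarrow> x = x' \<and> y = y' \<and> a = a'"
  by (metis point_arr_sel point_eq_iff)

lemma point_functor:
  assumes "category K"
  shows "cat_functor (point K x) \<longleftrightarrow> x \<in> Obj K"
proof
  assume "cat_functor (point K x)"
  then show "x \<in> Obj K" using cat_functor.obj[of "point K x" undefined] by simp
next
  interpret K: category K by fact
  assume "x \<in> Obj K"
  then show "cat_functor (point K x)"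
    by (intro cat_functor.intro) (auto simp: category_one_cat K.category_axioms hom_iff, auto simp: point_def split: if_splits)
qed

lemma functor_eq_point:
  assumes "cat_functor G" "FDom G = one_cat"
  shows "G = point (FCod G) (FObj G undefined)"
proof -
  interpret G: cat_functor G by fact
  show ?thesis
    using G.obj_map G.arr_ext G.map_one[of undefined] assms(2)
    by (intro ftor_eqI[of _ _ "{undefined}" "{undefined}"]) (auto simp: point_def PiE_def)
qed

lemma point_arr_nat_trans:
  fixes K :: "('o, 'a) cat"
  assumes K: "category K"
  shows "nat_trans (point_arr K x y a :: ('p, 'b, 'o, 'a) ntrans) \<longleftrightarrow> x \<in> Obj K \<and> y \<in> Obj K \<and> a \<in> hom K x y"
proof
  assume t: "nat_trans (point_arr K x y a :: ('p, 'b, 'o, 'a) ntrans)"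
  then have "cat_functor (point K x :: ('p, 'b, 'o, 'a) ftor)" "cat_functor (point K y :: ('p, 'b, 'o, 'a) ftor)"
    using nat_trans.dom_functor[OF t] nat_trans.cod_functor[OF t] by simp_all
  then show "x \<in> Obj K \<and> y \<in> Obj K \<and> a \<in> hom K x y"
    using nat_trans.map_hom[OF t, of undefined] by (simp add: point_functor[OF K])
next
  interpret K: category K by fact
  assume "x \<in> Obj K \<and> y \<in> Obj K \<and> a \<in> hom K x y"
  then show "nat_trans (point_arr K x y a :: ('p, 'b, 'o, 'a) ntrans)"
    by (intro nat_trans.intro) (auto simp: point_functor[OF K] hom_iff, auto simp: point_arr_def)
qed

lemma nat_trans_eq_point_arr:
  assumes "nat_trans \<tau>" "NTDom \<tau> = point K x" "NTCod \<tau> = point K y"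
  shows "\<tau> = point_arr K x y (NTMap \<tau> undefined)"
proof -
  interpret \<tau>: nat_trans \<tau> by fact
  show ?thesis
    using \<tau>.map_ext assms(2,3) by (intro ntrans_eqI[of _ _ "{undefined}"]) (auto simp: point_arr_def)
qed

lemma id_ftor_one_cat: "id_ftor one_cat = point one_cat undefined"
  by (intro ftor_eqI[of _ _ "{undefined}" "{undefined}"]) (auto simp: id_ftor_def point_def)

lemma id_nt_point: "id_nt (point K x) = point_arr K x x (One K x)"
  by (intro ntrans_eqI[of _ _ "{undefined}"]) (auto simp: id_nt_def point_arr_def)

lemma nt_vcomp_point_arr: "nt_vcomp (point_arr K y z b) (point_arr K x w a) = point_arr K x z (b \<odot>\<^bsub>K\<^esub> a)"
  by (intro ntrans_eqI[of _ _ "{undefined}"]) (auto simp: nt_vcomp_def point_arr_def)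

lemma ftor_comp_point:
  assumes "cat_functor G" "FDom G = K" "x \<in> Obj K"
  shows "ftor_comp G (point K x) = point (FCod G) (FObj G x)"
  using assms cat_functor.arr_one[of G x]
  by (intro ftor_eqI[of _ _ "{undefined}" "{undefined}"]) (auto simp: ftor_comp_def point_def)

lemma nt_hcomp_point_arr:
  assumes "cat_functor (NTDom \<tau>)" "cat_functor (NTCod \<tau>)" "FDom (NTDom \<tau>) = K" "FDom (NTCod \<tau>) = K"
    "FCod (NTDom \<tau>) = L" "FCod (NTCod \<tau>) = L" "category K" "a \<in> hom K x y"
  shows "nt_hcomp \<tau> (point_arr K x y a) = point_arr L (FObj (NTDom \<tau>) x) (FObj (NTCod \<tau>) y)
    (NTMap \<tau> y \<odot>\<^bsub>L\<^esub> FArr (NTDom \<tau>) a)"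
proof -
  have "x \<in> Obj K" "y \<in> Obj K"
    using assms(8) category.dom_cod[OF assms(7)] by (auto simp: hom_iff)
  then show ?thesis
    using assms by (intro ntrans_eqI[of _ _ "{undefined}"]) (auto simp: nt_hcomp_def ftor_comp_point point_arr_def)
qed

lemma nt_hcomp_id_one_cat:
  assumes K: "category K" and a: "a \<in> hom K x y"
  shows "nt_hcomp (point_arr K x y a) (id_nt (id_ftor one_cat)) = point_arr K x y a"
proof -
  interpret K: category K by fact
  have xy: "x \<in> Obj K" "y \<in> Obj K" using a by (auto simp: hom_iff)
  then show ?thesis
    using a by (simp add: id_ftor_one_cat id_nt_point nt_hcomp_point_arr[where L = K] point_functor[OF K]
        category_one_cat hom_iff)
qed

lemma ftor_comp_id_one_cat:
  "category K \<Longrightarrow> x \<in> Obj K \<Longrightarrow> ftor_comp (point K x) (id_ftor one_cat) = point K x"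
  by (simp add: id_ftor_one_cat ftor_comp_point point_functor)

lemma diag_one_pseudo_functor: "normal_pseudo_functor A Cat (diag_ob Cat one_cat)"
proof -
  have f: "cat_functor (point one_cat undefined)" by (simp add: point_functor category_one_cat)
  have n: "nat_trans (point_arr one_cat undefined undefined undefined)"
    by (simp add: point_arr_nat_trans category_one_cat hom_iff)
  have c: "ftor_comp (point one_cat undefined) (point one_cat undefined) = point one_cat undefined"
    using ftor_comp_point[OF f, of one_cat undefined] by simp
  have h: "nt_hcomp (point_arr one_cat undefined undefined undefined) (point_arr one_cat undefined undefined undefined)
      = point_arr one_cat undefined undefined undefined"
    using nt_hcomp_point_arr[of "point_arr one_cat undefined undefined undefined" one_cat one_cat undefined undefined undefined]
    by (simp add: f category_one_cat hom_iff)
  show ?thesis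
    by (rule normal_pseudo_functor.intro)
      (auto simp: id_ftor_one_cat id_nt_point hom1_iff hom2_iff f n c h nt_vcomp_point_arr category_one_cat iso2_def
        intro!: bexI[of _ "point_arr one_cat undefined undefined undefined"])
qed

context two_category
begin

lemma postcomp_functor:
  assumes "Y \<in> Ob C" "h \<in> Mor C"
  shows "cat_functor (postcomp C Y h)"
proof -
  note [simp] = assms
  show ?thesis
    by (rule cat_functor.intro)
      (auto simp: hom_category hom_cat_sel hom_iff hom1_iff,
        auto simp: postcomp_def hom_cat_sel hom1_iff)
qed

lemma precomp_sel [simp]:
  "FDom (precomp C f Z) = hom_cat C (Trg C f) Z" "FCod (precomp C f Z) = hom_cat C (Src C f) Z"
  "g \<in> hom1 C (Trg C f) Z \<Longrightarrow> FObj (precomp C f Z) g = g \<cdot> f"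
  "\<beta> \<in> Arr (hom_cat C (Trg C f) Z) \<Longrightarrow> FArr (precomp C f Z) \<beta> = \<beta> \<star> Id2 C f"
  by (simp_all add: precomp_def hom_cat_sel)

lemma precomp_functor:
  assumes "Z \<in> Ob C" "f \<in> Mor C"
  shows "cat_functor (precomp C f Z)"
proof -
  note [simp] = assms
  show ?thesis
    by (rule cat_functor.intro)
      (auto simp: hom_category hom_cat_sel hom_iff hom1_iff,
        auto simp: precomp_def hom_cat_sel hom1_iff)
qed

lemma precomp2_sel [simp]:
  "NTDom (precomp2 C \<alpha> Z) = precomp C (CSrc C \<alpha>) Z" "NTCod (precomp2 C \<alpha> Z) = precomp C (CTrg C \<alpha>) Z"
  "g \<in> hom1 C (Trg C (CSrc C \<alpha>)) Z \<Longrightarrow> NTMap (precomp2 C \<alpha> Z) g = Id2 C g \<star> \<alpha>"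
  by (simp_all add: precomp2_def hom_cat_sel)

lemma postcomp2_nat_trans:
  assumes "Y \<in> Ob C" "\<theta> \<in> Cell C"
  shows "nat_trans (postcomp2 C Y \<theta>)"
proof -
  note [simp] = assms
  show ?thesis
  proof (rule nat_trans.intro)
    fix \<alpha> f g assume "\<alpha> \<in> hom (FDom (NTDom (postcomp2 C Y \<theta>))) f g"
    then show "NTMap (postcomp2 C Y \<theta>) g \<odot>\<^bsub>FCod (NTDom (postcomp2 C Y \<theta>))\<^esub> FArr (NTDom (postcomp2 C Y \<theta>)) \<alpha>
        = FArr (NTCod (postcomp2 C Y \<theta>)) \<alpha> \<odot>\<^bsub>FCod (NTDom (postcomp2 C Y \<theta>))\<^esub> NTMap (postcomp2 C Y \<theta>) f"
      using whisker_exchange[of \<alpha> f g \<theta> "CSrc C \<theta>" "CTrg C \<theta>"] csrc_ctrg[of \<alpha>]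
      by (auto simp: hom_iff hom_cat_sel hom1_iff hom2_iff)
  qed (auto simp: postcomp_functor hom_iff hom_cat_sel hom1_iff, auto simp: postcomp2_def hom_cat_sel)
qed

text \<open>\<open>C(Y, -)\<close> is a 2-functor.\<close>

lemma postcomp_id1:
  assumes "Y \<in> Ob C" "Z \<in> Ob C"
  shows "postcomp C Y (Id1 C Z) = id_ftor (hom_cat C Y Z)"
  using assms
  by (intro ftor_eqI[of _ _ "hom1 C Y Z" "Arr (hom_cat C Y Z)"])
    (auto simp: hom1_iff hom_cat_sel, auto simp: postcomp_def id_ftor_def hom_cat_sel hom1_iff)

lemma postcomp_comp1:
  assumes "Y \<in> Ob C" "h \<in> Mor C" "h' \<in> Mor C" "Src C h' = Trg C h"
  shows "postcomp C Y (h' \<cdot> h) = ftor_comp (postcomp C Y h') (postcomp C Y h)"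
  using assms
  by (intro ftor_eqI[of _ _ "hom1 C Y (Src C h)" "Arr (hom_cat C Y (Src C h))"])
    (auto simp: hom1_iff hom_cat_sel, auto simp: postcomp_def ftor_comp_def hom_cat_sel hom1_iff)

lemma postcomp2_id2:
  assumes "Y \<in> Ob C" "h \<in> Mor C"
  shows "postcomp2 C Y (Id2 C h) = id_nt (postcomp C Y h)"
  using assms
  by (intro ntrans_eqI[of _ _ "hom1 C Y (Src C h)"])
    (auto simp: hom1_iff hom_cat_sel, auto simp: postcomp2_def id_nt_def hom_cat_sel hom1_iff)

lemma postcomp2_vcomp:
  assumes "Y \<in> Ob C" "\<alpha> \<in> Cell C" "\<beta> \<in> Cell C" "CTrg C \<alpha> = CSrc C \<beta>"
  shows "postcomp2 C Y (\<beta> \<bullet> \<alpha>) = nt_vcomp (postcomp2 C Y \<beta>) (postcomp2 C Y \<alpha>)"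
  using assms csrc_ctrg[of \<alpha>]
  by (intro ntrans_eqI[of _ _ "hom1 C Y (Src C (CSrc C \<alpha>))"])
    (auto simp: postcomp2_def nt_vcomp_def hom_cat_sel hom1_iff)

lemma postcomp2_hcomp:
  assumes "Y \<in> Ob C" "\<alpha> \<in> Cell C" "\<beta> \<in> Cell C" "Trg C (CSrc C \<alpha>) = Src C (CSrc C \<beta>)"
  shows "postcomp2 C Y (\<beta> \<star> \<alpha>) = nt_hcomp (postcomp2 C Y \<beta>) (postcomp2 C Y \<alpha>)"
proof (rule ntrans_eqI[of _ _ "hom1 C Y (Src C (CSrc C \<alpha>))"])
  note [simp] = assms
  show "NTDom (postcomp2 C Y (\<beta> \<star> \<alpha>)) = NTDom (nt_hcomp (postcomp2 C Y \<beta>) (postcomp2 C Y \<alpha>))"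
    "NTCod (postcomp2 C Y (\<beta> \<star> \<alpha>)) = NTCod (nt_hcomp (postcomp2 C Y \<beta>) (postcomp2 C Y \<alpha>))"
    by (simp_all add: nt_hcomp_def postcomp_comp1)
  show "NTMap (postcomp2 C Y (\<beta> \<star> \<alpha>)) \<in> extensional (hom1 C Y (Src C (CSrc C \<alpha>)))"
    "NTMap (nt_hcomp (postcomp2 C Y \<beta>) (postcomp2 C Y \<alpha>)) \<in> extensional (hom1 C Y (Src C (CSrc C \<alpha>)))"
    by (simp_all add: postcomp2_def nt_hcomp_def hom_cat_sel)
  fix f assume "f \<in> hom1 C Y (Src C (CSrc C \<alpha>))"
  then have f: "f \<in> Mor C" "Src C f = Y" "Trg C f = Src C (CSrc C \<alpha>)" by (auto simp: hom1_iff)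
  then show "NTMap (postcomp2 C Y (\<beta> \<star> \<alpha>)) f = NTMap (nt_hcomp (postcomp2 C Y \<beta>) (postcomp2 C Y \<alpha>)) f"
    using interchange'[of "\<alpha> \<star> Id2 C f" "Id2 C (CTrg C \<alpha> \<cdot> f)" "Id2 C (CSrc C \<beta>)" \<beta>]
    by (simp add: nt_hcomp_def hom_cat_sel hom1_iff)
qed

lemma postcomp2_iso2:
  assumes "Y \<in> Ob C" "\<alpha> \<in> iso2 C f g"
  shows "postcomp2 C Y \<alpha> \<in> iso2 Cat (postcomp C Y f) (postcomp C Y g)"
proof -
  obtain \<beta> where \<beta>: "\<beta> \<in> hom2 C g f" "\<beta> \<bullet> \<alpha> = Id2 C f" "\<alpha> \<bullet> \<beta> = Id2 C g"
    using assms(2) by (auto simp: iso2_iff)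
  have \<alpha>: "\<alpha> \<in> hom2 C f g" using assms(2) by (rule iso2_hom2)
  have "nt_vcomp (postcomp2 C Y \<beta>) (postcomp2 C Y \<alpha>) = id_nt (postcomp C Y f)"
    "nt_vcomp (postcomp2 C Y \<alpha>) (postcomp2 C Y \<beta>) = id_nt (postcomp C Y g)"
    using \<alpha> \<beta> assms(1) csrc_ctrg[of \<alpha>]
    by (auto simp: hom2_iff postcomp2_vcomp[symmetric] postcomp2_id2[symmetric])
  then show ?thesis
    using \<alpha> \<beta>(1) assms(1) unfolding iso2_def
    by (auto simp: hom2_iff postcomp2_nat_trans intro!: bexI[of _ "postcomp2 C Y \<beta>"])
qed

end

lemma hom_pfun_sel [simp]:
  "PObj (hom_pfun C F Y) i = hom_cat C Y (PObj F i)" "PMor (hom_pfun C F Y) u = postcomp C Y (PMor F u)"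
  "PCell (hom_pfun C F Y) \<alpha> = postcomp2 C Y (PCell F \<alpha>)"
  "PComp (hom_pfun C F Y) u' u = postcomp2 C Y (PComp F u' u)"
  by (simp_all add: hom_pfun_def)

context diagram
begin

lemma hom_pfun_pseudo_functor:
  assumes Y: "Y \<in> Ob C"
  shows "normal_pseudo_functor I Cat (hom_pfun C F Y)"
proof (rule normal_pseudo_functor.intro)
  note [simp] = Y
  show "PObj (hom_pfun C F Y) i \<in> Ob Cat" if "i \<in> Ob I" for i
    using that by (simp add: C.hom_category)
  show "PMor (hom_pfun C F Y) u \<in> hom1 Cat (PObj (hom_pfun C F Y) i) (PObj (hom_pfun C F Y) j)"
    if "u \<in> hom1 I i j" for u i j
    using that by (auto simp: hom1_iff C.postcomp_functor)
  show "PCell (hom_pfun C F Y) \<alpha> \<in> hom2 Cat (PMor (hom_pfun C F Y) u) (PMor (hom_pfun C F Y) v)"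
    if "\<alpha> \<in> hom2 I u v" for \<alpha> u v
    using that by (auto simp: hom2_iff C.postcomp2_nat_trans)
  show "PCell (hom_pfun C F Y) (Id2 I u) = Id2 Cat (PMor (hom_pfun C F Y) u)" if "u \<in> Mor I" for u
    using that by (simp add: F.map_id2 C.postcomp2_id2)
  show "PCell (hom_pfun C F Y) (\<beta> \<bullet>\<^bsub>I\<^esub> \<alpha>) = PCell (hom_pfun C F Y) \<beta> \<bullet>\<^bsub>Cat\<^esub> PCell (hom_pfun C F Y) \<alpha>"
    if "\<alpha> \<in> hom2 I u v" "\<beta> \<in> hom2 I v w" for \<alpha> \<beta> u v w
    using that F.map_vcomp[OF that] by (auto simp: hom2_iff C.postcomp2_vcomp)
  show "PComp (hom_pfun C F Y) u' u \<in> iso2 Cat (PMor (hom_pfun C F Y) u' \<cdot>\<^bsub>Cat\<^esub> PMor (hom_pfun C F Y) u)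
      (PMor (hom_pfun C F Y) (u' \<cdot>\<^bsub>I\<^esub> u))" if "u \<in> hom1 I i j" "u' \<in> hom1 I j h" for u u' i j h
    using that C.postcomp2_iso2[OF Y F.comp_iso[OF that]] by (auto simp: hom1_iff C.postcomp_comp1)
  show "PComp (hom_pfun C F Y) v' v \<bullet>\<^bsub>Cat\<^esub> (PCell (hom_pfun C F Y) \<alpha>' \<star>\<^bsub>Cat\<^esub> PCell (hom_pfun C F Y) \<alpha>)
      = PCell (hom_pfun C F Y) (\<alpha>' \<star>\<^bsub>I\<^esub> \<alpha>) \<bullet>\<^bsub>Cat\<^esub> PComp (hom_pfun C F Y) u' u"
    if "u \<in> hom1 I i j" "u' \<in> hom1 I j h" "\<alpha> \<in> hom2 I u v" "\<alpha>' \<in> hom2 I u' v'" for u u' v v' i j h \<alpha> \<alpha>'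
  proof -
    have [simp]: "\<alpha> \<in> Cell I" "\<alpha>' \<in> Cell I" "CSrc I \<alpha> = u" "CSrc I \<alpha>' = u'" "CTrg I \<alpha> = v" "CTrg I \<alpha>' = v'"
      "u \<in> Mor I" "u' \<in> Mor I" "Src I u' = j" "Trg I u = j" "v \<in> Mor I" "v' \<in> Mor I" "Src I v' = j" "Trg I v = j"
      using that I.csrc_ctrg[of \<alpha>] I.csrc_ctrg[of \<alpha>'] by (auto simp: hom1_iff hom2_iff)
    show ?thesis
      using arg_cong[OF F.comp_natural[OF that], of "postcomp2 C Y"]
      by (simp add: C.postcomp2_vcomp C.postcomp2_hcomp)
  qed
  show "PComp (hom_pfun C F Y) u'' (u' \<cdot>\<^bsub>I\<^esub> u) \<bullet>\<^bsub>Cat\<^esub>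
        (Id2 Cat (PMor (hom_pfun C F Y) u'') \<star>\<^bsub>Cat\<^esub> PComp (hom_pfun C F Y) u' u)
      = PComp (hom_pfun C F Y) (u'' \<cdot>\<^bsub>I\<^esub> u') u \<bullet>\<^bsub>Cat\<^esub>
        (PComp (hom_pfun C F Y) u'' u' \<star>\<^bsub>Cat\<^esub> Id2 Cat (PMor (hom_pfun C F Y) u))"
    if "u \<in> hom1 I h i" "u' \<in> hom1 I i j" "u'' \<in> hom1 I j k" for u u' u'' h i j k
  proof -
    have [simp]: "u \<in> Mor I" "u' \<in> Mor I" "u'' \<in> Mor I" "Src I u' = i" "Trg I u = i" "Src I u'' = j" "Trg I u' = j"
      using that by (auto simp: hom1_iff)
    show ?thesis
      using arg_cong[OF F.comp_assoc[OF that], of "postcomp2 C Y"]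
      by (simp add: C.postcomp2_vcomp C.postcomp2_hcomp C.postcomp2_id2)
  qed
  show "PMor (hom_pfun C F Y) (Id1 I i) = Id1 Cat (PObj (hom_pfun C F Y) i)" if "i \<in> Ob I" for i
    using that by (simp add: F.map_id1 C.postcomp_id1)
  show "PComp (hom_pfun C F Y) u (Id1 I i) = Id2 Cat (PMor (hom_pfun C F Y) u)"
    "PComp (hom_pfun C F Y) (Id1 I j) u = Id2 Cat (PMor (hom_pfun C F Y) u)"
    if "u \<in> hom1 I i j" for u i j
    using that F.comp_id_right[OF that] F.comp_id_left[OF that] by (auto simp: hom1_iff C.postcomp2_id2)
qed

text \<open>The transformation \<open>\<Delta>1 \<Rightarrow> C(Y, F-)\<close> that picks out the legs and cells of \<open>k\<close>.\<close>

definition cat_cone :: "'o \<Rightarrow> ('io, 'im, 'm, 'c) cone_data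
    \<Rightarrow> ('io, 'im, 'ic, ('m, 'c) cat, ('m, 'c, 'm, 'c) ftor, ('m, 'c, 'm, 'c) ntrans) psnat" where
  "cat_cone Y k = \<lparr>NDom = diag_ob Cat one_cat, NCod = hom_pfun C F Y,
    NObj = (\<lambda>i\<in>Ob I. point (hom_cat C Y (PObj F i)) (fst k i)),
    NMor = (\<lambda>u\<in>Mor I. point_arr (hom_cat C Y (PObj F (Trg I u))) (PMor F u \<cdot> fst k (Src I u)) (fst k (Trg I u)) (snd k u))\<rparr>"

definition cat_modif :: "'o \<Rightarrow> ('io, 'im, 'm, 'c) cone_data \<Rightarrow> ('io, 'im, 'm, 'c) cone_data \<Rightarrow> ('io \<Rightarrow> 'c)
    \<Rightarrow> ('io, 'im, 'ic, ('m, 'c) cat, ('m, 'c, 'm, 'c) ftor, ('m, 'c, 'm, 'c) ntrans) modif" where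
  "cat_modif Y k k' m = \<lparr>MDom = cat_cone Y k, MCod = cat_cone Y k',
    MObj = (\<lambda>i\<in>Ob I. point_arr (hom_cat C Y (PObj F i)) (fst k i) (fst k' i) (m i))\<rparr>"

lemma cat_cone_sel [simp]:
  "NDom (cat_cone Y k) = diag_ob Cat one_cat" "NCod (cat_cone Y k) = hom_pfun C F Y"
  "i \<in> Ob I \<Longrightarrow> NObj (cat_cone Y k) i = point (hom_cat C Y (PObj F i)) (fst k i)"
  "u \<in> Mor I \<Longrightarrow> NMor (cat_cone Y k) u
    = point_arr (hom_cat C Y (PObj F (Trg I u))) (PMor F u \<cdot> fst k (Src I u)) (fst k (Trg I u)) (snd k u)"
  "NObj (cat_cone Y k) \<in> extensional (Ob I)" "NMor (cat_cone Y k) \<in> extensional (Mor I)"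
  by (simp_all add: cat_cone_def)

lemma cat_modif_sel [simp]:
  "MDom (cat_modif Y k k' m) = cat_cone Y k" "MCod (cat_modif Y k k' m) = cat_cone Y k'"
  "i \<in> Ob I \<Longrightarrow> MObj (cat_modif Y k k' m) i = point_arr (hom_cat C Y (PObj F i)) (fst k i) (fst k' i) (m i)"
  "MObj (cat_modif Y k k' m) \<in> extensional (Ob I)"
  by (simp_all add: cat_modif_def)

lemma cat_cone_eq_iff: "cat_cone Y k = cat_cone Y k' \<longleftrightarrow> k \<simeq> k'"
proof
  assume eq: "cat_cone Y k = cat_cone Y k'"
  show "k \<simeq> k'"
    unfolding same_def
  proof (intro conjI ballI)
    show "fst k i = fst k' i" if "i \<in> Ob I" for i
      using arg_cong[OF eq, of "\<lambda>x. NObj x i"] that by simp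
    show "snd k u = snd k' u" if "u \<in> Mor I" for u
      using arg_cong[OF eq, of "\<lambda>x. NMor x u"] that by simp
  qed
next
  assume "k \<simeq> k'"
  then show "cat_cone Y k = cat_cone Y k'"
    by (intro psnat_eqI[of _ _ "Ob I" "Mor I"]) (auto simp: same_def)
qed

lemma iso2_Cat_point_arr:
  assumes Y: "Y \<in> Ob C" and Z: "Z \<in> Ob C" and f: "f \<in> hom1 C Y Z" and g: "g \<in> hom1 C Y Z"
  shows "point_arr (hom_cat C Y Z) f g \<alpha> \<in> iso2 Cat (point (hom_cat C Y Z) f) (point (hom_cat C Y Z) g)
    \<longleftrightarrow> \<alpha> \<in> iso2 C f g"
proof -
  let ?K = "hom_cat C Y Z"
  have K: "category ?K" by (rule C.hom_category[OF Y Z])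
  have h: "hom ?K f g = hom2 C f g" "hom ?K g f = hom2 C g f" "f \<in> Obj ?K" "g \<in> Obj ?K"
    using C.hom_hom_cat f g by (auto simp: hom_cat_sel)
  have fg: "f \<in> Mor C" "g \<in> Mor C" using f g by (auto simp: hom1_iff)
  have t: "point_arr ?K f g \<alpha> \<in> hom2 Cat (point ?K f) (point ?K g) \<longleftrightarrow> \<alpha> \<in> hom2 C f g" for \<alpha>
    using h by (simp add: hom2_iff[of _ Cat] point_arr_nat_trans[OF K])
  have t': "point_arr ?K g f \<alpha> \<in> hom2 Cat (point ?K g) (point ?K f) \<longleftrightarrow> \<alpha> \<in> hom2 C g f" for \<alpha>
    using h by (simp add: hom2_iff[of _ Cat] point_arr_nat_trans[OF K])
  have e: "\<exists>\<beta>. \<tau> = point_arr ?K g f \<beta>" if "\<tau> \<in> hom2 Cat (point ?K g) (point ?K f)" for \<tau>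
    using nat_trans_eq_point_arr[of \<tau> ?K g f] that by (auto simp: hom2_iff[of _ Cat])
  show ?thesis
  proof
    assume l: "point_arr ?K f g \<alpha> \<in> iso2 Cat (point ?K f) (point ?K g)"
    then obtain \<tau> where "\<tau> \<in> hom2 Cat (point ?K g) (point ?K f)"
      "nt_vcomp \<tau> (point_arr ?K f g \<alpha>) = id_nt (point ?K f)" "nt_vcomp (point_arr ?K f g \<alpha>) \<tau> = id_nt (point ?K g)"
      by (auto simp: iso2_def)
    moreover from this obtain \<beta> where "\<tau> = point_arr ?K g f \<beta>" using e by blast
    ultimately have "\<beta> \<in> hom2 C g f" "\<beta> \<bullet> \<alpha> = Id2 C f" "\<alpha> \<bullet> \<beta> = Id2 C g"
      using t' by (simp_all add: nt_vcomp_point_arr id_nt_point hom_cat_sel)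
    moreover have "\<alpha> \<in> hom2 C f g" using l t by (simp add: iso2_def)
    ultimately show "\<alpha> \<in> iso2 C f g" by (auto simp: C.iso2_iff)
  next
    assume l: "\<alpha> \<in> iso2 C f g"
    then obtain \<beta> where \<beta>: "\<beta> \<in> hom2 C g f" "\<beta> \<bullet> \<alpha> = Id2 C f" "\<alpha> \<bullet> \<beta> = Id2 C g"
      by (auto simp: C.iso2_iff)
    have "point_arr ?K g f \<beta> \<in> hom2 Cat (point ?K g) (point ?K f)" using \<beta> t' by simp
    then show "point_arr ?K f g \<alpha> \<in> iso2 Cat (point ?K f) (point ?K g)"
      using C.iso2_hom2[OF l] t \<beta> unfolding iso2_def
      by (auto simp: nt_vcomp_point_arr id_nt_point hom_cat_sel intro!: bexI[of _ "point_arr ?K g f \<beta>"])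
  qed
qed

end

context two_category
begin

lemma postcomp_point:
  assumes "Y \<in> Ob C" "h \<in> Mor C" "Src C h = Z" "x \<in> hom1 C Y Z"
  shows "ftor_comp (postcomp C Y h) (point (hom_cat C Y Z) x) = point (hom_cat C Y (Trg C h)) (h \<cdot> x)"
  using assms by (simp add: ftor_comp_point[OF postcomp_functor] hom_cat_sel)

lemma postcomp2_point:
  assumes "Y \<in> Ob C" "\<theta> \<in> Cell C" "Src C (CSrc C \<theta>) = Z" "x \<in> hom1 C Y Z"
  shows "nt_hcomp (postcomp2 C Y \<theta>) (id_nt (point (hom_cat C Y Z) x))
    = point_arr (hom_cat C Y (Trg C (CSrc C \<theta>))) (CSrc C \<theta> \<cdot> x) (CTrg C \<theta> \<cdot> x) (\<theta> \<star> Id2 C x)"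
proof -
  have x: "Id2 C x \<in> hom (hom_cat C Y Z) x x" "category (hom_cat C Y Z)"
    using assms(1,2,4) csrc_ctrg[OF assms(2)] src_trg(1)[of "CSrc C \<theta>"] assms(3)
    by (auto simp: hom_iff hom_cat_sel hom1_iff hom_category)
  show ?thesis
    unfolding id_nt_point
    using assms x by (subst nt_hcomp_point_arr) (auto simp: postcomp_functor hom_cat_sel hom1_iff)
qed

lemma postcomp_point_arr:
  assumes "Y \<in> Ob C" "h \<in> Mor C" "Src C h = Z" "x \<in> hom1 C Y Z" "a \<in> hom2 C x y"
  shows "nt_hcomp (id_nt (postcomp C Y h)) (point_arr (hom_cat C Y Z) x y a)
    = point_arr (hom_cat C Y (Trg C h)) (h \<cdot> x) (h \<cdot> y) (Id2 C h \<star> a)"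
proof -
  have [simp]: "x \<in> Mor C" "Src C x = Y" "Trg C x = Z" "a \<in> Cell C" "CSrc C a = x" "CTrg C a = y"
    using assms by (auto simp: hom1_iff hom2_iff)
  have [simp]: "y \<in> Mor C" "Src C y = Y" "Trg C y = Z" "Z \<in> Ob C"
    using csrc_ctrg[of a] src_trg(2)[of x] by auto
  show ?thesis
    using assms(1-3)
    by (subst nt_hcomp_point_arr[where L = "hom_cat C Y (Trg C h)"])
      (simp_all add: postcomp_functor hom_category hom_iff hom_cat_sel hom1_iff)
qed

end

context diagram
begin

lemma cat_cone_point_arr_id:
  assumes "Y \<in> Ob C" "i \<in> Ob I" "x \<in> hom1 C Y (PObj F i)"
  shows "nt_hcomp (id_nt (point (hom_cat C Y (PObj F i)) x)) (id_nt (id_ftor one_cat))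
      = point_arr (hom_cat C Y (PObj F i)) x x (Id2 C x)"
  using assms unfolding id_nt_point
  by (subst nt_hcomp_id_one_cat) (auto simp: C.hom_category hom_iff hom_cat_sel hom1_iff)

text \<open>Evaluated at the only object of the terminal category, the axioms of a pseudo-natural
  transformation \<open>\<Delta>1 \<Rightarrow> C(Y, F-)\<close> are those of a cone on \<open>Y\<close>.\<close>

lemma cat_cone_iff_pcone:
  assumes Y: "Y \<in> Ob C"
  shows "pseudo_nat I Cat (cat_cone Y k) \<longleftrightarrow> pcone Y k"
proof
  assume "pseudo_nat I Cat (cat_cone Y k)"
  then interpret k: pseudo_nat I Cat "cat_cone Y k" .
  note [simp] = Y
  have leg1: "fst k i \<in> hom1 C Y (PObj F i)" if "i \<in> Ob I" for i
    using k.obj_comp[OF that] that cat_functor.obj[of "NObj (cat_cone Y k) i" undefined]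
    by (simp add: hom1_iff[of _ Cat] hom_cat_sel)
  note leg [simp] = leg1[unfolded hom1_iff, THEN conjunct1] leg1[unfolded hom1_iff, THEN conjunct2, THEN conjunct1]
    leg1[unfolded hom1_iff, THEN conjunct2, THEN conjunct2]
  have iso: "snd k u \<in> iso2 C (PMor F u \<cdot> fst k (Src I u)) (fst k (Trg I u))" if [simp]: "u \<in> Mor I" for u
  proof (rule iffD1[OF iso2_Cat_point_arr[of Y "PObj F (Trg I u)"]])
    show "point_arr (hom_cat C Y (PObj F (Trg I u))) (PMor F u \<cdot> fst k (Src I u)) (fst k (Trg I u)) (snd k u)
        \<in> iso2 Cat (point (hom_cat C Y (PObj F (Trg I u))) (PMor F u \<cdot> fst k (Src I u)))
            (point (hom_cat C Y (PObj F (Trg I u))) (fst k (Trg I u)))"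
      using k.mor_comp[of u "Src I u" "Trg I u"]
      by (simp add: hom1_iff C.postcomp_point ftor_comp_id_one_cat C.hom_category hom_cat_sel)
  qed (simp_all add: hom1_iff)
  have [simp]: "snd k u \<in> Cell C" "CSrc C (snd k u) = PMor F u \<cdot> fst k (Src I u)"
    "CTrg C (snd k u) = fst k (Trg I u)" if "u \<in> Mor I" for u
    using C.iso2_hom2[OF iso[OF that]] by (auto simp: hom2_iff)
  show "pcone Y k"
  proof (rule pconeI)
    show "snd k (CTrg I \<alpha>) \<bullet> (PCell F \<alpha> \<star> Id2 C (fst k (Src I (CSrc I \<alpha>)))) = snd k (CSrc I \<alpha>)"
      if [simp]: "\<alpha> \<in> Cell I" for \<alpha>
      using k.natural[of "CSrc I \<alpha>" "Src I (CSrc I \<alpha>)" "Trg I (CSrc I \<alpha>)" \<alpha> "CTrg I \<alpha>"]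
      by (simp add: hom1_iff hom2_iff C.postcomp2_point cat_cone_point_arr_id nt_vcomp_point_arr hom_cat_sel)
    show "snd k (u' \<cdot>\<^bsub>I\<^esub> u) \<bullet> (PComp F u' u \<star> Id2 C (fst k (Src I u)))
        = snd k u' \<bullet> (Id2 C (PMor F u') \<star> snd k u)"
      if [simp]: "u \<in> Mor I" "u' \<in> Mor I" "Src I u' = Trg I u" for u u'
      using k.respects_comp[of u "Src I u" "Trg I u" u' "Trg I u'"]
      by (simp add: hom1_iff hom2_iff C.postcomp2_point cat_cone_point_arr_id nt_vcomp_point_arr hom_cat_sel
          nt_hcomp_id_one_cat C.postcomp_point_arr C.hom_category hom_iff)
    show "snd k (Id1 I i) = Id2 C (fst k i)" if [simp]: "i \<in> Ob I" for i
      using k.respects_id[of i] by (simp add: id_nt_point hom_cat_sel)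
  qed (rule leg1, assumption, rule iso, assumption)
next
  assume k: "pcone Y k"
  note [simp] = Y pcone_leg[OF k] pcone_cell[OF k]
  show "pseudo_nat I Cat (cat_cone Y k)"
  proof (rule pseudo_nat.intro)
    show "NObj (cat_cone Y k) i \<in> hom1 Cat (PObj (NDom (cat_cone Y k)) i) (PObj (NCod (cat_cone Y k)) i)"
      if [simp]: "i \<in> Ob I" for i
      by (simp add: hom1_iff[of _ Cat] point_functor C.hom_category) (simp add: hom_cat_sel hom1_iff)
    show "NMor (cat_cone Y k) u \<in> iso2 Cat (PMor (NCod (cat_cone Y k)) u \<cdot>\<^bsub>Cat\<^esub> NObj (cat_cone Y k) i)
        (NObj (cat_cone Y k) j \<cdot>\<^bsub>Cat\<^esub> PMor (NDom (cat_cone Y k)) u)" if u: "u \<in> hom1 I i j" for u i j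
    proof -
      have [simp]: "u \<in> Mor I" "Src I u = i" "Trg I u = j" "i \<in> Ob I" "j \<in> Ob I" using u by (auto simp: hom1_iff)
      show ?thesis
        using pcone_iso2[OF k, of u]
        by (simp add: C.postcomp_point ftor_comp_id_one_cat C.hom_category hom_cat_sel iso2_Cat_point_arr hom1_iff)
    qed
    show "NMor (cat_cone Y k) v \<bullet>\<^bsub>Cat\<^esub> (PCell (NCod (cat_cone Y k)) \<alpha> \<star>\<^bsub>Cat\<^esub> Id2 Cat (NObj (cat_cone Y k) i))
        = (Id2 Cat (NObj (cat_cone Y k) j) \<star>\<^bsub>Cat\<^esub> PCell (NDom (cat_cone Y k)) \<alpha>) \<bullet>\<^bsub>Cat\<^esub> NMor (cat_cone Y k) u"
      if u: "u \<in> hom1 I i j" "\<alpha> \<in> hom2 I u v" for u i j \<alpha> v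
    proof -
      have e: "i = Src I (CSrc I \<alpha>)" "j = Trg I (CSrc I \<alpha>)" "u = CSrc I \<alpha>" "v = CTrg I \<alpha>"
        and [simp]: "\<alpha> \<in> Cell I"
        using u by (auto simp: hom1_iff hom2_iff)
      show ?thesis
        unfolding e using pcone_nat[OF k, of \<alpha>]
        by (simp add: hom1_iff hom2_iff C.postcomp2_point cat_cone_point_arr_id nt_vcomp_point_arr hom_cat_sel)
    qed
    show "NMor (cat_cone Y k) (u' \<cdot>\<^bsub>I\<^esub> u) \<bullet>\<^bsub>Cat\<^esub>
          (PComp (NCod (cat_cone Y k)) u' u \<star>\<^bsub>Cat\<^esub> Id2 Cat (NObj (cat_cone Y k) i))
        = (Id2 Cat (NObj (cat_cone Y k) h) \<star>\<^bsub>Cat\<^esub> PComp (NDom (cat_cone Y k)) u' u) \<bullet>\<^bsub>Cat\<^esub>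
          (NMor (cat_cone Y k) u' \<star>\<^bsub>Cat\<^esub> Id2 Cat (PMor (NDom (cat_cone Y k)) u)) \<bullet>\<^bsub>Cat\<^esub>
          (Id2 Cat (PMor (NCod (cat_cone Y k)) u') \<star>\<^bsub>Cat\<^esub> NMor (cat_cone Y k) u)"
      if u: "u \<in> hom1 I i j" "u' \<in> hom1 I j h" for u u' i j h
    proof -
      have [simp]: "u \<in> Mor I" "Src I u = i" "Trg I u = j" "i \<in> Ob I" "j \<in> Ob I" "u' \<in> Mor I" "Src I u' = j"
        "Trg I u' = h" "h \<in> Ob I"
        using u by (auto simp: hom1_iff)
      show ?thesis
        using pcone_comp[OF k, of u u']
        by (simp add: hom1_iff hom2_iff C.postcomp2_point cat_cone_point_arr_id nt_vcomp_point_arr hom_cat_sel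
            nt_hcomp_id_one_cat C.postcomp_point_arr C.hom_category hom_iff)
    qed
    show "NMor (cat_cone Y k) (Id1 I i) = Id2 Cat (NObj (cat_cone Y k) i)" if [simp]: "i \<in> Ob I" for i
      using pcone_id[OF k, of i] by (simp add: id_nt_point hom_cat_sel F.map_id1)
  qed (simp_all add: diag_one_pseudo_functor hom_pfun_pseudo_functor)
qed

lemma cat_cone_hom1:
  assumes "Y \<in> Ob C"
  shows "cat_cone Y k \<in> hom1 (Ps I Cat) (diag_ob Cat one_cat) (hom_pfun C F Y) \<longleftrightarrow> pcone Y k"
  using cat_cone_iff_pcone[OF assms, of k] by (simp add: hom1_iff)

lemma cat_cone_exhaust:
  assumes Y: "Y \<in> Ob C" and mu: "\<mu> \<in> hom1 (Ps I Cat) (diag_ob Cat one_cat) (hom_pfun C F Y)"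
  obtains k where "pcone Y k" "\<mu> = cat_cone Y k"
proof -
  have d: "NDom \<mu> = diag_ob Cat one_cat" "NCod \<mu> = hom_pfun C F Y" and "pseudo_nat I Cat \<mu>"
    using mu by (auto simp: hom1_iff)
  then interpret l: pseudo_nat I Cat \<mu> by simp
  define k where "k = ((\<lambda>i. FObj (NObj \<mu> i) undefined), (\<lambda>u. NTMap (NMor \<mu> u) undefined))"
  have obj: "NObj \<mu> i = point (hom_cat C Y (PObj F i)) (fst k i)" "fst k i \<in> hom1 C Y (PObj F i)"
    if "i \<in> Ob I" for i
  proof -
    have f: "cat_functor (NObj \<mu> i)" "FDom (NObj \<mu> i) = one_cat" "FCod (NObj \<mu> i) = hom_cat C Y (PObj F i)"
      using l.obj_comp[OF that] by (auto simp: d hom1_iff)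
    show "NObj \<mu> i = point (hom_cat C Y (PObj F i)) (fst k i)"
      using functor_eq_point[OF f(1,2)] f(3) by (simp add: k_def)
    show "fst k i \<in> hom1 C Y (PObj F i)"
      using cat_functor.obj[OF f(1), of undefined] f by (simp add: k_def hom_cat_sel)
  qed
  have mor: "NMor \<mu> u = point_arr (hom_cat C Y (PObj F (Trg I u))) (PMor F u \<cdot> fst k (Src I u)) (fst k (Trg I u)) (snd k u)"
    if [simp]: "u \<in> Mor I" for u
  proof -
    have "NMor \<mu> u \<in> hom2 Cat (point (hom_cat C Y (PObj F (Trg I u))) (PMor F u \<cdot> fst k (Src I u)))
        (point (hom_cat C Y (PObj F (Trg I u))) (fst k (Trg I u)))"
      using l.mor_comp[of u "Src I u" "Trg I u"] Y
      by (simp add: d hom1_iff[of u] obj C.postcomp_point ftor_comp_id_one_cat C.hom_category hom_cat_sel iso2_def)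
    then show ?thesis
      using nat_trans_eq_point_arr[of "NMor \<mu> u"] by (simp add: hom2_iff k_def)
  qed
  have eq: "\<mu> = cat_cone Y k"
    using d l.obj_ext l.mor_ext by (intro psnat_eqI[of _ _ "Ob I" "Mor I"]) (simp_all add: obj mor)
  then have "pcone Y k" using cat_cone_hom1[OF Y, of k] mu by simp
  then show ?thesis using eq that by blast
qed

lemma cat_modif_iff_pmod:
  assumes Y: "Y \<in> Ob C" and k: "pcone Y k" and k': "pcone Y k'"
  shows "cat_modif Y k k' m \<in> hom2 (Ps I Cat) (cat_cone Y k) (cat_cone Y k') \<longleftrightarrow> pmod k k' m"
proof -
  note [simp] = Y pcone_leg[OF k] pcone_cell[OF k] pcone_leg[OF k'] pcone_cell[OF k']
  have H: "hom (hom_cat C Y (PObj F i)) (fst k i) (fst k' i) = hom2 C (fst k i) (fst k' i)" if "i \<in> Ob I" for i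
    using that by (intro C.hom_hom_cat) (simp add: hom1_iff)
  have cell: "nat_trans (point_arr (hom_cat C Y (PObj F i)) (fst k i) (fst k' i) (m i) :: ('m, 'c, 'm, 'c) ntrans)
      \<longleftrightarrow> m i \<in> hom2 C (fst k i) (fst k' i)" if "i \<in> Ob I" for i
    using that by (simp add: point_arr_nat_trans C.hom_category H) (simp add: hom_cat_sel hom1_iff)
  have compat: "((MObj (cat_modif Y k k' m) (Trg I u) \<star>\<^bsub>Cat\<^esub> Id2 Cat (PMor (NDom (cat_cone Y k)) u)) \<bullet>\<^bsub>Cat\<^esub> NMor (cat_cone Y k) u
        = NMor (cat_cone Y k') u \<bullet>\<^bsub>Cat\<^esub> (Id2 Cat (PMor (NCod (cat_cone Y k)) u) \<star>\<^bsub>Cat\<^esub> MObj (cat_modif Y k k' m) (Src I u)))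
      \<longleftrightarrow> m (Trg I u) \<bullet> snd k u = snd k' u \<bullet> (Id2 C (PMor F u) \<star> m (Src I u))"
    if [simp]: "u \<in> Mor I" and m: "\<And>i. i \<in> Ob I \<Longrightarrow> m i \<in> hom2 C (fst k i) (fst k' i)" for u
    using m[of "Src I u"] m[of "Trg I u"]
    by (simp add: nt_hcomp_id_one_cat C.postcomp_point_arr nt_vcomp_point_arr C.hom_category H hom_cat_sel hom1_iff)
  show ?thesis
  proof
    assume "cat_modif Y k k' m \<in> hom2 (Ps I Cat) (cat_cone Y k) (cat_cone Y k')"
    then have "modification I Cat (cat_modif Y k k' m)" by (simp add: hom2_iff)
    then interpret m: modification I Cat "cat_modif Y k k' m" .
    have c: "m i \<in> hom2 C (fst k i) (fst k' i)" if "i \<in> Ob I" for i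
      using m.comp_cell[OF that] that by (simp add: hom2_iff[of _ Cat] cell)
    show "pmod k k' m"
    proof (rule pmodI[OF c])
      show "m (Trg I u) \<bullet> snd k u = snd k' u \<bullet> (Id2 C (PMor F u) \<star> m (Src I u))" if "u \<in> Mor I" for u
        using m.compatible[of u "Src I u" "Trg I u"] compat[OF that c] that unfolding cat_modif_sel(1,2)
        by (simp only: hom1_iff simp_thms)
    qed
  next
    assume m: "pmod k k' m"
    have c: "m i \<in> hom2 C (fst k i) (fst k' i)" if "i \<in> Ob I" for i
      using pmod_cell[OF m that] by (simp add: hom2_iff)
    have "modification I Cat (cat_modif Y k k' m)"
    proof (rule modification.intro)
      show "MObj (cat_modif Y k k' m) i \<in> hom2 Cat (NObj (MDom (cat_modif Y k k' m)) i) (NObj (MCod (cat_modif Y k k' m)) i)"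
        if "i \<in> Ob I" for i
        using c[OF that] that by (simp add: hom2_iff[of _ Cat] cell)
      show "(MObj (cat_modif Y k k' m) j \<star>\<^bsub>Cat\<^esub> Id2 Cat (PMor (NDom (MDom (cat_modif Y k k' m))) u)) \<bullet>\<^bsub>Cat\<^esub>
            NMor (MDom (cat_modif Y k k' m)) u
          = NMor (MCod (cat_modif Y k k' m)) u \<bullet>\<^bsub>Cat\<^esub>
            (Id2 Cat (PMor (NCod (MDom (cat_modif Y k k' m))) u) \<star>\<^bsub>Cat\<^esub> MObj (cat_modif Y k k' m) i)"
        if "u \<in> hom1 I i j" for u i j
        using compat[of u, OF _ c] pmod_compat[OF m, of u] that unfolding cat_modif_sel(1,2) hom1_iff by blast
    qed (simp_all add: cat_cone_iff_pcone k k')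
    then show "cat_modif Y k k' m \<in> hom2 (Ps I Cat) (cat_cone Y k) (cat_cone Y k')" by (simp add: hom2_iff)
  qed
qed

lemma cat_modif_exhaust:
  assumes Y: "Y \<in> Ob C" and k: "pcone Y k" and k': "pcone Y k'"
    and \<Gamma>: "\<Gamma> \<in> hom2 (Ps I Cat) (cat_cone Y k) (cat_cone Y k')"
  obtains m where "pmod k k' m" "\<Gamma> = cat_modif Y k k' m"
proof -
  have d: "MDom \<Gamma> = cat_cone Y k" "MCod \<Gamma> = cat_cone Y k'" and "modification I Cat \<Gamma>"
    using \<Gamma> by (auto simp: hom2_iff)
  then interpret G: modification I Cat \<Gamma> by simp
  have "MObj \<Gamma> i = point_arr (hom_cat C Y (PObj F i)) (fst k i) (fst k' i) (NTMap (MObj \<Gamma> i) undefined)"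
    if "i \<in> Ob I" for i
    using G.comp_cell[OF that] that by (intro nat_trans_eq_point_arr) (auto simp: d hom2_iff)
  then have eq: "\<Gamma> = cat_modif Y k k' (\<lambda>i. NTMap (MObj \<Gamma> i) undefined)"
    using G.comp_ext d by (intro modif_eqI[of _ _ "Ob I"]) auto
  then have "pmod k k' (\<lambda>i. NTMap (MObj \<Gamma> i) undefined)"
    using cat_modif_iff_pmod[OF Y k k'] \<Gamma> by metis
  then show ?thesis using eq that by blast
qed

lemma cat_modif_eq_iff:
  "cat_modif Y k k' m = cat_modif Y k k' n \<longleftrightarrow> (\<forall>i \<in> Ob I. m i = n i)"
proof
  assume eq: "cat_modif Y k k' m = cat_modif Y k k' n"
  show "\<forall>i \<in> Ob I. m i = n i"
  proof
    show "m i = n i" if "i \<in> Ob I" for i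
      using arg_cong[OF eq, of "\<lambda>x. MObj x i"] that by simp
  qed
next
  assume "\<forall>i \<in> Ob I. m i = n i"
  then show "cat_modif Y k k' m = cat_modif Y k k' n"
    by (intro modif_eqI[of _ _ "Ob I"]) auto
qed

lemma cat_modif_vcomp:
  "modif_vcomp I Cat (cat_modif Y k' k'' n) (cat_modif Y k k' m) = cat_modif Y k k'' (\<lambda>i. n i \<bullet> m i)"
  by (intro modif_eqI[of _ _ "Ob I"]) (auto simp: nt_vcomp_point_arr hom_cat_sel)

lemma cat_modif_id:
  "id_modif I Cat (cat_cone Y k) = cat_modif Y k k (\<lambda>i. Id2 C (fst k i))"
  by (intro modif_eqI[of _ _ "Ob I"]) (auto simp: id_nt_point hom_cat_sel)

end

section \<open>Bi-limits\<close>

lemma hom_psnat_sel [simp]: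
  "NDom (hom_psnat I C F f) = hom_pfun C F (Trg C f)" "NCod (hom_psnat I C F f) = hom_pfun C F (Src C f)"
  "i \<in> Ob I \<Longrightarrow> NObj (hom_psnat I C F f) i = precomp C f (PObj F i)"
  "u \<in> Mor I \<Longrightarrow> NMor (hom_psnat I C F f) u
    = id_nt (ftor_comp (postcomp C (Src C f) (PMor F u)) (precomp C f (PObj F (Src I u))))"
  by (simp_all add: hom_psnat_def)

lemma hom_modif_sel [simp]:
  "MDom (hom_modif I C F \<alpha>) = hom_psnat I C F (CSrc C \<alpha>)" "MCod (hom_modif I C F \<alpha>) = hom_psnat I C F (CTrg C \<alpha>)"
  "i \<in> Ob I \<Longrightarrow> MObj (hom_modif I C F \<alpha>) i = precomp2 C \<alpha> (PObj F i)"
  by (simp_all add: hom_modif_def)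

context diagram
begin

text \<open>The structure cells of \<open>C(c, F-)\<close> are identities, so composing with it only precomposes the legs
  and cells with \<open>c\<close>.\<close>

lemma hom_psnat_cat_cone:
  assumes X: "X \<in> Ob C" and k: "pcone X k" and c: "c \<in> hom1 C Y X"
  shows "psnat_comp I Cat (hom_psnat I C F c) (cat_cone X k) = cat_cone Y (k \<triangleleft> c)"
proof -
  note [simp] = X pcone_leg[OF k] pcone_cell[OF k] c[unfolded hom1_iff]
  have [simp]: "Y \<in> Ob C" using C.src_trg(1)[of c] by simp
  have obj: "NObj (psnat_comp I Cat (hom_psnat I C F c) (cat_cone X k)) i = NObj (cat_cone Y (k \<triangleleft> c)) i"
    if [simp]: "i \<in> Ob I" for i
    by (simp add: ftor_comp_point[OF C.precomp_functor] hom_cat_sel hom1_iff)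
  have mor: "NMor (psnat_comp I Cat (hom_psnat I C F c) (cat_cone X k)) u = NMor (cat_cone Y (k \<triangleleft> c)) u"
    if [simp]: "u \<in> Mor I" for u
  proof -
    let ?G = "ftor_comp (postcomp C Y (PMor F u)) (precomp C c (PObj F (Src I u)))"
    have G: "cat_functor ?G"
      by (rule ftor_comp_functor) (simp_all add: C.precomp_functor C.postcomp_functor)
    have 1: "nt_hcomp (id_nt (precomp C c (PObj F (Trg I u))))
          (point_arr (hom_cat C X (PObj F (Trg I u))) (PMor F u \<cdot> fst k (Src I u)) (fst k (Trg I u)) (snd k u))
        = point_arr (hom_cat C Y (PObj F (Trg I u))) (PMor F u \<cdot> fst k (Src I u) \<cdot> c) (fst k (Trg I u) \<cdot> c) (snd k u \<star> Id2 C c)"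
      by (subst nt_hcomp_point_arr[where L = "hom_cat C Y (PObj F (Trg I u))"])
        (simp_all add: C.precomp_functor C.hom_category hom_iff hom_cat_sel hom1_iff)
    have 2: "nt_hcomp (id_nt ?G) (id_nt (point (hom_cat C X (PObj F (Src I u))) (fst k (Src I u))))
        = point_arr (hom_cat C Y (PObj F (Trg I u))) (PMor F u \<cdot> fst k (Src I u) \<cdot> c) (PMor F u \<cdot> fst k (Src I u) \<cdot> c)
            (Id2 C (PMor F u \<cdot> fst k (Src I u) \<cdot> c))"
      unfolding id_nt_point
      by (subst nt_hcomp_point_arr[where L = "hom_cat C Y (PObj F (Trg I u))"])
        (simp_all add: G C.hom_category hom_iff hom_cat_sel hom1_iff)
    show ?thesis by (simp add: 1 2 nt_vcomp_point_arr hom_cat_sel)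
  qed
  show ?thesis
    by (rule psnat_eqI[of _ _ "Ob I" "Mor I"]) (simp_all only: obj mor psnat_comp_sel(5,6) cat_cone_sel(5,6), simp_all)
qed

lemma hom_modif_cat_cone:
  assumes X: "X \<in> Ob C" and k: "pcone X k" and c: "c \<in> hom1 C Y X" and \<alpha>: "\<alpha> \<in> hom2 C c d"
  shows "modif_hcomp I Cat (hom_modif I C F \<alpha>) (id_modif I Cat (cat_cone X k))
    = cat_modif Y (k \<triangleleft> c) (k \<triangleleft> d) (\<lambda>i. Id2 C (fst k i) \<star> \<alpha>)"
proof -
  note [simp] = X pcone_leg[OF k] pcone_cell[OF k] c[unfolded hom1_iff] \<alpha>[unfolded hom2_iff]
  have [simp]: "d \<in> Mor C" "Src C d = Y" "Trg C d = X" "Y \<in> Ob C"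
    using C.csrc_ctrg[of \<alpha>] C.src_trg(1)[of c] by auto
  have d: "d \<in> hom1 C Y X" by (simp add: hom1_iff)
  have "nt_hcomp (precomp2 C \<alpha> (PObj F i)) (id_nt (point (hom_cat C X (PObj F i)) (fst k i)))
      = point_arr (hom_cat C Y (PObj F i)) (fst k i \<cdot> c) (fst k i \<cdot> d) (Id2 C (fst k i) \<star> \<alpha>)"
    if [simp]: "i \<in> Ob I" for i
    unfolding id_nt_point
    by (subst nt_hcomp_point_arr[where L = "hom_cat C Y (PObj F i)"])
      (simp_all add: C.precomp_functor C.hom_category hom_iff hom_cat_sel hom1_iff)
  then show ?thesis
    by (intro modif_eqI[of _ _ "Ob I"]) (simp_all add: hom_psnat_cat_cone[OF X k c] hom_psnat_cat_cone[OF X k d])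
qed

abbreviation cone_cat where
  "cone_cat Y \<equiv> hom_cat (Ps I Cat) (diag_ob Cat one_cat) (hom_pfun C F Y)"

lemma cone_cat_obj:
  assumes "Y \<in> Ob C"
  shows "Obj (cone_cat Y) = cat_cone Y ` {k. pcone Y k}"
proof -
  have "hom1 (Ps I Cat) (diag_ob Cat one_cat) (hom_pfun C F Y) = cat_cone Y ` {k. pcone Y k}"
  proof (intro equalityI subsetI)
    fix \<mu> assume "\<mu> \<in> hom1 (Ps I Cat) (diag_ob Cat one_cat) (hom_pfun C F Y)"
    then obtain k where "pcone Y k" "\<mu> = cat_cone Y k" by (rule cat_cone_exhaust[OF assms])
    then show "\<mu> \<in> cat_cone Y ` {k. pcone Y k}" by blast
  next
    fix \<mu> assume "\<mu> \<in> cat_cone Y ` {k. pcone Y k}"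
    then show "\<mu> \<in> hom1 (Ps I Cat) (diag_ob Cat one_cat) (hom_pfun C F Y)"
      using cat_cone_hom1[OF assms] by blast
  qed
  then show ?thesis by (simp add: hom_cat_sel(1))
qed

lemma cone_cat_hom:
  assumes Y: "Y \<in> Ob C" and k: "pcone Y k" "pcone Y k'"
  shows "hom (cone_cat Y) (cat_cone Y k) (cat_cone Y k') = cat_modif Y k k' ` {m. pmod k k' m}"
proof -
  have "hom (cone_cat Y) (cat_cone Y k) (cat_cone Y k') = hom2 (Ps I Cat) (cat_cone Y k) (cat_cone Y k')"
    using cat_cone_hom1[OF Y, of k] k(1) by (auto simp: hom_iff hom_cat_sel(2-4) hom2_iff)
  then show ?thesis
    using cat_modif_iff_pmod[OF Y k] cat_modif_exhaust[OF Y k] by blast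
qed

lemma cone_cat_homE:
  assumes Y: "Y \<in> Ob C" and \<Gamma>: "\<Gamma> \<in> hom (cone_cat Y) a b"
  obtains k k' m where "pcone Y k" "pcone Y k'" "pmod k k' m" "a = cat_cone Y k" "b = cat_cone Y k'"
    "\<Gamma> = cat_modif Y k k' m"
proof -
  have a: "a \<in> hom1 (Ps I Cat) (diag_ob Cat one_cat) (hom_pfun C F Y)" and M: "modification I Cat \<Gamma>"
    and ab: "MDom \<Gamma> = a" "MCod \<Gamma> = b"
    using \<Gamma> by (auto simp: hom_iff hom_cat_sel)
  interpret M: modification I Cat \<Gamma> by (rule M)
  have b: "b \<in> hom1 (Ps I Cat) (diag_ob Cat one_cat) (hom_pfun C F Y)"
    using a M.same_dom M.same_cod M.cod_pseudo_nat by (simp add: hom1_iff ab)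
  obtain k where k: "pcone Y k" "a = cat_cone Y k" using cat_cone_exhaust[OF Y a] by blast
  obtain k' where k': "pcone Y k'" "b = cat_cone Y k'" using cat_cone_exhaust[OF Y b] by blast
  show ?thesis
    using \<Gamma> that k k' cone_cat_hom[OF Y k(1) k'(1)] by blast
qed

text \<open>Composable arrows of \<open>cone_cat Y\<close> can be presented with the same intermediate cone.\<close>

lemma cone_cat_homE':
  assumes Y: "Y \<in> Ob C" and k: "pcone Y k" and \<Gamma>: "\<Gamma> \<in> hom (cone_cat Y) (cat_cone Y k) b"
  obtains k' m where "pcone Y k'" "pmod k k' m" "b = cat_cone Y k'" "\<Gamma> = cat_modif Y k k' m"
proof -
  obtain k' where "pcone Y k'" "b = cat_cone Y k'" using cone_cat_homE[OF Y \<Gamma>] by metis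
  then show ?thesis using \<Gamma> cone_cat_hom[OF Y k, of k'] that by blast
qed

lemma category_cone_cat:
  assumes Y: "Y \<in> Ob C"
  shows "category (cone_cat Y)"
proof (rule category.intro)
  show "Dom (cone_cat Y) \<Gamma> \<in> Obj (cone_cat Y)" "Cod (cone_cat Y) \<Gamma> \<in> Obj (cone_cat Y)"
    if "\<Gamma> \<in> Arr (cone_cat Y)" for \<Gamma>
  proof -
    have "\<Gamma> \<in> hom (cone_cat Y) (MDom \<Gamma>) (MCod \<Gamma>)" using that by (simp add: hom_iff hom_cat_sel)
    then obtain k k' where "pcone Y k" "pcone Y k'" "MDom \<Gamma> = cat_cone Y k" "MCod \<Gamma> = cat_cone Y k'"
      using cone_cat_homE[OF Y] by metis
    then show "Dom (cone_cat Y) \<Gamma> \<in> Obj (cone_cat Y)" "Cod (cone_cat Y) \<Gamma> \<in> Obj (cone_cat Y)"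
      using cone_cat_obj[OF Y] by (simp_all add: hom_cat_sel(3,4))
  qed
  show "One (cone_cat Y) a \<in> hom (cone_cat Y) a a" if "a \<in> Obj (cone_cat Y)" for a
  proof -
    obtain k where k: "pcone Y k" "a = cat_cone Y k" using \<open>a \<in> _\<close> cone_cat_obj[OF Y] by auto
    show ?thesis
      using cone_cat_hom[OF Y k(1) k(1)] pmod_id[OF k(1)] unfolding k(2) hom_cat_sel(5) Ps_sel cat_modif_id by blast
  qed
  show "\<Delta> \<odot>\<^bsub>cone_cat Y\<^esub> \<Gamma> \<in> hom (cone_cat Y) a c"
    if \<Gamma>: "\<Gamma> \<in> hom (cone_cat Y) a b" and \<Delta>: "\<Delta> \<in> hom (cone_cat Y) b c" for \<Gamma> \<Delta> a b c
  proof -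
    obtain k k' m where k: "pcone Y k" "pcone Y k'" "pmod k k' m" "a = cat_cone Y k" "b = cat_cone Y k'"
      "\<Gamma> = cat_modif Y k k' m" by (rule cone_cat_homE[OF Y \<Gamma>])
    obtain k'' n where n: "pcone Y k''" "pmod k' k'' n" "c = cat_cone Y k''" "\<Delta> = cat_modif Y k' k'' n"
      by (rule cone_cat_homE'[OF Y k(2) \<Delta>[unfolded k(5)]])
    show ?thesis
      using cone_cat_hom[OF Y k(1) n(1)] pmod_vcomp[OF k(1,2) n(1) k(3) n(2)]
      unfolding k(4,6) n(3,4) hom_cat_sel(6) Ps_sel cat_modif_vcomp by blast
  qed
  show "One (cone_cat Y) b \<odot>\<^bsub>cone_cat Y\<^esub> \<Gamma> = \<Gamma>" "\<Gamma> \<odot>\<^bsub>cone_cat Y\<^esub> One (cone_cat Y) a = \<Gamma>"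
    if \<Gamma>: "\<Gamma> \<in> hom (cone_cat Y) a b" for \<Gamma> a b
    using \<Gamma>
    by (auto elim!: cone_cat_homE[OF Y] simp: hom_cat_sel cat_modif_id cat_modif_vcomp cat_modif_eq_iff pmod_cell)
  show "(\<Theta> \<odot>\<^bsub>cone_cat Y\<^esub> \<Delta>) \<odot>\<^bsub>cone_cat Y\<^esub> \<Gamma> = \<Theta> \<odot>\<^bsub>cone_cat Y\<^esub> \<Delta> \<odot>\<^bsub>cone_cat Y\<^esub> \<Gamma>"
    if \<Gamma>: "\<Gamma> \<in> hom (cone_cat Y) a b" and \<Delta>: "\<Delta> \<in> hom (cone_cat Y) b c" and \<Theta>: "\<Theta> \<in> hom (cone_cat Y) c d"
    for \<Gamma> \<Delta> \<Theta> a b c d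
  proof -
    obtain k k' m where k: "pcone Y k" "pcone Y k'" "pmod k k' m" "a = cat_cone Y k" "b = cat_cone Y k'"
      "\<Gamma> = cat_modif Y k k' m" by (rule cone_cat_homE[OF Y \<Gamma>])
    obtain k'' n where n: "pcone Y k''" "pmod k' k'' n" "c = cat_cone Y k''" "\<Delta> = cat_modif Y k' k'' n"
      by (rule cone_cat_homE'[OF Y k(2) \<Delta>[unfolded k(5)]])
    obtain k3 r where r: "pcone Y k3" "pmod k'' k3 r" "d = cat_cone Y k3" "\<Theta> = cat_modif Y k'' k3 r"
      by (rule cone_cat_homE'[OF Y n(1) \<Theta>[unfolded n(3)]])
    show ?thesis
      using pmod_cell[OF k(3)] pmod_cell[OF n(2)] pmod_cell[OF r(2)]
      unfolding k(6) n(4) r(4) by (simp add: hom_cat_sel cat_modif_vcomp cat_modif_eq_iff)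
  qed
qed

lemma iso_arr_cat_modif:
  assumes Y: "Y \<in> Ob C" and k: "pcone Y k" and k': "pcone Y k'" and m: "pmod k k' m"
  shows "iso_arr (cone_cat Y) (cat_modif Y k k' m) \<longleftrightarrow> piso k k' m"
proof -
  have \<Gamma>: "cat_modif Y k k' m \<in> hom (cone_cat Y) (cat_cone Y k) (cat_cone Y k')"
    using cone_cat_hom[OF Y k k'] m by blast
  have iso: "iso_arr (cone_cat Y) (cat_modif Y k k' m) \<longleftrightarrow>
      (\<exists>n. pmod k' k n \<and> (\<forall>i \<in> Ob I. n i \<bullet> m i = Id2 C (fst k i)) \<and> (\<forall>i \<in> Ob I. m i \<bullet> n i = Id2 C (fst k' i)))"
    using \<Gamma> unfolding iso_arr_def hom_iff[of "cat_modif Y k k' m"]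
    by (simp add: cone_cat_hom[OF Y k' k] hom_cat_sel cat_modif_id cat_modif_vcomp cat_modif_eq_iff)
  show ?thesis
  proof
    assume "iso_arr (cone_cat Y) (cat_modif Y k k' m)"
    then obtain n where n: "pmod k' k n" "\<forall>i \<in> Ob I. n i \<bullet> m i = Id2 C (fst k i)"
      "\<forall>i \<in> Ob I. m i \<bullet> n i = Id2 C (fst k' i)" unfolding iso by blast
    have "m i \<in> iso2 C (fst k i) (fst k' i)" if "i \<in> Ob I" for i
      using n(2,3) that pmod_cell[OF m that] pmod_cell[OF n(1) that]
      by (auto simp: C.iso2_iff hom2_iff intro!: exI[of _ "n i"])
    then show "piso k k' m" using m by (simp add: piso_def)
  next
    assume p: "piso k k' m"
    obtain n where n: "piso k' k n" "\<And>i. i \<in> Ob I \<Longrightarrow> n i \<bullet> m i = Id2 C (fst k i)"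
      "\<And>i. i \<in> Ob I \<Longrightarrow> m i \<bullet> n i = Id2 C (fst k' i)"
      using piso_inverse[OF k k' p] by metis
    then show "iso_arr (cone_cat Y) (cat_modif Y k k' m)" unfolding iso using piso_pmod by blast
  qed
qed

lemma bilimit_comparison_sel:
  assumes X: "X \<in> Ob C" and k: "pcone X k"
  shows "FDom (bilimit_comparison I C F X (cat_cone X k) Y) = hom_cat C Y X"
    "FCod (bilimit_comparison I C F X (cat_cone X k) Y) = cone_cat Y"
    "c \<in> hom1 C Y X \<Longrightarrow> FObj (bilimit_comparison I C F X (cat_cone X k) Y) c = cat_cone Y (k \<triangleleft> c)"
    "c \<in> hom1 C Y X \<Longrightarrow> \<alpha> \<in> hom2 C c d \<Longrightarrow> FArr (bilimit_comparison I C F X (cat_cone X k) Y) \<alpha>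
      = cat_modif Y (k \<triangleleft> c) (k \<triangleleft> d) (\<lambda>i. Id2 C (fst k i) \<star> \<alpha>)"
  using hom_psnat_cat_cone[OF X k] hom_modif_cat_cone[OF X k]
  by (simp_all add: bilimit_comparison_def hom_cat_sel hom2_iff[of _ C])

lemma bilimit_comparison_functor:
  assumes X: "X \<in> Ob C" and k: "pcone X k" and Y: "Y \<in> Ob C"
  shows "cat_functor (bilimit_comparison I C F X (cat_cone X k) Y)" (is "cat_functor ?L")
proof (rule cat_functor.intro)
  note sel = bilimit_comparison_sel[OF X k]
  have hom: "\<alpha> \<in> hom (hom_cat C Y X) c d \<longleftrightarrow> c \<in> hom1 C Y X \<and> d \<in> hom1 C Y X \<and> \<alpha> \<in> hom2 C c d" for \<alpha> c d
    using C.csrc_ctrg[of \<alpha>] by (auto simp: hom_iff hom_cat_sel hom1_iff hom2_iff)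
  note [simp] = pcone_leg[OF k]
  show "category (FDom ?L)" "category (FCod ?L)"
    by (simp_all add: sel C.hom_category X Y category_cone_cat)
  show "FObj ?L \<in> Obj (FDom ?L) \<rightarrow>\<^sub>E Obj (FCod ?L)"
  proof
    show "FObj ?L c \<in> Obj (FCod ?L)" if "c \<in> Obj (FDom ?L)" for c
      using that pcone_precompose[OF k, of c] by (simp add: sel hom_cat_sel(1)[of C] cone_cat_obj[OF Y])
    show "FObj ?L c = undefined" if "c \<notin> Obj (FDom ?L)" for c
      using that by (simp add: bilimit_comparison_def)
  qed
  show "FArr ?L \<in> extensional (Arr (FDom ?L))" by (simp add: bilimit_comparison_def)
  show "FArr ?L \<alpha> \<in> hom (FCod ?L) (FObj ?L c) (FObj ?L d)" if "\<alpha> \<in> hom (FDom ?L) c d" for \<alpha> c d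
    using that pcone_precompose[OF k] pmod_whisker[OF k]
    by (auto simp: sel hom cone_cat_hom[OF Y])
  show "FArr ?L (One (FDom ?L) c) = One (FCod ?L) (FObj ?L c)" if "c \<in> Obj (FDom ?L)" for c
  proof -
    have c: "c \<in> hom1 C Y X" using that by (simp add: sel hom_cat_sel)
    then have i: "Id2 C c \<in> hom2 C c c" by (simp add: hom1_iff hom2_iff)
    show ?thesis
      using c sel(3)[OF c] sel(4)[OF c i]
      by (simp add: sel(1,2) hom_cat_sel(5) cat_modif_id cat_modif_eq_iff hom1_iff)
  qed
  show "FArr ?L (\<beta> \<odot>\<^bsub>FDom ?L\<^esub> \<alpha>) = FArr ?L \<beta> \<odot>\<^bsub>FCod ?L\<^esub> FArr ?L \<alpha>"
    if "\<alpha> \<in> hom (FDom ?L) c d" "\<beta> \<in> hom (FDom ?L) d e" for \<alpha> \<beta> c d e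
  proof -
    have c: "c \<in> hom1 C Y X" and d: "d \<in> hom1 C Y X" and \<alpha>: "\<alpha> \<in> hom2 C c d" and \<beta>: "\<beta> \<in> hom2 C d e"
      using that by (simp_all add: sel hom)
    have \<beta>\<alpha>: "\<beta> \<bullet> \<alpha> \<in> hom2 C c e" using \<alpha> \<beta> by (simp add: hom2_iff)
    have "Id2 C (fst k i) \<star> (\<beta> \<bullet> \<alpha>) = (Id2 C (fst k i) \<star> \<beta>) \<bullet> (Id2 C (fst k i) \<star> \<alpha>)" if "i \<in> Ob I" for i
      using that \<alpha>[unfolded hom2_iff] \<beta>[unfolded hom2_iff] c[unfolded hom1_iff]
      by (intro C.whisker_left_vcomp) simp_all
    then show ?thesis
      by (simp add: sel(1,2) sel(4)[OF c \<alpha>] sel(4)[OF d \<beta>] sel(4)[OF c \<beta>\<alpha>] hom_cat_sel(6) cat_modif_vcomp cat_modif_eq_iff)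
  qed
qed

lemma bilimit_comparison_iff:
  assumes X: "X \<in> Ob C" and k: "pcone X k" and Y: "Y \<in> Ob C"
  shows "adjoint_equivalence (bilimit_comparison I C F X (cat_cone X k) Y) \<longleftrightarrow> factors_at X k Y \<and> lifts_at X k Y"
    (is "adjoint_equivalence ?L \<longleftrightarrow> _")
proof -
  note sel = bilimit_comparison_sel[OF X k]
  have "essentially_surjective ?L \<longleftrightarrow> (\<forall>k'. pcone Y k' \<longrightarrow> (\<exists>c \<in> hom1 C Y X.
      \<exists>e \<in> hom (cone_cat Y) (cat_cone Y (k \<triangleleft> c)) (cat_cone Y k'). iso_arr (cone_cat Y) e))"
    by (auto simp: essentially_surjective_def sel(1,2) sel(3) hom_cat_sel(1)[of C] cone_cat_obj[OF Y])
  also have "\<dots> \<longleftrightarrow> factors_at X k Y"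
    unfolding factors_at_def
  proof (intro all_cong1 imp_cong bex_cong refl)
    fix k' c assume k': "pcone Y k'" and c: "c \<in> hom1 C Y X"
    note kc = pcone_precompose[OF k c]
    show "(\<exists>e \<in> hom (cone_cat Y) (cat_cone Y (k \<triangleleft> c)) (cat_cone Y k'). iso_arr (cone_cat Y) e) \<longleftrightarrow>
        (\<exists>m. piso (k \<triangleleft> c) k' m)"
      using iso_arr_cat_modif[OF Y kc k'] piso_pmod[of "k \<triangleleft> c" k'] unfolding cone_cat_hom[OF Y kc k'] by blast
  qed
  finally have es: "essentially_surjective ?L \<longleftrightarrow> factors_at X k Y" .
  have "bij_betw (FArr ?L) (hom (FDom ?L) c d) (hom (FCod ?L) (FObj ?L c) (FObj ?L d)) \<longleftrightarrow>
      (\<forall>m. pmod (k \<triangleleft> c) (k \<triangleleft> d) m \<longrightarrow> (\<exists>!\<beta>. \<beta> \<in> hom2 C c d \<and> (\<forall>i \<in> Ob I. Id2 C (fst k i) \<star> \<beta> = m i)))"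
    if c: "c \<in> hom1 C Y X" and d: "d \<in> hom1 C Y X" for c d
  proof -
    let ?M = "cat_modif Y (k \<triangleleft> c) (k \<triangleleft> d)"
    have L: "FArr ?L \<beta> = ?M m \<longleftrightarrow> (\<forall>i \<in> Ob I. Id2 C (fst k i) \<star> \<beta> = m i)" if "\<beta> \<in> hom2 C c d" for \<beta> m
      using sel(4)[OF c that] by (simp add: cat_modif_eq_iff)
    have into: "FArr ?L \<beta> \<in> ?M ` {m. pmod (k \<triangleleft> c) (k \<triangleleft> d) m}" if "\<beta> \<in> hom2 C c d" for \<beta>
      using sel(4)[OF c that] pmod_whisker[OF k c that] by blast
    have "bij_betw (FArr ?L) (hom2 C c d) (?M ` {m. pmod (k \<triangleleft> c) (k \<triangleleft> d) m}) \<longleftrightarrow>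
        (\<forall>\<Gamma> \<in> ?M ` {m. pmod (k \<triangleleft> c) (k \<triangleleft> d) m}. \<exists>!\<beta>. \<beta> \<in> hom2 C c d \<and> FArr ?L \<beta> = \<Gamma>)"
      using into unfolding bij_betw_def inj_on_def by (auto simp: image_iff set_eq_iff) metis+
    also have "\<dots> \<longleftrightarrow> (\<forall>m. pmod (k \<triangleleft> c) (k \<triangleleft> d) m \<longrightarrow>
        (\<exists>!\<beta>. \<beta> \<in> hom2 C c d \<and> (\<forall>i \<in> Ob I. Id2 C (fst k i) \<star> \<beta> = m i)))"
      using L by (auto cong: conj_cong)
    finally show ?thesis
      by (simp add: sel(1,2) sel(3)[OF c] sel(3)[OF d] C.hom_hom_cat[OF c]
          cone_cat_hom[OF Y pcone_precompose[OF k c] pcone_precompose[OF k d]])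
  qed
  then have ff: "fully_faithful ?L \<longleftrightarrow> lifts_at X k Y"
    unfolding fully_faithful_def lifts_at_def sel(1)[of Y] hom_cat_sel(1)[of C] by (auto simp: sel(1))
  show ?thesis
    using adjoint_equivalence_imp[of ?L] adjoint_equivalenceI[OF bilimit_comparison_functor[OF X k Y]] es ff
    by blast
qed

lemma is_bilimit_iff:
  assumes X: "X \<in> Ob C" and k: "pcone X k"
  shows "is_bilimit I C F X (cat_cone X k) \<longleftrightarrow> (\<forall>Y \<in> Ob C. factors_at X k Y \<and> lifts_at X k Y)"
  using bilimit_comparison_iff[OF X k] cat_cone_hom1[OF X] X k by (simp add: is_bilimit_def)

lemma bilimit_iff_bi_terminal_cone:
  assumes tensors: "has_tensors_by C arrow_cat"
  shows "(\<exists>X l. is_bilimit I C F X l) \<longleftrightarrow>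
    (\<exists>X l. X \<in> Ob C \<and> l \<in> hom1 (Ps I C) (diag_ob C X) F \<and> bi_terminal (cone_slice I C F) (X, l))"
proof
  assume "\<exists>X l. is_bilimit I C F X l"
  then obtain X l where b: "is_bilimit I C F X l" by blast
  then have X: "X \<in> Ob C" and "l \<in> hom1 (Ps I Cat) (diag_ob Cat one_cat) (hom_pfun C F X)"
    by (auto simp: is_bilimit_def)
  then obtain k where k: "pcone X k" and l: "l = cat_cone X k" by (rule cat_cone_exhaust)
  let ?l = "cone_of X k"
  have cone: "(X, ?l) \<in> cones I C F" by (rule cone_of[OF X k])
  have eq: "cat_cone X (data ?l) = cat_cone X k" using data_cone_of by (simp add: cat_cone_eq_iff)
  have "\<forall>Y \<in> Ob C. factors_at X (data ?l) Y \<and> lifts_at X (data ?l) Y"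
    using b is_bilimit_iff[OF X coneD(7)[OF cone]] unfolding l eq by blast
  then have "bi_terminal (cone_slice I C F) (X, ?l)"
    using bi_terminal_cone_iff[OF cone] lifts_iff_compares[OF tensors coneD(7)[OF cone]] by blast
  then show "\<exists>X l. X \<in> Ob C \<and> l \<in> hom1 (Ps I C) (diag_ob C X) F \<and> bi_terminal (cone_slice I C F) (X, l)"
    using X coneD(2)[OF cone] by blast
next
  assume "\<exists>X l. X \<in> Ob C \<and> l \<in> hom1 (Ps I C) (diag_ob C X) F \<and> bi_terminal (cone_slice I C F) (X, l)"
  then obtain X l where X: "X \<in> Ob C" and cone: "(X, l) \<in> cones I C F"
    and "bi_terminal (cone_slice I C F) (X, l)" by (auto simp: cones_def)
  then have "\<forall>Y \<in> Ob C. factors_at X (data l) Y \<and> lifts_at X (data l) Y"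
    using bi_terminal_cone_iff[OF cone] lifts_iff_compares[OF tensors coneD(7)[OF cone]] by blast
  then show "\<exists>X l. is_bilimit I C F X l"
    using is_bilimit_iff[OF X coneD(7)[OF cone]] by blast
qed

end

theorem corollary7p26:
  fixes I :: "('io, 'im, 'ic) two_cat"
    and C :: "('o, 'm, 'c) two_cat"
    and F :: "('io, 'im, 'ic, 'o, 'm, 'c) pfun"
  assumes "two_category I"
    and "two_category C"
    and "normal_pseudo_functor I C F"
    and "has_tensors_by C arrow_cat"
  shows "(\<exists>X l. is_bilimit I C F X l) \<longleftrightarrow>
    (\<exists>X l. X \<in> Ob C \<and> l \<in> hom1 (Ps I C) (diag_ob C X) F \<and>
      bi_terminal (cone_slice I C F) (X, l))"
proof -
  interpret diagram I C F by (intro diagram.intro assms)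
  show ?thesis by (rule bilimit_iff_bi_terminal_cone) fact
qed

end
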